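(* Let $\Omega\subset\mathbb{R}^d$, $d\in\{2,3\}$, be a bounded Lipschitz domain and let $T>0$. Let $A:\mathbb{R}^d\to\mathbb{R}$ be continuously differentiable, positive on $\mathbb{R}^d\setminus\{\mathbf 0\}$ and positively two-homogeneous, i.e. $A(\lambda\mathbf p)=\lambda^2A(\mathbf p)$ for all $\lambda>0$, $\mathbf p\in\mathbb{R}^d$, and assume that the gradient $A':\mathbb{R}^d\to\mathbb{R}^d$ is strongly monotone, i.e. there is $a_0>0$ with $(A'(\mathbf p)-A'(\mathbf q))\cdot(\mathbf p-\mathbf q)\ge a_0|\mathbf p-\mathbf q|^2$ for all $\mathbf p,\mathbf q\in\mathbb{R}^d$. Let the mobility function $M:\mathbb{R}^d\times\mathbb{R}\to\mathbb{R}$ be a positive constant. Let $\varphi_0\in H^1(\Omega)$, and let $F$ be either (a) a regular potential satisfying both the growth condition (G) and the decomposition condition (D) described in the context, or (b) the logarithmic potential (see context), in which case it is additionally assumed that $|\varphi_0|\le1$ a.e. in $\Omega$ and $|\langle\varphi_0\rangle_\Omega|<1$. Then the weak solution $(\varphi,\mu)$ (in the sense defined in the context) of the anisotropic Cahn--Hilliard equation with potential $F$ and initial datum $\varphi_0$ is unique; that is, any two weak solutions with the same initial datum $\varphi_0$ coincide.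
   Context: Notation: $\Omega_T=(0,T)\times\Omega$; $\langle f\rangle_\Omega=\frac1{|\Omega|}\int_\Omega f\,\mathrm d\mathbf x$ is the spatial mean; $H^1(\Omega)'$ is the dual of $H^1(\Omega)$ with duality pairing $\langle\cdot,\cdot\rangle_{H^1(\Omega)}$. Equation: with interface parameter equal to $1$, the anisotropic Cahn--Hilliard equation is $\partial_t\varphi=\nabla\cdot(M(\nabla\varphi,\varphi)\nabla\mu)$ and $\mu=-\nabla\cdot A'(\nabla\varphi)+F'(\varphi)$ in $\Omega_T$, with $A'(\nabla\varphi)\cdot\mathbf n=0$ and $\nabla\mu\cdot\mathbf n=0$ on $(0,T)\times\partial\Omega$ and $\varphi|_{t=0}=\varphi_0$ in $\Omega$, where $\mathbf n$ is the outer unit normal on $\partial\Omega$. Existence of a weak solution is known in both cases (a) and (b). Growth condition (G): $F:\mathbb{R}\to\mathbb{R}$ is continuously differentiable and there are an exponent $p\in[2,6)$ and constants $B_F,C_F,C_{F'}\ge0$ with $-B_F\le F(s)\le C_F(1+|s|^p)$ and $|F'(s)|\le C_{F'}(1+|s|^{p-1})$ for all $s\in\mathbb{R}$. Decomposition condition (D): there are $F_1,F_2\in C^2(\mathbb{R};\mathbb{R})$ with $F=F_1+F_2$ on $\mathbb{R}$, $F_1$ convex, and $F_2'$ Lipschitz continuous. Logarithmic potential: for constants $\theta>0$ and $\theta_c>0$, $F(s)=\frac\theta2[(1+s)\ln(1+s)+(1-s)\ln(1-s)]+\frac{\theta_c}2(1-s^2)$ for $s\in(-1,1)$, extended continuously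 to $[-1,1]$; $F'$ is defined on $(-1,1)$ only. Energy: $E(\varphi)=\int_\Omega A(\nabla\varphi)+F(\varphi)\,\mathrm d\mathbf x$. Weak solution: a pair $(\varphi,\mu)$ such that (i) $\varphi\in C([0,T];L^2(\Omega))\cap L^\infty(0,T;H^1(\Omega))\cap H^1(0,T;H^1(\Omega)')$, $\mu\in L^2(0,T;H^1(\Omega))$, $F'(\varphi)\in L^2(0,T;L^2(\Omega))$, and, in the case of the logarithmic potential, $|\varphi|<1$ a.e. in $\Omega_T$; (ii) for almost every $t\in[0,T]$ and all $\zeta,\eta\in H^1(\Omega)$: $\langle\partial_t\varphi,\zeta\rangle_{H^1(\Omega)}=-\int_\Omega M(\nabla\varphi,\varphi)\nabla\mu\cdot\nabla\zeta\,\mathrm d\mathbf x$ and $\int_\Omega\mu\eta\,\mathrm d\mathbf x=\int_\Omega A'(\nabla\varphi)\cdot\nabla\eta+F'(\varphi)\eta\,\mathrm d\mathbf x$; and $\varphi(0)=\varphi_0$ a.e. in $\Omega$; (iii) $E(\varphi(t))+\frac12\int_0^t\int_\Omega M(\nabla\varphi,\varphi)|\nabla\mu|^2\,\mathrm d\mathbf x\,\mathrm ds\le E(\varphi_0)$ for almost all $t\in[0,T]$ in the case of a regular potential, and for all $t\in[0,T]$ in the case of the logarithmic potential. *)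

theory Defs
  imports "HOL-Analysis.Analysis" "HOL-Real_Asymp.Real_Asymp"
begin

section \<open>Differentiability and test functions\<close>

definition grad :: "('a::euclidean_space \<Rightarrow> real) \<Rightarrow> 'a \<Rightarrow> 'a" where
  "grad f x = (\<Sum>b\<in>Basis. frechet_derivative f (at x) b *\<^sub>R b)"

primrec Ck :: "nat \<Rightarrow> ('a::euclidean_space \<Rightarrow> real) \<Rightarrow> bool" where
  "Ck 0 f \<longleftrightarrow> continuous_on UNIV f"
| "Ck (Suc k) f \<longleftrightarrow>
     (\<forall>x. f differentiable (at x)) \<and> (\<forall>b\<in>Basis. Ck k (\<lambda>x. frechet_derivative f (at x) b))"

definition test_functions :: "'a::euclidean_space set \<Rightarrow> ('a \<Rightarrow> real) set" where
  "test_functions S =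
     {f. (\<forall>k. Ck k f) \<and> compact (closure {x. f x \<noteq> 0}) \<and> closure {x. f x \<noteq> 0} \<subseteq> S}"

section \<open>Lipschitz domains\<close>

text \<open>Near each boundary point the set is the strict epigraph of a Lipschitz function over the
  hyperplane orthogonal to some unit vector \<open>\<nu>\<close> (an inner direction);
  \<open>\<gamma>\<close> is only evaluated on that hyperplane.\<close>

definition bounded_Lipschitz_domain :: "'a::euclidean_space set \<Rightarrow> bool" where
  "bounded_Lipschitz_domain \<Omega> \<longleftrightarrow>
     \<Omega> \<noteq> {} \<and> open \<Omega> \<and> connected \<Omega> \<and> bounded \<Omega> \<and>
     (\<forall>z\<in>frontier \<Omega>. \<exists>r>0. \<exists>\<nu> \<gamma> L. norm \<nu> = 1 \<and> L-lipschitz_on {y. y \<bullet> \<nu> = 0} (\<gamma> :: 'a \<Rightarrow> real) \<and>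
        \<Omega> \<inter> ball z r = {x \<in> ball z r. \<gamma> (x - (x \<bullet> \<nu>) *\<^sub>R \<nu>) < x \<bullet> \<nu>})"

section \<open>Function spaces over a spatial domain\<close>

text \<open>Elements of Lebesgue and Sobolev spaces are represented by functions (only their values
  on the domain matter), so the norms below are seminorms on representatives and equality in
  these spaces is equality almost everywhere.\<close>

definition L2 :: "'a::euclidean_space set \<Rightarrow> ('a \<Rightarrow> 'b::euclidean_space) set" where
  "L2 \<Omega> = {u. u \<in> borel_measurable (lebesgue_on \<Omega>) \<and>
               integrable (lebesgue_on \<Omega>) (\<lambda>x. (norm (u x))\<^sup>2)}"

definition L2_norm :: "'a::euclidean_space set \<Rightarrow> ('a \<Rightarrow> 'b::euclidean_space) \<Rightarrow> real" where
  "L2_norm \<Omega> u = sqrt (\<integral>x. (norm (u x))\<^sup>2 \<partial>lebesgue_on \<Omega>)"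

definition is_weak_gradient ::
    "'a::euclidean_space set \<Rightarrow> ('a \<Rightarrow> real) \<Rightarrow> ('a \<Rightarrow> 'a) \<Rightarrow> bool" where
  "is_weak_gradient \<Omega> u g \<longleftrightarrow>
     (\<forall>f\<in>test_functions \<Omega>. \<forall>b\<in>Basis.
        (\<integral>x. u x * (grad f x \<bullet> b) \<partial>lebesgue_on \<Omega>) = - (\<integral>x. (g x \<bullet> b) * f x \<partial>lebesgue_on \<Omega>))"

definition H1 :: "'a::euclidean_space set \<Rightarrow> ('a \<Rightarrow> real) set" where
  "H1 \<Omega> = {u \<in> L2 \<Omega>. \<exists>g\<in>L2 \<Omega>. is_weak_gradient \<Omega> u g}"

text \<open>A representative of the weak gradient, which is unique up to null sets.\<close>

definition wgrad :: "'a::euclidean_space set \<Rightarrow> ('a \<Rightarrow> real) \<Rightarrow> 'a \<Rightarrow> 'a" where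
  "wgrad \<Omega> u = (SOME g. g \<in> L2 \<Omega> \<and> is_weak_gradient \<Omega> u g)"

definition H1_norm :: "'a::euclidean_space set \<Rightarrow> ('a \<Rightarrow> real) \<Rightarrow> real" where
  "H1_norm \<Omega> u = sqrt ((L2_norm \<Omega> u)\<^sup>2 + (L2_norm \<Omega> (wgrad \<Omega> u))\<^sup>2)"

text \<open>Boundedness with respect to the seminorm makes a functional on representatives
  well defined on equivalence classes. The duality pairing is application.\<close>

definition H1_dual :: "'a::euclidean_space set \<Rightarrow> (('a \<Rightarrow> real) \<Rightarrow> real) set" where
  "H1_dual \<Omega> = {l.
     (\<forall>u\<in>H1 \<Omega>. \<forall>v\<in>H1 \<Omega>. l (\<lambda>x. u x + v x) = l u + l v) \<and>
     (\<forall>u\<in>H1 \<Omega>. \<forall>c. l (\<lambda>x. c * u x) = c * l u) \<and>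
     (\<exists>C. \<forall>u\<in>H1 \<Omega>. \<bar>l u\<bar> \<le> C * H1_norm \<Omega> u)}"

definition H1_dual_norm :: "'a::euclidean_space set \<Rightarrow> (('a \<Rightarrow> real) \<Rightarrow> real) \<Rightarrow> real" where
  "H1_dual_norm \<Omega> l = (SUP u\<in>{u \<in> H1 \<Omega>. H1_norm \<Omega> u \<le> 1}. \<bar>l u\<bar>)"

text \<open>The embedding of \<open>L2 \<Omega>\<close> into the dual of \<open>H1 \<Omega>\<close>.\<close>

definition L2_functional :: "'a::euclidean_space set \<Rightarrow> ('a \<Rightarrow> real) \<Rightarrow> ('a \<Rightarrow> real) \<Rightarrow> real" where
  "L2_functional \<Omega> u = (\<lambda>\<zeta>. \<integral>x. u x * \<zeta> x \<partial>lebesgue_on \<Omega>)"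

definition spatial_mean :: "'a::euclidean_space set \<Rightarrow> ('a \<Rightarrow> real) \<Rightarrow> real" where
  "spatial_mean \<Omega> u = (1 / measure lebesgue \<Omega>) * (\<integral>x. u x \<partial>lebesgue_on \<Omega>)"

section \<open>Bochner spaces over a time interval\<close>

text \<open>Here \<open>X\<close> is a space of real-valued functions or functionals with (semi)norm \<open>N\<close>.
  It cannot be a type, as it depends on the domain; hence Bochner's definition of strong
  measurability as an almost everywhere limit of simple functions is repeated for carriers.\<close>

definition strongly_measurable ::
    "('b \<Rightarrow> real) set \<Rightarrow> (('b \<Rightarrow> real) \<Rightarrow> real) \<Rightarrow> real set \<Rightarrow> (real \<Rightarrow> 'b \<Rightarrow> real) \<Rightarrow> bool" where
  "strongly_measurable X N I f \<longleftrightarrow>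
     (AE t in lebesgue_on I. f t \<in> X) \<and>
     (\<exists>s. (\<forall>k::nat. simple_function (lebesgue_on I) (s k) \<and> s k ` I \<subseteq> X) \<and>
          (AE t in lebesgue_on I. (\<lambda>k. N (\<lambda>x. s k t x - f t x)) \<longlonglongrightarrow> 0))"

definition Bochner_L2 ::
    "real \<Rightarrow> ('b \<Rightarrow> real) set \<Rightarrow> (('b \<Rightarrow> real) \<Rightarrow> real) \<Rightarrow> (real \<Rightarrow> 'b \<Rightarrow> real) set" where
  "Bochner_L2 T X N = {f. strongly_measurable X N {0<..<T} f \<and>
     integrable (lebesgue_on {0<..<T}) (\<lambda>t. (N (f t))\<^sup>2)}"

definition Bochner_Linf ::
    "real \<Rightarrow> ('b \<Rightarrow> real) set \<Rightarrow> (('b \<Rightarrow> real) \<Rightarrow> real) \<Rightarrow> (real \<Rightarrow> 'b \<Rightarrow> real) set" where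
  "Bochner_Linf T X N = {f. strongly_measurable X N {0<..<T} f \<and>
     (\<exists>C. AE t in lebesgue_on {0<..<T}. N (f t) \<le> C)}"

definition time_continuous ::
    "real \<Rightarrow> ('b \<Rightarrow> real) set \<Rightarrow> (('b \<Rightarrow> real) \<Rightarrow> real) \<Rightarrow> (real \<Rightarrow> 'b \<Rightarrow> real) set" where
  "time_continuous T X N = {f. (\<forall>t\<in>{0..T}. f t \<in> X) \<and>
     (\<forall>t\<in>{0..T}. ((\<lambda>s. N (\<lambda>x. f s x - f t x)) \<longlongrightarrow> 0) (at t within {0..T}))}"

text \<open>\<open>\<psi>\<close> is the distributional time derivative of \<open>\<phi>\<close>, with values in the dual of \<open>H1 \<Omega>\<close>.
  Equality in the dual is equality at every \<open>\<zeta>\<close>, and the Bochner integral in the dual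
  commutes with the evaluation at \<open>\<zeta>\<close>.\<close>

definition is_time_derivative ::
    "'a::euclidean_space set \<Rightarrow> real \<Rightarrow> (real \<Rightarrow> 'a \<Rightarrow> real) \<Rightarrow> (real \<Rightarrow> ('a \<Rightarrow> real) \<Rightarrow> real) \<Rightarrow> bool" where
  "is_time_derivative \<Omega> T \<phi> \<psi> \<longleftrightarrow>
     (\<forall>\<theta>\<in>test_functions {0<..<T}. \<forall>\<zeta>\<in>H1 \<Omega>.
        (\<integral>t. deriv \<theta> t * L2_functional \<Omega> (\<phi> t) \<zeta> \<partial>lebesgue_on {0<..<T}) =
        - (\<integral>t. \<theta> t * \<psi> t \<zeta> \<partial>lebesgue_on {0<..<T}))"

section \<open>Potentials and energy\<close>

definition growth_condition :: "(real \<Rightarrow> real) \<Rightarrow> bool" where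
  "growth_condition F \<longleftrightarrow> Ck 1 F \<and>
     (\<exists>p B\<^sub>F C\<^sub>F C\<^sub>F'. 2 \<le> p \<and> p < 6 \<and> 0 \<le> B\<^sub>F \<and> 0 \<le> C\<^sub>F \<and> 0 \<le> C\<^sub>F' \<and>
        (\<forall>s. - B\<^sub>F \<le> F s \<and> F s \<le> C\<^sub>F * (1 + \<bar>s\<bar> powr p) \<and>
             \<bar>deriv F s\<bar> \<le> C\<^sub>F' * (1 + \<bar>s\<bar> powr (p - 1))))"

definition decomposition_condition :: "(real \<Rightarrow> real) \<Rightarrow> bool" where
  "decomposition_condition F \<longleftrightarrow>
     (\<exists>F\<^sub>1 F\<^sub>2. Ck 2 F\<^sub>1 \<and> Ck 2 F\<^sub>2 \<and> (\<forall>s. F s = F\<^sub>1 s + F\<^sub>2 s) \<and>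
        convex_on UNIV F\<^sub>1 \<and> (\<exists>L. L-lipschitz_on UNIV (deriv F\<^sub>2)))"

text \<open>As \<open>ln 0 = 0\<close>, the formula also gives the continuous extension to \<open>{-1..1}\<close>; values
  outside this interval are irrelevant.\<close>

definition log_potential :: "real \<Rightarrow> real \<Rightarrow> real \<Rightarrow> real" where
  "log_potential \<theta> \<theta>\<^sub>c s =
     \<theta> / 2 * ((1 + s) * ln (1 + s) + (1 - s) * ln (1 - s)) + \<theta>\<^sub>c / 2 * (1 - s\<^sup>2)"

lemma continuous_on_log_potential: "continuous_on {-1..1} (log_potential \<theta> \<theta>\<^sub>c)"
proof -
  have h: "continuous_on {0..} (\<lambda>x::real. x * ln x)"
    unfolding continuous_on_eq_continuous_within
  proof
    fix x :: real assume "x \<in> {0..}"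
    show "continuous (at x within {0..}) (\<lambda>x. x * ln x)"
    proof (cases "x = 0")
      case True
      have "((\<lambda>x::real. x * ln x) \<longlongrightarrow> 0) (at_right 0)" by real_asymp
      then have "((\<lambda>x::real. x * ln x) \<longlongrightarrow> 0) (at 0 within {0..})"
        by (simp add: at_within_Ici_at_right)
      then show ?thesis using True by (simp add: continuous_within)
    next
      case False
      then show ?thesis by (intro continuous_intros) auto
    qed
  qed
  have "continuous_on {-1..1} (\<lambda>s::real. (1 + s) * ln (1 + s))"
    by (rule continuous_on_compose2[OF h]) (auto intro!: continuous_intros)
  moreover have "continuous_on {-1..1} (\<lambda>s::real. (1 - s) * ln (1 - s))"
    by (rule continuous_on_compose2[OF h]) (auto intro!: continuous_intros)
  moreover have "continuous_on {-1..1} (\<lambda>s::real. 1 - s\<^sup>2)"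
    by (intro continuous_intros)
  ultimately show ?thesis
    unfolding log_potential_def[abs_def]
    by (intro continuous_on_add continuous_on_mult_left) assumption+
qed

datatype potential = Regular "real \<Rightarrow> real" | Logarithmic real real

primrec pot :: "potential \<Rightarrow> real \<Rightarrow> real" where
  "pot (Regular F) = F"
| "pot (Logarithmic \<theta> \<theta>\<^sub>c) = log_potential \<theta> \<theta>\<^sub>c"

definition energy ::
    "'a::euclidean_space set \<Rightarrow> ('a \<Rightarrow> real) \<Rightarrow> (real \<Rightarrow> real) \<Rightarrow> ('a \<Rightarrow> real) \<Rightarrow> real" where
  "energy \<Omega> A F u = (\<integral>x. A (wgrad \<Omega> u x) + F (u x) \<partial>lebesgue_on \<Omega>)"

section \<open>Weak solutions of the anisotropic Cahn--Hilliard equation\<close>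

text \<open>Functions on the space-time cylinder are maps from time to spatial functions, so
  ``a.e. in \<open>(0,T) \<times> \<Omega>\<close>'' reads ``a.e. in \<open>\<Omega>\<close> for a.e. \<open>t\<close>''; no jointly measurable
  representative is presupposed.\<close>

definition solution_regularity ::
    "'a::euclidean_space set \<Rightarrow> real \<Rightarrow> potential \<Rightarrow>
     (real \<Rightarrow> 'a \<Rightarrow> real) \<Rightarrow> (real \<Rightarrow> 'a \<Rightarrow> real) \<Rightarrow> (real \<Rightarrow> ('a \<Rightarrow> real) \<Rightarrow> real) \<Rightarrow> bool" where
  "solution_regularity \<Omega> T P \<phi> \<mu> \<phi>\<^sub>t \<longleftrightarrow>
     \<phi> \<in> time_continuous T (L2 \<Omega>) (L2_norm \<Omega>) \<and>
     \<phi> \<in> Bochner_Linf T (H1 \<Omega>) (H1_norm \<Omega>) \<and>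
     (\<lambda>t. L2_functional \<Omega> (\<phi> t)) \<in> Bochner_L2 T (H1_dual \<Omega>) (H1_dual_norm \<Omega>) \<and>
     \<phi>\<^sub>t \<in> Bochner_L2 T (H1_dual \<Omega>) (H1_dual_norm \<Omega>) \<and>
     is_time_derivative \<Omega> T \<phi> \<phi>\<^sub>t \<and>
     \<mu> \<in> Bochner_L2 T (H1 \<Omega>) (H1_norm \<Omega>) \<and>
     (\<lambda>t x. deriv (pot P) (\<phi> t x)) \<in> Bochner_L2 T (L2 \<Omega>) (L2_norm \<Omega>) \<and>
     (case P of Regular F \<Rightarrow> True
      | Logarithmic \<theta> \<theta>\<^sub>c \<Rightarrow>
          (AE t in lebesgue_on {0<..<T}. AE x in lebesgue_on \<Omega>. \<bar>\<phi> t x\<bar> < 1))"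

definition weak_equations ::
    "'a::euclidean_space set \<Rightarrow> real \<Rightarrow> ('a \<Rightarrow> real) \<Rightarrow> ('a \<Rightarrow> real \<Rightarrow> real) \<Rightarrow> potential \<Rightarrow>
     (real \<Rightarrow> 'a \<Rightarrow> real) \<Rightarrow> (real \<Rightarrow> 'a \<Rightarrow> real) \<Rightarrow> (real \<Rightarrow> ('a \<Rightarrow> real) \<Rightarrow> real) \<Rightarrow> bool" where
  "weak_equations \<Omega> T A M P \<phi> \<mu> \<phi>\<^sub>t \<longleftrightarrow>
     (AE t in lebesgue_on {0..T}. \<forall>\<zeta>\<in>H1 \<Omega>. \<forall>\<eta>\<in>H1 \<Omega>.
        \<phi>\<^sub>t t \<zeta> = - (\<integral>x. M (wgrad \<Omega> (\<phi> t) x) (\<phi> t x) * (wgrad \<Omega> (\<mu> t) x \<bullet> wgrad \<Omega> \<zeta> x)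
                      \<partial>lebesgue_on \<Omega>) \<and>
        (\<integral>x. \<mu> t x * \<eta> x \<partial>lebesgue_on \<Omega>) =
          (\<integral>x. grad A (wgrad \<Omega> (\<phi> t) x) \<bullet> wgrad \<Omega> \<eta> x + deriv (pot P) (\<phi> t x) * \<eta> x
             \<partial>lebesgue_on \<Omega>))"

definition energy_inequality_at ::
    "'a::euclidean_space set \<Rightarrow> ('a \<Rightarrow> real) \<Rightarrow> ('a \<Rightarrow> real \<Rightarrow> real) \<Rightarrow> potential \<Rightarrow> ('a \<Rightarrow> real) \<Rightarrow>
     (real \<Rightarrow> 'a \<Rightarrow> real) \<Rightarrow> (real \<Rightarrow> 'a \<Rightarrow> real) \<Rightarrow> real \<Rightarrow> bool" where
  "energy_inequality_at \<Omega> A M P \<phi>\<^sub>0 \<phi> \<mu> t \<longleftrightarrow>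
     energy \<Omega> A (pot P) (\<phi> t) +
       1/2 * (\<integral>s. (\<integral>x. M (wgrad \<Omega> (\<phi> s) x) (\<phi> s x) * (norm (wgrad \<Omega> (\<mu> s) x))\<^sup>2
                       \<partial>lebesgue_on \<Omega>) \<partial>lebesgue_on {0..t})
     \<le> energy \<Omega> A (pot P) \<phi>\<^sub>0"

definition weak_solution ::
    "'a::euclidean_space set \<Rightarrow> real \<Rightarrow> ('a \<Rightarrow> real) \<Rightarrow> ('a \<Rightarrow> real \<Rightarrow> real) \<Rightarrow> potential \<Rightarrow>
     ('a \<Rightarrow> real) \<Rightarrow> (real \<Rightarrow> 'a \<Rightarrow> real) \<Rightarrow> (real \<Rightarrow> 'a \<Rightarrow> real) \<Rightarrow> bool" where
  "weak_solution \<Omega> T A M P \<phi>\<^sub>0 \<phi> \<mu> \<longleftrightarrow>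
     (\<exists>\<phi>\<^sub>t. solution_regularity \<Omega> T P \<phi> \<mu> \<phi>\<^sub>t \<and> weak_equations \<Omega> T A M P \<phi> \<mu> \<phi>\<^sub>t) \<and>
     (AE x in lebesgue_on \<Omega>. \<phi> 0 x = \<phi>\<^sub>0 x) \<and>
     (case P of
        Regular F \<Rightarrow> AE t in lebesgue_on {0..T}. energy_inequality_at \<Omega> A M P \<phi>\<^sub>0 \<phi> \<mu> t
      | Logarithmic \<theta> \<theta>\<^sub>c \<Rightarrow> \<forall>t\<in>{0..T}. energy_inequality_at \<Omega> A M P \<phi>\<^sub>0 \<phi> \<mu> t)"

end

theory Submission
  imports Defs
begin

text \<open>Let \<open>\<phi>\<close> and \<open>\<mu>\<close> be the differences of the two solutions and let \<open>W(t)\<close> be the integral of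
  \<open>\<nabla>\<mu>\<close> over \<open>(0,t)\<close> in \<open>L2 \<Omega>\<close>. Integrating the first equation in time gives
  \<open>(\<phi>(t), \<zeta>) = - m (W(t), \<nabla>\<zeta>)\<close> for all \<open>\<zeta>\<close> in \<open>H1 \<Omega>\<close>; thus \<open>W\<close> takes the role of the gradient of the
  inverse Laplacian of \<open>\<phi>\<close>, and neither the Poincare inequality nor the solvability of a Neumann
  problem is needed. With \<open>\<zeta> = \<mu>(t)\<close> this yields \<open>(\<phi>, \<mu>) = - m (W, W')\<close>, and with \<open>\<zeta> = \<phi>(t)\<close> it
  yields \<open>\<parallel>\<phi>\<parallel>\<^sup>2 \<le> m \<parallel>W\<parallel> \<parallel>\<nabla>\<phi>\<parallel>\<close>. The second equation tested with \<open>\<phi>\<close>, strong monotonicity of the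
  gradient of \<open>A\<close> and the one-sided Lipschitz bound on \<open>F'\<close> give
  \<open>(\<mu>, \<phi>) \<ge> a\<^sub>0 \<parallel>\<nabla>\<phi>\<parallel>\<^sup>2 - L \<parallel>\<phi>\<parallel>\<^sup>2\<close>. Combining these,
  \<open>(W, W') \<le> K \<parallel>W\<parallel>\<^sup>2\<close> with \<open>W(0) = 0\<close>, so \<open>W = 0\<close> by Gronwall's inequality.\<close>

section \<open>Smooth functions\<close>

text \<open>Elements of the spaces are representatives, and \<open>wgrad\<close> picks one weak
  gradient for each. Even the gradient of a difference is thus known only up to a null set, by the
  fundamental lemma of the calculus of variations, for which smooth bumps over boxes are built. The
  time derivative is likewise seen only through smooth test functions; smoothed indicators of time
  intervals turn it into increments. Constant mobility makes the difference of the fluxes linear in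
  \<nabla>\<mu>, so that one curve W represents its time integral. Two-homogeneity bounds
  \<open>grad A\<close> linearly, which makes the terms of the second equation integrable. The
  constant is K = L^2 m / (4 a_0): the potential loses L \<parallel>\<phi>\<parallel>^2 <= L m
  \<parallel>W\<parallel> \<parallel>\<nabla>\<phi>\<parallel>; this minus a_0
  \<parallel>\<nabla>\<phi>\<parallel>^2 is at most L^2 m^2 \<parallel>W\<parallel>^2 / (4 a_0)
  whatever \<parallel>\<nabla>\<phi>\<parallel> is; one factor m cancels against m (W, W'). Once W =
  0, the interpolation bound gives \<phi> = 0, and the second equation tested with \<mu> itself
  gives \<mu> = 0.\<close>

lemma Ck_SucI:
  assumes "\<And>x. (f has_derivative D x) (at x)" and "\<And>b. b \<in> Basis \<Longrightarrow> Ck k (\<lambda>x. D x b)"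
  shows "Ck (Suc k) f"
proof -
  have "frechet_derivative f (at x) = D x" for x
    using assms(1) frechet_derivative_at by metis
  then show ?thesis using assms by (auto simp: differentiable_def)
qed

text \<open>Derivatives on the whole space are unique. Together with the introduction rule this
  trades the chosen \<open>frechet_derivative\<close> for any explicit family \<open>D\<close>, with
  which the closure properties below compute.\<close>

lemma Ck_SucE:
  assumes "Ck (Suc k) f"
  obtains D where "\<And>x. (f has_derivative D x) (at x)" and "\<And>b. b \<in> Basis \<Longrightarrow> Ck k (\<lambda>x. D x b)"
  using assms that[of "\<lambda>x. frechet_derivative f (at x)"] by (auto simp: frechet_derivative_works)

lemma Ck_Suc_imp_Ck: "Ck (Suc k) f \<Longrightarrow> Ck k f"
proof (induction k arbitrary: f)
  case 0
  then show ?case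
    by (auto intro!: continuous_at_imp_continuous_on differentiable_imp_continuous_within)
next
  case (Suc k)
  then show ?case by simp
qed

lemma Ck_imp_continuous_on: "Ck k f \<Longrightarrow> continuous_on S f"
proof (induction k)
  case 0
  then show ?case using continuous_on_subset by auto
next
  case (Suc k)
  then show ?case using Ck_Suc_imp_Ck by blast
qed

lemma Ck_const: "Ck k (\<lambda>x. c)"
proof (induction k arbitrary: c)
  case (Suc k)
  show ?case by (rule Ck_SucI[where D = "\<lambda>x h. 0"]) (auto simp: Suc)
qed simp

lemma Ck_add: "Ck k f \<Longrightarrow> Ck k g \<Longrightarrow> Ck k (\<lambda>x. f x + g x)"
proof (induction k arbitrary: f g)
  case 0
  then show ?case by (simp add: continuous_on_add)
next
  case (Suc k)
  obtain D where D: "\<And>x. (f has_derivative D x) (at x)"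
    "\<And>b. b \<in> Basis \<Longrightarrow> Ck k (\<lambda>x. D x b)" by (rule Ck_SucE[OF Suc.prems(1)]) (rule that)
  obtain G where G: "\<And>x. (g has_derivative G x) (at x)"
    "\<And>b. b \<in> Basis \<Longrightarrow> Ck k (\<lambda>x. G x b)" by (rule Ck_SucE[OF Suc.prems(2)]) (rule that)
  show ?case
  proof (rule Ck_SucI)
    show "((\<lambda>x. f x + g x) has_derivative (\<lambda>h. D x h + G x h)) (at x)" for x
      using D(1) G(1) by (rule has_derivative_add)
    show "Ck k (\<lambda>x. D x b + G x b)" if "b \<in> Basis" for b
      using D(2) G(2) that by (intro Suc.IH)
  qed
qed

lemma Ck_mult: "Ck k f \<Longrightarrow> Ck k g \<Longrightarrow> Ck k (\<lambda>x. f x * g x)"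
proof (induction k arbitrary: f g)
  case 0
  then show ?case by (simp add: continuous_on_mult)
next
  case (Suc k)
  obtain D where D: "\<And>x. (f has_derivative D x) (at x)"
    "\<And>b. b \<in> Basis \<Longrightarrow> Ck k (\<lambda>x. D x b)" by (rule Ck_SucE[OF Suc.prems(1)]) (rule that)
  obtain G where G: "\<And>x. (g has_derivative G x) (at x)"
    "\<And>b. b \<in> Basis \<Longrightarrow> Ck k (\<lambda>x. G x b)" by (rule Ck_SucE[OF Suc.prems(2)]) (rule that)
  show ?case
  proof (rule Ck_SucI)
    show "((\<lambda>x. f x * g x) has_derivative (\<lambda>h. f x * G x h + D x h * g x)) (at x)" for x
      using D(1) G(1) by (rule has_derivative_mult)
    show "Ck k (\<lambda>x. f x * G x b + D x b * g x)" if "b \<in> Basis" for b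
      using Suc.prems[THEN Ck_Suc_imp_Ck] D(2)[OF that] G(2)[OF that]
      by (intro Ck_add Suc.IH)
  qed
qed

lemma Ck_prod: "finite I \<Longrightarrow> (\<And>i. i \<in> I \<Longrightarrow> Ck k (f i)) \<Longrightarrow> Ck k (\<lambda>x. \<Prod>i\<in>I. f i x)"
  by (induction I rule: finite_induct) (auto intro: Ck_const Ck_mult)

lemma Ck_compose_affine:
  fixes h :: "real \<Rightarrow> real"
  shows "Ck k h \<Longrightarrow> Ck k (\<lambda>x. h (x \<bullet> b + c))"
proof (induction k arbitrary: h)
  case 0
  then have "continuous_on UNIV h" by simp
  then have "continuous_on UNIV (\<lambda>x. h (x \<bullet> b + c))"
    by (rule continuous_on_compose2) (auto intro!: continuous_intros)
  then show ?case by simp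
next
  case (Suc k)
  obtain D where D: "\<And>x. (h has_derivative D x) (at x)"
    "\<And>b. b \<in> Basis \<Longrightarrow> Ck k (\<lambda>x. D x b)" by (rule Ck_SucE[OF Suc.prems]) (rule that)
  \<comment> \<open>A linear map on the reals is multiplication by its value at 1. This splits the
    inner derivative off as the constant factor \<open>i \<bullet> b\<close> and leaves a function
    of one real variable for the induction hypothesis.\<close>
  have lin: "D x y = y * D x 1" for x y
    using linear_scale[OF has_derivative_linear[OF D(1)], of x y 1] by simp
  show ?case
  proof (rule Ck_SucI[where D = "\<lambda>x v. D (x \<bullet> b + c) (v \<bullet> b)"])
    fix x
    show "((\<lambda>x. h (x \<bullet> b + c)) has_derivative (\<lambda>v. D (x \<bullet> b + c) (v \<bullet> b))) (at x)"
      by (rule has_derivative_compose[OF _ D(1), where f = "\<lambda>x. x \<bullet> b + c"])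
         (auto intro!: derivative_eq_intros)
  next
    fix i :: 'a assume "i \<in> Basis"
    have "Ck k (\<lambda>x. (i \<bullet> b) * D (x \<bullet> b + c) 1)"
      by (intro Ck_mult Ck_const Suc.IH[of "\<lambda>y. D y 1"]) (simp add: D)
    then show "Ck k (\<lambda>x. D (x \<bullet> b + c) (i \<bullet> b))"
      by (subst lin) simp
  qed
qed

lemma Ck_compose_affine_real:
  fixes h :: "real \<Rightarrow> real"
  shows "Ck k h \<Longrightarrow> Ck k (\<lambda>x. h (x * b + c))"
  using Ck_compose_affine[of k h b c] by simp

lemma Ck_Suc_DERIV:
  fixes h :: "real \<Rightarrow> real"
  assumes "\<And>x. (h has_real_derivative h' x) (at x)" and "Ck k h'"
  shows "Ck (Suc k) h"
  using assms
  by (intro Ck_SucI[where D = "\<lambda>x y. h' x * y"]) (auto simp: has_field_derivative_def)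

text \<open>For \<open>j = 0\<close> this is the classical smooth function that is flat at the
  origin. The powers in front close the family under differentiation: the derivative of member
  \<open>j\<close> combines members \<open>j + 1\<close> and \<open>j + 2\<close>, so smoothness
  follows by one induction over all \<open>j\<close> at once.\<close>

definition flat_exp :: "nat \<Rightarrow> real \<Rightarrow> real" where
  "flat_exp j x = (if x > 0 then inverse x ^ j * exp (- inverse x) else 0)"

lemma flat_exp_tendsto_0: "(flat_exp j \<longlongrightarrow> 0) (at 0)"
proof -
  have "((\<lambda>y::real. y ^ j / exp y) \<longlongrightarrow> 0) at_top" by (rule tendsto_power_div_exp_0)
  then have "((\<lambda>x::real. inverse x ^ j / exp (inverse x)) \<longlongrightarrow> 0) (at_right 0)"
    by (rule filterlim_compose[OF _ filterlim_inverse_at_top_right])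
  then have "(flat_exp j \<longlongrightarrow> 0) (at_right 0)"
    by (rule Lim_transform_eventually)
       (auto simp: flat_exp_def exp_minus divide_inverse eventually_at_filter)
  moreover have "(flat_exp j \<longlongrightarrow> 0) (at_left 0)"
    by (rule Lim_transform_eventually[OF tendsto_const])
       (auto simp: flat_exp_def eventually_at_filter)
  ultimately show ?thesis
    using filterlim_split_at by blast
qed

lemma flat_exp_DERIV:
  "(flat_exp j has_real_derivative (- real j * flat_exp (Suc j) x + flat_exp (j + 2) x)) (at x)"
proof -
  consider "x > 0" | "x < 0" | "x = 0" by linarith
  then show ?thesis
  proof cases
    case 1
    have "((\<lambda>x. inverse x ^ j * exp (- inverse x)) has_real_derivative
        real j * inverse x ^ (j - 1) * - (inverse x)\<^sup>2 * exp (- inverse x) +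
        inverse x ^ j * (exp (- inverse x) * (inverse x)\<^sup>2)) (at x)"
      using 1 by (auto intro!: derivative_eq_intros simp: power2_eq_square)
    moreover have "real j * inverse x ^ (j - 1) * - (inverse x)\<^sup>2 * exp (- inverse x) +
        inverse x ^ j * (exp (- inverse x) * (inverse x)\<^sup>2) =
        - real j * flat_exp (Suc j) x + flat_exp (j + 2) x"
      using 1 by (cases j) (auto simp: flat_exp_def power2_eq_square algebra_simps)
    ultimately have "((\<lambda>x. inverse x ^ j * exp (- inverse x)) has_real_derivative
        - real j * flat_exp (Suc j) x + flat_exp (j + 2) x) (at x)" by simp
    then show ?thesis
      using 1 by (elim has_field_derivative_transform_within_open[where S = "{0<..}"])
        (auto simp: flat_exp_def)
  next
    case 2
    have "((\<lambda>x. 0) has_real_derivative (- real j * flat_exp (Suc j) x + flat_exp (j + 2) x)) (at x)"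
      using 2 by (auto simp: flat_exp_def)
    then show ?thesis
      using 2 by (elim has_field_derivative_transform_within_open[where S = "{..<0}"])
        (auto simp: flat_exp_def)
  next
    case 3
    \<comment> \<open>The difference quotient at the origin is again a member of the family,
      \<open>flat_exp (Suc j)\<close>, whose limit is already known.\<close>
    have "((\<lambda>h. (flat_exp j (0 + h) - flat_exp j 0) / h) \<longlongrightarrow> 0) (at 0)"
      by (rule Lim_transform_eventually[OF flat_exp_tendsto_0[of "Suc j"]])
         (auto simp: flat_exp_def eventually_at_filter field_simps)
    then show ?thesis using 3 by (simp add: DERIV_def flat_exp_def)
  qed
qed

lemma Ck_flat_exp: "Ck k (flat_exp j)"
proof (induction k arbitrary: j)
  case 0
  have "isCont (flat_exp j) x" for x
    using flat_exp_DERIV by (rule DERIV_isCont)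
  then show ?case by (simp add: continuous_at_imp_continuous_on)
next
  case (Suc k)
  show ?case
    by (rule Ck_Suc_DERIV[OF flat_exp_DERIV]) (rule Ck_add[OF Ck_mult[OF Ck_const Suc] Suc])
qed

lemma flat_exp_nonneg: "0 \<le> flat_exp j x"
  by (simp add: flat_exp_def)

lemma flat_exp_0_le_1: "flat_exp 0 x \<le> 1"
  by (simp add: flat_exp_def)

lemma flat_exp_scaled_tendsto:
  "(\<lambda>n. flat_exp 0 (real (Suc n) * x)) \<longlonglongrightarrow> (if x > 0 then 1 else 0)"
proof (cases "x > 0")
  case True
  have "(\<lambda>n. exp (- inverse (real (Suc n) * x))) \<longlonglongrightarrow> 1"
    using True by real_asymp
  then show ?thesis using True by (simp add: flat_exp_def)
next
  case False
  then have "\<not> real (Suc n) * x > 0" for n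
    by (simp add: zero_less_mult_iff)
  then show ?thesis using False by (simp add: flat_exp_def)
qed

text \<open>Scaling the arguments by \<open>Suc n\<close> drives the values to 1 inside the box
  without enlarging the support, so the indicator of a box is approximated from inside and no
  convolution is required.\<close>

definition box_bump :: "nat \<Rightarrow> 'a::euclidean_space \<Rightarrow> 'a \<Rightarrow> 'a \<Rightarrow> real" where
  "box_bump n a c x = (\<Prod>b\<in>Basis. flat_exp 0 (real (Suc n) * (x \<bullet> b - a \<bullet> b)) *
                                   flat_exp 0 (real (Suc n) * (c \<bullet> b - x \<bullet> b)))"

lemma Ck_box_bump: "Ck k (box_bump n a c)"
proof -
  have "Ck k (\<lambda>x::'a. flat_exp 0 (real (Suc n) * (x \<bullet> b - a \<bullet> b)))" for b
    using Ck_compose_affine[OF Ck_flat_exp, of k 0 "real (Suc n) *\<^sub>R b" "- (real (Suc n) * (a \<bullet> b))"]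
    by (simp add: algebra_simps)
  moreover have "Ck k (\<lambda>x::'a. flat_exp 0 (real (Suc n) * (c \<bullet> b - x \<bullet> b)))" for b
    using Ck_compose_affine[OF Ck_flat_exp, of k 0 "- (real (Suc n) *\<^sub>R b)" "real (Suc n) * (c \<bullet> b)"]
    by (simp add: algebra_simps)
  ultimately show ?thesis
    unfolding box_bump_def[abs_def] by (intro Ck_prod Ck_mult) auto
qed

lemma box_bump_outside: "x \<notin> box a c \<Longrightarrow> box_bump n a c x = 0"
  by (force simp: box_bump_def mem_box flat_exp_def zero_less_mult_iff)

lemma box_bump_bounds: "0 \<le> box_bump n a c x" "box_bump n a c x \<le> 1"
  by (auto simp: box_bump_def flat_exp_nonneg flat_exp_0_le_1
      intro!: prod_nonneg prod_le_1 mult_nonneg_nonneg mult_le_one)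

lemma box_bump_tendsto: "(\<lambda>n. box_bump n a c x) \<longlonglongrightarrow> indicat_real (box a c) x"
proof -
  have "(\<lambda>n. box_bump n a c x) \<longlonglongrightarrow>
      (\<Prod>b\<in>Basis. (if x \<bullet> b - a \<bullet> b > 0 then 1 else 0) * (if c \<bullet> b - x \<bullet> b > 0 then 1 else 0))"
    unfolding box_bump_def by (intro tendsto_prod tendsto_mult flat_exp_scaled_tendsto)
  also have "(\<Prod>b\<in>Basis. (if x \<bullet> b - a \<bullet> b > 0 then 1 else 0) * (if c \<bullet> b - x \<bullet> b > 0 then 1 else 0))
      = indicat_real (box a c) x"
  proof (cases "x \<in> box a c")
    case True
    then show ?thesis by (auto simp: mem_box intro!: prod.neutral)
  next
    case False
    then show ?thesis by (force simp: mem_box)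
  qed
  finally show ?thesis .
qed

lemma box_bump_test_function:
  assumes "cbox a c \<subseteq> S"
  shows "box_bump n a c \<in> test_functions S"
proof -
  have sub: "{x. box_bump n a c x \<noteq> 0} \<subseteq> cbox a c"
    using box_bump_outside box_subset_cbox by blast
  then have "closure {x. box_bump n a c x \<noteq> 0} \<subseteq> cbox a c"
    by (intro closure_minimal) auto
  then show ?thesis
    using assms bounded_subset[OF bounded_cbox sub]
    by (auto simp: test_functions_def Ck_box_bump)
qed

section \<open>Functions of time with an integrable weak derivative\<close>

lemma Ck_inverse: "Ck k f \<Longrightarrow> (\<And>x. f x \<noteq> 0) \<Longrightarrow> Ck k (\<lambda>x. inverse (f x))"
proof (induction k)
  case 0
  then show ?case by (simp add: continuous_on_inverse)
next
  case (Suc k)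
  obtain D where D: "\<And>x. (f has_derivative D x) (at x)"
    "\<And>b. b \<in> Basis \<Longrightarrow> Ck k (\<lambda>x. D x b)" by (rule Ck_SucE[OF Suc.prems(1)]) (rule that)
  have inv: "Ck k (\<lambda>x. inverse (f x))"
    using Suc Ck_Suc_imp_Ck by blast
  show ?case
  proof (rule Ck_SucI)
    show "((\<lambda>x. inverse (f x)) has_derivative (\<lambda>h. - (inverse (f x) * D x h * inverse (f x)))) (at x)" for x
      by (rule Deriv.has_derivative_inverse[OF Suc.prems(2) D(1)])
    show "Ck k (\<lambda>x. - (inverse (f x) * D x b * inverse (f x)))" if "b \<in> Basis" for b
      using Ck_mult[OF Ck_const[of k "-1"] Ck_mult[OF Ck_mult[OF inv D(2)[OF that]] inv]] by simp
  qed
qed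

text \<open>Unlike \<open>flat_exp 0\<close>, this quotient reaches the value 1 exactly, for
  arguments from 1 on. The difference of two shifted copies therefore has compact support.\<close>

definition smooth_step :: "real \<Rightarrow> real" where
  "smooth_step x = flat_exp 0 x * inverse (flat_exp 0 x + flat_exp 0 (1 - x))"

lemma smooth_step_denominator_pos: "flat_exp 0 x + flat_exp 0 (1 - x) > 0"
proof (cases "x > 0")
  case True
  then have "flat_exp 0 x > 0" by (simp add: flat_exp_def)
  then show ?thesis using flat_exp_nonneg[of 0 "1 - x"] by linarith
next
  case False
  then have "flat_exp 0 (1 - x) > 0" by (simp add: flat_exp_def)
  then show ?thesis using flat_exp_nonneg[of 0 x] by linarith
qed

lemma Ck_smooth_step: "Ck k smooth_step"
proof -
  have "Ck k (\<lambda>x::real. flat_exp 0 (1 - x))"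
    using Ck_compose_affine_real[OF Ck_flat_exp, of k 0 "-1" 1] by (simp add: algebra_simps)
  then show ?thesis
    unfolding smooth_step_def[abs_def] using smooth_step_denominator_pos
    by (intro Ck_mult Ck_inverse Ck_add Ck_flat_exp) (auto simp: less_le)
qed

lemma smooth_step_eq_0: "x \<le> 0 \<Longrightarrow> smooth_step x = 0"
  by (simp add: smooth_step_def flat_exp_def)

lemma smooth_step_eq_1: "x \<ge> 1 \<Longrightarrow> smooth_step x = 1"
  by (simp add: smooth_step_def flat_exp_def)

lemma smooth_step_bounds: "0 \<le> smooth_step x" "smooth_step x \<le> 1"
  using smooth_step_denominator_pos[of x] flat_exp_nonneg[of 0 x] flat_exp_nonneg[of 0 "1 - x"]
  by (auto simp: smooth_step_def field_simps)

text \<open>A kernel of integral one supported in [0,1]; its dilations concentrate at the origin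
  from the right and act as an approximate identity.\<close>

definition smooth_step' :: "real \<Rightarrow> real" where
  "smooth_step' = deriv smooth_step"

lemma smooth_step_DERIV: "(smooth_step has_real_derivative smooth_step' x) (at x)"
  and smooth_step'_continuous: "continuous_on UNIV smooth_step'"
proof -
  obtain D where D: "\<And>x. (smooth_step has_derivative D x) (at x)"
    "\<And>b. b \<in> Basis \<Longrightarrow> Ck 0 (\<lambda>x. D x b)" by (rule Ck_SucE[OF Ck_smooth_step]) (rule that)
  have lin: "D x y = D x 1 * y" for x y
    using linear_scale[OF has_derivative_linear[OF D(1)], of x y 1] by simp
  then have DERIV: "(smooth_step has_real_derivative D x 1) (at x)" for x
    using D(1)[of x] unfolding has_field_derivative_def by (metis (no_types, lifting) ext)
  then have eq: "smooth_step' x = D x 1" for x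
    by (simp add: smooth_step'_def DERIV_imp_deriv)
  show "(smooth_step has_real_derivative smooth_step' x) (at x)"
    using DERIV by (simp add: eq)
  show "continuous_on UNIV smooth_step'"
    using D(2)[of 1] by (simp add: eq[abs_def])
qed

lemma smooth_step'_eq_0: "x \<notin> {0..1} \<Longrightarrow> smooth_step' x = 0"
proof -
  assume "x \<notin> {0..1}"
  then consider "x < 0" | "x > 1" by fastforce
  then have "(smooth_step has_real_derivative 0) (at x)"
  proof cases
    case 1
    show ?thesis
      by (rule has_field_derivative_transform_within_open[where S = "{..<0}" and f = "\<lambda>_. 0"])
        (use 1 in \<open>auto simp: smooth_step_eq_0\<close>)
  next
    case 2
    show ?thesis
      by (rule has_field_derivative_transform_within_open[where S = "{1<..}" and f = "\<lambda>_. 1"])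
        (use 2 in \<open>auto simp: smooth_step_eq_1\<close>)
  qed
  then show ?thesis using smooth_step_DERIV DERIV_unique by blast
qed

lemma smooth_step'_integral: "has_bochner_integral lborel smooth_step' 1"
proof -
  have "has_bochner_integral lborel (\<lambda>x. smooth_step' x * indicator {0..1} x) (smooth_step 1 - smooth_step 0)"
    by (rule has_bochner_integral_FTC_Icc_real[OF _ smooth_step_DERIV])
       (use smooth_step'_continuous in \<open>auto simp: continuous_on_eq_continuous_at\<close>)
  moreover have "(\<lambda>x. smooth_step' x * indicator {0..1} x) = smooth_step'"
    by (rule ext) (use smooth_step'_eq_0 in \<open>auto simp: indicator_def\<close>)
  ultimately show ?thesis
    by (simp add: smooth_step_eq_0 smooth_step_eq_1)
qed

lemma smooth_step_scaled_tendsto: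
  "(\<lambda>n. smooth_step (real (Suc n) * x)) \<longlonglongrightarrow> (if x > 0 then 1 else 0)"
proof (cases "x > 0")
  case True
  obtain N :: nat where N: "1 < real N * x" using reals_Archimedean3[OF True] by blast
  have "smooth_step (real (Suc n) * x) = 1" if "n \<ge> N" for n
  proof (rule smooth_step_eq_1)
    have "real N * x \<le> real (Suc n) * x" using that True by (intro mult_right_mono) auto
    then show "1 \<le> real (Suc n) * x" using N by linarith
  qed
  then have "\<forall>\<^sub>F n in sequentially. smooth_step (real (Suc n) * x) = 1"
    unfolding eventually_sequentially by blast
  then show ?thesis using True by (simp add: tendsto_eventually)
next
  case False
  then have "smooth_step (real (Suc n) * x) = 0" for n
    by (intro smooth_step_eq_0) (simp add: mult_le_0_iff)
  then show ?thesis using False by simp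
qed

text \<open>The substitution \<open>t = a + y / Suc n\<close> moves the scaling from the kernel into
  the argument of \<open>l\<close>. The kernel is then fixed, and dominated convergence applies with
  a multiple of its absolute value as majorant.\<close>

lemma smooth_step'_mollifies:
  fixes l :: "real \<Rightarrow> real"
  assumes l: "continuous_on {0..T} l" and a: "0 < a" "a < T"
  shows "(\<lambda>n. \<integral>t. real (Suc n) * smooth_step' (real (Suc n) * (t - a)) * l t \<partial>lebesgue_on {0<..<T})
    \<longlonglongrightarrow> l a"
proof -
  \<comment> \<open>Extension by zero allows the affine substitution on the whole line; continuity
    survives at \<open>a\<close> because \<open>a\<close> is an interior point.\<close>
  define L where "L t = indicat_real {0<..<T} t * l t" for t
  have "continuous_on {0<..<T} l"
    using l by (rule continuous_on_subset) auto
  then have L[measurable]: "L \<in> borel_measurable borel"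
    using borel_measurable_continuous_on_indicator[of "{0<..<T}" l] by (simp add: L_def[abs_def])
  have [measurable]: "smooth_step' \<in> borel_measurable borel"
    using smooth_step'_continuous by (rule borel_measurable_continuous_onI)
  have "\<exists>B. \<forall>t\<in>{0..T}. \<bar>l t\<bar> \<le> B"
    using compact_imp_bounded[OF compact_continuous_image[OF l]] by (auto simp: bounded_iff)
  then obtain B where B: "\<And>t. t \<in> {0..T} \<Longrightarrow> \<bar>l t\<bar> \<le> B" by blast
  have "0 \<le> B" using B[of a] a by auto
  then have LB: "\<bar>L t\<bar> \<le> B" for t using B[of t] by (auto simp: L_def indicator_def)
  have "(\<lambda>n. \<integral>y. smooth_step' y * L (a + y / real (Suc n)) \<partial>lborel) \<longlonglongrightarrow> (\<integral>y. smooth_step' y * l a \<partial>lborel)"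
  proof (rule integral_dominated_convergence[where w = "\<lambda>y. B * \<bar>smooth_step' y\<bar>"])
    show "integrable lborel (\<lambda>y. B * \<bar>smooth_step' y\<bar>)"
      using smooth_step'_integral by (auto simp: has_bochner_integral_iff)
    show "AE y in lborel. norm (smooth_step' y * L (a + y / real (Suc n))) \<le> B * \<bar>smooth_step' y\<bar>" for n
      using LB by (intro AE_I2) (simp add: abs_mult mult.commute[of B] mult_left_mono)
    have "\<forall>\<^sub>F t in nhds a. L t = l t"
      using eventually_nhds_in_open[of "{0<..<T}" a] a by (auto simp: L_def elim!: eventually_mono)
    then have "isCont L a"
      using \<open>continuous_on {0<..<T} l\<close> a by (simp add: isCont_cong continuous_on_eq_continuous_at)
    moreover have "L a = l a" using a by (simp add: L_def)
    ultimately have "(\<lambda>n. L (a + y / real (Suc n))) \<longlonglongrightarrow> l a" for y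
    proof -
      have "(\<lambda>n. a + y / real (Suc n)) \<longlonglongrightarrow> a" by real_asymp
      then show ?thesis using isCont_tendsto_compose[OF \<open>isCont L a\<close>] \<open>L a = l a\<close> by metis
    qed
    then show "AE y in lborel. (\<lambda>n. smooth_step' y * L (a + y / real (Suc n))) \<longlonglongrightarrow> smooth_step' y * l a"
      by (intro AE_I2 tendsto_mult tendsto_const)
  qed measurable
  moreover have "(\<integral>y. smooth_step' y * l a \<partial>lborel) = l a"
    using smooth_step'_integral by (simp add: has_bochner_integral_iff)
  moreover have "(\<integral>t. real (Suc n) * smooth_step' (real (Suc n) * (t - a)) * l t \<partial>lebesgue_on {0<..<T}) =
      (\<integral>y. smooth_step' y * L (a + y / real (Suc n)) \<partial>lborel)" for n
  proof -
    let ?f = "\<lambda>t. real (Suc n) * smooth_step' (real (Suc n) * (t - a)) * L t"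
    have "(\<integral>t. real (Suc n) * smooth_step' (real (Suc n) * (t - a)) * l t \<partial>lebesgue_on {0<..<T}) =
        (\<integral>t. ?f t \<partial>lebesgue)"
      by (simp add: integral_restrict_space L_def mult_ac)
    also have "\<dots> = (\<integral>t. ?f t \<partial>lborel)"
      by (rule integral_completion) measurable
    also have "\<dots> = \<bar>1 / real (Suc n)\<bar> *\<^sub>R (\<integral>y. ?f (a + 1 / real (Suc n) * y) \<partial>lborel)"
      by (rule lborel_integral_real_affine) simp
    also have "\<dots> = (\<integral>y. \<bar>1 / real (Suc n)\<bar> *\<^sub>R ?f (a + 1 / real (Suc n) * y) \<partial>lborel)"
      by (rule integral_scaleR_right[symmetric]) 
    also have "\<dots> = (\<integral>y. smooth_step' y * L (a + y / real (Suc n)) \<partial>lborel)"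
      by (intro Bochner_Integration.integral_cong) (simp_all del: of_nat_Suc)
    finally show ?thesis .
  qed
  ultimately show ?thesis by (simp only:)
qed

text \<open>A smoothed indicator of (a,b]. Its derivative is an approximate point mass at
  \<open>a\<close> minus one at \<open>b\<close>, so that testing with it produces an increment in
  the limit.\<close>

definition interval_bump :: "nat \<Rightarrow> real \<Rightarrow> real \<Rightarrow> real \<Rightarrow> real" where
  "interval_bump n a b t = smooth_step (real (Suc n) * (t - a)) - smooth_step (real (Suc n) * (t - b))"

lemma interval_bump_DERIV:
  "(interval_bump n a b has_real_derivative
    real (Suc n) * smooth_step' (real (Suc n) * (t - a)) -
    real (Suc n) * smooth_step' (real (Suc n) * (t - b))) (at t)"
proof -
  have *: "((\<lambda>t. smooth_step (real (Suc n) * (t - c))) has_real_derivative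
      smooth_step' (real (Suc n) * (t - c)) * real (Suc n)) (at t)" for c
    by (rule DERIV_chain2[OF smooth_step_DERIV]) (auto intro!: derivative_eq_intros)
  show ?thesis
    unfolding interval_bump_def[abs_def]
    using DERIV_diff[OF *[of a] *[of b]] by (simp add: mult.commute)
qed

text \<open>The right transition ends at \<open>b + 1 / Suc n\<close>; the third hypothesis says
  that this happens before \<open>T\<close>.\<close>

lemma interval_bump_test_function:
  assumes "0 < a" "a < b" "1 < real (Suc n) * (T - b)"
  shows "interval_bump n a b \<in> test_functions {0<..<T}"
proof -
  have scaled: "Ck k (\<lambda>t. smooth_step (real (Suc n) * (t - c)))" for k c
    using Ck_compose_affine_real[OF Ck_smooth_step, of k "real (Suc n)" "- real (Suc n) * c"]
    by (simp add: algebra_simps)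
  have smooth: "Ck k (interval_bump n a b)" for k
  proof -
    have "Ck k (\<lambda>t. smooth_step (real (Suc n) * (t - a)) + (-1) * smooth_step (real (Suc n) * (t - b)))"
      by (intro Ck_add Ck_mult Ck_const scaled)
    then show ?thesis by (simp add: interval_bump_def[abs_def])
  qed
  define c where "c = b + 1 / real (Suc n)"
  have "c < T"
  proof -
    have "1 / real (Suc n) < T - b"
      using assms(3) by (simp add: divide_less_eq mult.commute)
    then show ?thesis by (simp add: c_def)
  qed
  have sub: "{t. interval_bump n a b t \<noteq> 0} \<subseteq> {a..c}"
  proof
    fix t assume t: "t \<in> {t. interval_bump n a b t \<noteq> 0}"
    have "interval_bump n a b t = 0" if "t < a"
    proof -
      have "real (Suc n) * (t - a) \<le> 0" "real (Suc n) * (t - b) \<le> 0"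
        using that assms(2) by (auto simp: mult_le_0_iff)
      then show ?thesis by (simp add: interval_bump_def smooth_step_eq_0)
    qed
    moreover have "interval_bump n a b t = 0" if "t > c"
    proof -
      have "1 / real (Suc n) \<le> t - b" using that by (simp add: c_def)
      then have "1 \<le> real (Suc n) * (t - b)"
        by (simp add: divide_le_eq mult.commute)
      moreover have "real (Suc n) * (t - b) \<le> real (Suc n) * (t - a)"
        using assms(2) by (intro mult_left_mono) auto
      ultimately have "smooth_step (real (Suc n) * (t - a)) = 1" "smooth_step (real (Suc n) * (t - b)) = 1"
        by (intro smooth_step_eq_1; linarith)+
      then show ?thesis by (simp only: interval_bump_def diff_self)
    qed
    ultimately show "t \<in> {a..c}" using t by fastforce
  qed
  then have "closure {t. interval_bump n a b t \<noteq> 0} \<subseteq> {a..c}"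
    by (intro closure_minimal) auto
  moreover have "{a..c} \<subseteq> {0<..<T}" using assms(1) \<open>c < T\<close> by auto
  moreover have "bounded {t. interval_bump n a b t \<noteq> 0}"
    using bounded_subset[OF bounded_closed_interval sub] .
  ultimately show ?thesis
    by (auto simp: test_functions_def smooth)
qed

lemma interval_bump_tendsto:
  assumes "a < b"
  shows "(\<lambda>n. interval_bump n a b t) \<longlonglongrightarrow> indicat_real {a<..b} t"
proof -
  have "(\<lambda>n. interval_bump n a b t) \<longlonglongrightarrow> (if t - a > 0 then 1 else 0) - (if t - b > 0 then 1 else 0)"
    unfolding interval_bump_def by (intro tendsto_diff smooth_step_scaled_tendsto)
  also have "(if t - a > 0 then 1 else 0) - (if t - b > 0 then 1 else 0) = indicat_real {a<..b} t"
    using assms by (auto simp: indicator_def)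
  finally show ?thesis .
qed

lemma integrable_lebesgue_on_subset:
  fixes f :: "'a::euclidean_space \<Rightarrow> 'b::euclidean_space"
  assumes "integrable (lebesgue_on S) f" and "T \<subseteq> S" and "S \<in> sets lebesgue" and "T \<in> sets lebesgue"
  shows "integrable (lebesgue_on T) f"
  using set_integrable_subset[of lebesgue S f T] assms
  by (simp add: set_integrable_def integrable_restrict_space)

text \<open>Test with \<open>interval_bump n a b\<close> and let \<open>n\<close> grow: the left
  side tends to \<open>l a - l b\<close> by mollification, the right side converges by dominated
  convergence with majorant the absolute value of \<open>\<psi>\<close>.\<close>

lemma weak_derivative_increment_interior:
  fixes l \<psi> :: "real \<Rightarrow> real"
  assumes l: "continuous_on {0..T} l"
    and \<psi>: "integrable (lebesgue_on {0<..<T}) \<psi>"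
    and weak: "\<And>\<theta>. \<theta> \<in> test_functions {0<..<T} \<Longrightarrow>
      (\<integral>t. deriv \<theta> t * l t \<partial>lebesgue_on {0<..<T}) = - (\<integral>t. \<theta> t * \<psi> t \<partial>lebesgue_on {0<..<T})"
    and ab: "0 < a" "a < b" "b < T"
  shows "l b - l a = (\<integral>t. indicat_real {a<..b} t * \<psi> t \<partial>lebesgue_on {0<..<T})"
proof -
  let ?M = "lebesgue_on {0<..<T}"
  have int: "integrable ?M (\<lambda>t. real (Suc n) * smooth_step' (real (Suc n) * (t - c)) * l t)" for n c
  proof -
    have "continuous_on {0..T} (\<lambda>t. real (Suc n) * smooth_step' (real (Suc n) * (t - c)) * l t)"
      by (intro continuous_intros l continuous_on_compose2[OF smooth_step'_continuous]) auto
    then have "integrable (lebesgue_on {0..T}) (\<lambda>t. real (Suc n) * smooth_step' (real (Suc n) * (t - c)) * l t)"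
      by (rule continuous_imp_integrable_real)
    then show ?thesis by (rule integrable_lebesgue_on_subset) auto
  qed
  have lim_l: "(\<lambda>n. \<integral>t. deriv (interval_bump n a b) t * l t \<partial>?M) \<longlonglongrightarrow> l a - l b"
  proof -
    have "(\<integral>t. deriv (interval_bump n a b) t * l t \<partial>?M) =
        (\<integral>t. real (Suc n) * smooth_step' (real (Suc n) * (t - a)) * l t \<partial>?M) -
        (\<integral>t. real (Suc n) * smooth_step' (real (Suc n) * (t - b)) * l t \<partial>?M)" for n
      by (subst Bochner_Integration.integral_diff[symmetric, OF int int])
         (simp add: DERIV_imp_deriv[OF interval_bump_DERIV] left_diff_distrib)
    then show ?thesis
      using tendsto_diff[OF smooth_step'_mollifies[OF l, of a] smooth_step'_mollifies[OF l, of b]] ab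
      by simp
  qed
  have lim_psi: "(\<lambda>n. \<integral>t. interval_bump n a b t * \<psi> t \<partial>?M) \<longlonglongrightarrow> (\<integral>t. indicat_real {a<..b} t * \<psi> t \<partial>?M)"
  proof (rule integral_dominated_convergence[where w = "\<lambda>t. norm (\<psi> t)"])
    have "interval_bump n a b \<in> borel_measurable borel" for n
      using DERIV_continuous_on[OF has_field_derivative_at_within[OF interval_bump_DERIV]]
      by (rule borel_measurable_continuous_onI)
    then have "interval_bump n a b \<in> borel_measurable ?M" for n
      by (intro measurable_restrict_space1 measurable_completion) simp
    then show "(\<lambda>t. interval_bump n a b t * \<psi> t) \<in> borel_measurable ?M" for n
      by (rule borel_measurable_times[OF _ borel_measurable_integrable[OF \<psi>]])
    have "(\<lambda>t. indicat_real {a<..b} t) \<in> borel_measurable ?M"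
      by (intro measurable_restrict_space1 measurable_completion) simp
    then show "(\<lambda>t. indicat_real {a<..b} t * \<psi> t) \<in> borel_measurable ?M"
      by (rule borel_measurable_times[OF _ borel_measurable_integrable[OF \<psi>]])
    show "integrable ?M (\<lambda>t. norm (\<psi> t))" using \<psi> by simp
    show "AE t in ?M. (\<lambda>n. interval_bump n a b t * \<psi> t) \<longlonglongrightarrow> indicat_real {a<..b} t * \<psi> t"
      by (intro AE_I2 tendsto_mult tendsto_const interval_bump_tendsto ab)
    have "\<bar>interval_bump n a b t\<bar> \<le> 1" for n t
      using smooth_step_bounds[of "real (Suc n) * (t - a)"] smooth_step_bounds[of "real (Suc n) * (t - b)"]
      unfolding interval_bump_def by linarith
    then show "AE t in ?M. norm (interval_bump n a b t * \<psi> t) \<le> norm (\<psi> t)" for n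
      by (intro AE_I2) (simp add: abs_mult mult_left_le_one_le)
  qed
  have "\<forall>\<^sub>F n in sequentially. (\<integral>t. deriv (interval_bump n a b) t * l t \<partial>?M) =
      - (\<integral>t. interval_bump n a b t * \<psi> t \<partial>?M)"
  proof -
    obtain N :: nat where N: "1 < real N * (T - b)" using reals_Archimedean3[of "T - b"] ab by auto
    have "interval_bump n a b \<in> test_functions {0<..<T}" if "n \<ge> N" for n
    proof (rule interval_bump_test_function)
      have "real N * (T - b) \<le> real (Suc n) * (T - b)" using that ab by (intro mult_right_mono) auto
      then show "1 < real (Suc n) * (T - b)" using N by linarith
    qed (use ab in auto)
    then show ?thesis
      unfolding eventually_sequentially using weak by blast
  qed
  then have "(\<lambda>n. \<integral>t. deriv (interval_bump n a b) t * l t \<partial>?M) \<longlonglongrightarrow>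
      - (\<integral>t. indicat_real {a<..b} t * \<psi> t \<partial>?M)"
    by (intro Lim_transform_eventually[OF tendsto_minus[OF lim_psi]]) (simp add: eq_commute)
  with lim_l have "l a - l b = - (\<integral>t. indicat_real {a<..b} t * \<psi> t \<partial>?M)"
    by (rule LIMSEQ_unique)
  then show ?thesis by simp
qed

text \<open>Test functions vanish near both ends of the time interval. The increment formula is
  therefore extended from interior points, by continuity of \<open>l\<close> on the left and
  integrability of \<open>\<psi>\<close> on the right.\<close>

lemma weak_derivative_increment:
  fixes l \<psi> :: "real \<Rightarrow> real"
  assumes l: "continuous_on {0..T} l"
    and \<psi>: "integrable (lebesgue_on {0<..<T}) \<psi>"
    and weak: "\<And>\<theta>. \<theta> \<in> test_functions {0<..<T} \<Longrightarrow>
      (\<integral>t. deriv \<theta> t * l t \<partial>lebesgue_on {0<..<T}) = - (\<integral>t. \<theta> t * \<psi> t \<partial>lebesgue_on {0<..<T})"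
    and t: "t \<in> {0..T}"
  shows "l t - l 0 = (\<integral>s. indicat_real {0<..<t} s * \<psi> s \<partial>lebesgue_on {0<..<T})"
proof (cases "t = 0")
  case True
  then show ?thesis by simp
next
  case False
  then have "t > 0" using t by simp
  let ?M = "lebesgue_on {0<..<T}"
  \<comment> \<open>The shift by 3 separates the two points for every \<open>n\<close>: the first is
    at most t/3 and the second at least 2t/3. The second also stays below \<open>T\<close> when
    \<open>t = T\<close>.\<close>
  let ?a = "\<lambda>n::nat. t / (real n + 3)" and ?b = "\<lambda>n::nat. t - t / (real n + 3)"
  have ab: "0 < ?a n" "?a n < ?b n" "?b n < T" for n
  proof -
    show "0 < ?a n" using \<open>t > 0\<close> by simp
    then show "?b n < T" using t by simp
    have "?a n \<le> t / 3" using \<open>t > 0\<close> by (intro divide_left_mono) auto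
    then show "?a n < ?b n" using \<open>t > 0\<close> by linarith
  qed
  have lim: "?a \<longlonglongrightarrow> 0" "?b \<longlonglongrightarrow> t" by real_asymp+
  have "(\<lambda>n. l (?b n) - l (?a n)) \<longlonglongrightarrow> l t - l 0"
  proof (intro tendsto_diff)
    have b: "?b n \<in> {0..T}" and a: "?a n \<in> {0..T}" for n
      using ab[of n] by (auto simp del: divide_le_eq)
    show "(\<lambda>n. l (?b n)) \<longlonglongrightarrow> l t"
      using continuous_on_tendsto_compose[OF l lim(2) t] b by simp
    show "(\<lambda>n. l (?a n)) \<longlonglongrightarrow> l 0"
      using continuous_on_tendsto_compose[OF l lim(1)] a t by simp
  qed
  moreover have "(\<lambda>n. \<integral>s. indicat_real {?a n<..?b n} s * \<psi> s \<partial>?M) \<longlonglongrightarrow>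
      (\<integral>s. indicat_real {0<..<t} s * \<psi> s \<partial>?M)"
  proof (rule integral_dominated_convergence[where w = "\<lambda>s. norm (\<psi> s)"])
    have ind: "(\<lambda>s. indicat_real {c<..d} s) \<in> borel_measurable ?M"
      "(\<lambda>s. indicat_real {c<..<d} s) \<in> borel_measurable ?M" for c d
      by (intro measurable_restrict_space1 measurable_completion; simp)+
    show "(\<lambda>s. indicat_real {?a n<..?b n} s * \<psi> s) \<in> borel_measurable ?M"
      "(\<lambda>s. indicat_real {0<..<t} s * \<psi> s) \<in> borel_measurable ?M" for n
      by (intro borel_measurable_times ind borel_measurable_integrable[OF \<psi>])+
    show "integrable ?M (\<lambda>s. norm (\<psi> s))" using \<psi> by simp
    show "AE s in ?M. norm (indicat_real {?a n<..?b n} s * \<psi> s) \<le> norm (\<psi> s)" for n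
      by (intro AE_I2) (auto simp: indicator_def)
    show "AE s in ?M. (\<lambda>n. indicat_real {?a n<..?b n} s * \<psi> s) \<longlonglongrightarrow> indicat_real {0<..<t} s * \<psi> s"
    proof (intro AE_I2 tendsto_mult tendsto_const tendsto_eventually)
      fix s
      show "\<forall>\<^sub>F n in sequentially. indicat_real {?a n<..?b n} s = indicat_real {0<..<t} s"
      proof (cases "s \<in> {0<..<t}")
        case True
        then have "\<forall>\<^sub>F n in sequentially. ?a n < s" "\<forall>\<^sub>F n in sequentially. s < ?b n"
          using order_tendstoD(2)[OF lim(1), of s] order_tendstoD(1)[OF lim(2), of s] by auto
        then show ?thesis by eventually_elim (use True in auto)
      next
        case False
        then have "s \<notin> {?a n<..?b n}" for n
          using ab(1)[of n] unfolding greaterThanLessThan_iff greaterThanAtMost_iff by linarith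
        then show ?thesis using False by simp
      qed
    qed
  qed
  moreover have "l (?b n) - l (?a n) = (\<integral>s. indicat_real {?a n<..?b n} s * \<psi> s \<partial>?M)" for n
    using weak_derivative_increment_interior[OF l \<psi> weak ab] .
  ultimately show ?thesis using LIMSEQ_unique by auto
qed

section \<open>Functions with vanishing integrals over boxes\<close>

text \<open>Dynkin argument: boxes form an intersection-stable generator of the Borel sets, and the
  sets over which \<open>h\<close> integrates to zero are closed under complements and countable
  disjoint unions. Lebesgue sets are then reached up to null sets, and a density is determined by
  its integrals.\<close>

lemma AE_lebesgue_eq_0_if_box_integrals_eq_0:
  fixes h :: "'a::euclidean_space \<Rightarrow> real"
  assumes h: "integrable lebesgue h"
    and zero: "\<And>a c. (\<integral>x. indicat_real (box a c) x * h x \<partial>lebesgue) = 0"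
  shows "AE x in lebesgue. h x = 0"
proof -
  have int: "integrable lebesgue (\<lambda>x. indicat_real A x * h x)" if "A \<in> sets lebesgue" for A
    using integrable_mult_indicator[OF that h] by simp
  have borel_zero: "(\<integral>x. indicat_real A x * h x \<partial>lebesgue) = 0" if "A \<in> sets borel" for A :: "'a set"
  proof -
    have Int: "Int_stable (range (\<lambda>(a, b). box a b :: 'a set))"
      unfolding Int_stable_def by (auto simp: box_Int_box intro: range_eqI[where x = "(_, _)"])
    have A: "A \<in> sigma_sets UNIV (range (\<lambda>(a, b). box a b))"
      using that by (simp add: borel_eq_box)
    have sets: "B \<in> sets lebesgue"
      if "B \<in> sigma_sets UNIV (range (\<lambda>(a, b). box a b))" for B :: "'a set"
    proof -
      have "B \<in> sets borel" using that by (simp add: borel_eq_box)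
      then show ?thesis by auto
    qed
    \<comment> \<open>The whole space is no box, but the complement step needs its integral; an
      exhaustion by growing boxes supplies it.\<close>
    have total: "(\<integral>x. h x \<partial>lebesgue) = 0"
    proof -
      let ?B = "\<lambda>n::nat. box (- real n *\<^sub>R One) (real n *\<^sub>R One :: 'a)"
      have "(\<lambda>n. \<integral>x. indicat_real (?B n) x * h x \<partial>lebesgue) \<longlonglongrightarrow> (\<integral>x. h x \<partial>lebesgue)"
      proof (rule integral_dominated_convergence[where w = "\<lambda>x. norm (h x)"])
        show "AE x in lebesgue. (\<lambda>n. indicat_real (?B n) x * h x) \<longlonglongrightarrow> h x"
        proof (intro AE_I2 tendsto_eventually)
          fix x :: 'a
          obtain N :: nat where N: "norm x < real N" using reals_Archimedean2 by blast
          have "x \<in> ?B n" if "n \<ge> N" for n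
          proof -
            have "\<bar>x \<bullet> i\<bar> < real n" if "i \<in> Basis" for i
              using Basis_le_norm[OF that, of x] N \<open>n \<ge> N\<close> by linarith
            then show ?thesis by (force simp: mem_box abs_less_iff)
          qed
          then show "\<forall>\<^sub>F n in sequentially. indicat_real (?B n) x * h x = h x"
            unfolding eventually_sequentially by (intro exI[of _ N]) simp
        qed
      qed (use h int in \<open>auto simp: indicator_def intro!: borel_measurable_integrable\<close>)
      then show ?thesis using LIMSEQ_unique zero by auto
    qed
    show ?thesis
    proof (rule sigma_sets_induct_disjoint[OF Int _ A])
      show "(\<integral>x. indicat_real (UNIV - B) x * h x \<partial>lebesgue) = 0"
        if "B \<in> sigma_sets UNIV (range (\<lambda>(a, b). box a b))"
          and "(\<integral>x. indicat_real B x * h x \<partial>lebesgue) = 0" for B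
      proof -
        have "(\<integral>x. indicat_real (UNIV - B) x * h x \<partial>lebesgue) =
            (\<integral>x. h x - indicat_real B x * h x \<partial>lebesgue)"
          by (intro Bochner_Integration.integral_cong) (auto simp: indicator_def)
        also have "\<dots> = 0"
          using int[OF sets[OF that(1)]] h total that(2) by simp
        finally show ?thesis .
      qed
      show "(\<integral>x. indicat_real (\<Union>(range B)) x * h x \<partial>lebesgue) = 0"
        if "disjoint_family B" and "range B \<subseteq> sigma_sets UNIV (range (\<lambda>(a, b). box a b))"
          and "\<And>i. (\<integral>x. indicat_real (B i) x * h x \<partial>lebesgue) = 0" for B :: "nat \<Rightarrow> 'a set"
      proof -
        have B: "B i \<in> sets lebesgue" for i using that(2) sets by blast
        have "(LINT x:(\<Union>i. B i)|lebesgue. h x) = (\<Sum>i. (LINT x:(B i)|lebesgue. h x))"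
        proof (rule lebesgue_integral_countable_add[OF B])
          show "B i \<inter> B j = {}" if "i \<noteq> j" for i j
            using \<open>disjoint_family B\<close> that by (auto simp: disjoint_family_on_def)
          show "set_integrable lebesgue (\<Union>i. B i) h"
            using int[of "\<Union>i. B i"] B by (auto simp: set_integrable_def)
        qed
        then show ?thesis using that(3) by (simp add: set_lebesgue_integral_def)
      qed
    qed (use zero in auto)
  qed
  have "AE x in lebesgue. h x = (\<lambda>_. 0) x"
  proof (rule density_unique_real[OF h])
    fix A :: "'a set" assume "A \<in> sets lebesgue"
    \<comment> \<open>A Lebesgue set differs from a Borel set, here an F-sigma set, only by a null
      set, so the Borel case suffices.\<close>
    then obtain C T where CT: "fsigma C" "T \<in> null_sets lebesgue" "C \<union> T = A" "disjnt C T"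
      by (rule lebesgue_set_almost_fsigma)
    have "C \<in> sets borel"
      using CT(1) by (auto elim!: fsigma.cases)
    have "AE x in lebesgue. x \<notin> T"
      using CT(2) by (rule AE_not_in)
    then have "AE x in lebesgue. indicat_real A x * h x = indicat_real C x * h x"
      by eventually_elim (use CT(3) in \<open>auto simp: indicator_def\<close>)
    then have "(\<integral>x. indicat_real A x * h x \<partial>lebesgue) = (\<integral>x. indicat_real C x * h x \<partial>lebesgue)"
      using int \<open>A \<in> sets lebesgue\<close> \<open>C \<in> sets borel\<close>
      by (intro integral_cong_AE borel_measurable_integrable) auto
    then show "(LINT x:A|lebesgue. h x) = (LINT x:A|lebesgue. 0)"
      using borel_zero[OF \<open>C \<in> sets borel\<close>] by (simp add: set_lebesgue_integral_def)
  qed auto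
  then show ?thesis by simp
qed

text \<open>An open set is a countable union of closed boxes. On each of them the whole-space result
  applies to \<open>h\<close> cut off to the open box, since the intersection of two boxes is a box;
  the faces are null sets.\<close>

lemma AE_eq_0_if_cbox_integrals_eq_0:
  fixes h :: "'a::euclidean_space \<Rightarrow> real"
  assumes \<Omega>: "open \<Omega>" and h: "integrable (lebesgue_on \<Omega>) h"
    and zero: "\<And>a c. cbox a c \<subseteq> \<Omega> \<Longrightarrow> (\<integral>x. indicat_real (box a c) x * h x \<partial>lebesgue_on \<Omega>) = 0"
  shows "AE x in lebesgue_on \<Omega>. h x = 0"
proof -
  have \<Omega>s: "\<Omega> \<in> sets lebesgue" using \<Omega> by auto
  obtain \<D> where \<D>: "countable \<D>" "\<D> \<subseteq> Pow \<Omega>" "\<And>X. X \<in> \<D> \<Longrightarrow> \<exists>a b. X = cbox a b" "\<Union>\<D> = \<Omega>"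
    using open_countable_Union_open_cbox[OF \<Omega>] by blast
  have "AE x in lebesgue. x \<in> X \<longrightarrow> h x = 0" if X: "X \<in> \<D>" for X
  proof -
    obtain a b where X: "X = cbox a b" "cbox a b \<subseteq> \<Omega>" using \<D>(2) \<D>(3)[OF X] X by auto
    have "AE x in lebesgue. indicat_real (box a b) x * h x = 0"
    proof (rule AE_lebesgue_eq_0_if_box_integrals_eq_0)
      have *: "indicat_real (box a b) x * h x = indicat_real (box a b) x * (indicat_real \<Omega> x * h x)" for x
        using X(2) box_subset_cbox[of a b] by (auto simp: indicator_def)
      have "integrable lebesgue (\<lambda>x. indicat_real \<Omega> x * h x)"
        using h \<Omega>s by (simp add: integrable_restrict_space)
      then have "integrable lebesgue (\<lambda>x. indicat_real (box a b) x * (indicat_real \<Omega> x * h x))"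
        using integrable_mult_indicator[of "box a b" lebesgue "\<lambda>x. indicat_real \<Omega> x * h x"] by simp
      then show "integrable lebesgue (\<lambda>x. indicat_real (box a b) x * h x)"
        by (simp add: *[symmetric])
      fix c d
      obtain e f where ef: "box c d \<inter> box a b = box e f" 
        using box_Int_box by blast
      show "(\<integral>x. indicat_real (box c d) x * (indicat_real (box a b) x * h x) \<partial>lebesgue) = 0"
      \<comment> \<open>When the open box is empty, \<open>cbox e f\<close> may be degenerate and
        leave \<Omega>, so the hypothesis \<open>zero\<close> does not apply. A nonempty open box
        has \<open>cbox e f\<close> as its closure, which stays inside
        \<open>cbox a b\<close>.\<close>
      proof (cases "box e f = {}")
        case True
        have "indicat_real (box c d) x * (indicat_real (box a b) x * h x) = 0" for x
          using True ef by (auto simp: indicator_def)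
        then show ?thesis by (simp only: Bochner_Integration.integral_zero)
      next
        case False
        then have "closure (box e f) = cbox e f" by (rule closure_box)
        then have "cbox e f \<subseteq> cbox a b"
          using ef closure_mono[of "box e f" "cbox a b"] box_subset_cbox[of a b] by auto
        then have sub: "cbox e f \<subseteq> \<Omega>" using X by auto
        have "indicat_real (box c d) x * (indicat_real (box a b) x * h x) =
            indicat_real \<Omega> x *\<^sub>R (indicat_real (box e f) x * h x)" for x
          using sub box_subset_cbox[of e f] unfolding ef[symmetric] by (auto simp: indicator_def)
        then have "(\<integral>x. indicat_real (box c d) x * (indicat_real (box a b) x * h x) \<partial>lebesgue) =
            (\<integral>x. indicat_real (box e f) x * h x \<partial>lebesgue_on \<Omega>)"
          using \<Omega>s by (simp only: integral_restrict_space) (simp add: integral_restrict_space)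
        then show ?thesis using zero[OF sub] by simp
      qed
    qed
    moreover have "AE x in lebesgue. x \<notin> cbox a b - box a b"
      by (intro AE_not_in null_sets_completionI null_sets_cbox_Diff_box)
    ultimately show ?thesis unfolding X by eventually_elim auto
  qed
  then have "AE x in lebesgue. \<forall>X\<in>\<D>. x \<in> X \<longrightarrow> h x = 0"
    by (subst AE_ball_countable[OF \<D>(1)]) blast
  then have "AE x in lebesgue. x \<in> \<Omega> \<longrightarrow> h x = 0"
    by eventually_elim (use \<D>(4) in auto)
  then show ?thesis using \<Omega>s by (simp add: AE_restrict_space_iff)
qed

section \<open>The Hilbert space of square-integrable functions\<close>

text \<open>The discriminant criterion. It serves twice: for the Cauchy-Schwarz inequality, and with
  \<open>a = 0\<close> for the Euler equation of a minimiser, where it forces the linear coefficient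
  \<open>b\<close> to vanish.\<close>

lemma square_le_mult_if_quadratic_nonneg:
  fixes a b c :: real
  assumes "\<And>t. 0 \<le> a + 2 * t * b + t\<^sup>2 * c" and "0 \<le> c"
  shows "b\<^sup>2 \<le> a * c"
proof (cases "c = 0")
  case True
  have "b = 0"
  proof (rule ccontr)
    assume "b \<noteq> 0"
    \<comment> \<open>With \<open>c = 0\<close> this choice of \<open>t\<close> gives the quadratic
      the value -1.\<close>
    then have "2 * (- (a + 1) / (2 * b)) * b = - (a + 1)" by simp
    with assms(1)[of "- (a + 1) / (2 * b)"] True show False by simp
  qed
  then show ?thesis using True by simp
next
  case False
  then have "c > 0" using assms(2) by simp
  have "0 \<le> a + 2 * (- b / c) * b + (- b / c)\<^sup>2 * c" by (rule assms(1))
  also have "\<dots> = a - b\<^sup>2 / c"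
    using \<open>c > 0\<close> by (simp add: power2_eq_square field_simps)
  finally show ?thesis using \<open>c > 0\<close> by (simp add: field_simps)
qed

definition L2_inner :: "'a::euclidean_space set \<Rightarrow> ('a \<Rightarrow> 'b::euclidean_space) \<Rightarrow> ('a \<Rightarrow> 'b) \<Rightarrow> real" where
  "L2_inner \<Omega> u v = (\<integral>x. u x \<bullet> v x \<partial>lebesgue_on \<Omega>)"

lemma L2_measurable: "u \<in> L2 \<Omega> \<Longrightarrow> u \<in> borel_measurable (lebesgue_on \<Omega>)"
  by (simp add: L2_def)

lemma L2_integrable_norm_square: "u \<in> L2 \<Omega> \<Longrightarrow> integrable (lebesgue_on \<Omega>) (\<lambda>x. (norm (u x))\<^sup>2)"
  by (simp add: L2_def)

lemma L2I:
  assumes "u \<in> borel_measurable (lebesgue_on \<Omega>)" and "integrable (lebesgue_on \<Omega>) f"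
    and "AE x in lebesgue_on \<Omega>. (norm (u x))\<^sup>2 \<le> f x"
  shows "u \<in> L2 \<Omega>"
  using assms by (auto simp: L2_def intro!: Bochner_Integration.integrable_bound[OF assms(2)]
      elim!: eventually_mono)

lemma L2_integrable_inner:
  assumes "u \<in> L2 \<Omega>" and "v \<in> L2 \<Omega>"
  shows "integrable (lebesgue_on \<Omega>) (\<lambda>x. u x \<bullet> v x)"
proof (rule Bochner_Integration.integrable_bound)
  show "integrable (lebesgue_on \<Omega>) (\<lambda>x. (norm (u x))\<^sup>2 + (norm (v x))\<^sup>2)"
    using assms by (intro Bochner_Integration.integrable_add L2_integrable_norm_square)
  show "(\<lambda>x. u x \<bullet> v x) \<in> borel_measurable (lebesgue_on \<Omega>)"
    using assms by (intro borel_measurable_inner L2_measurable)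
  have "\<bar>u x \<bullet> v x\<bar> \<le> (norm (u x))\<^sup>2 + (norm (v x))\<^sup>2" for x
  proof -
    have "\<bar>u x \<bullet> v x\<bar> \<le> norm (u x) * norm (v x)" by (rule Cauchy_Schwarz_ineq2)
    moreover have "2 * norm (u x) * norm (v x) \<le> (norm (u x))\<^sup>2 + (norm (v x))\<^sup>2"
      by (rule sum_squares_bound)
    moreover have "0 \<le> norm (u x) * norm (v x)" by simp
    ultimately show ?thesis by linarith
  qed
  then show "AE x in lebesgue_on \<Omega>. norm (u x \<bullet> v x) \<le> norm ((norm (u x))\<^sup>2 + (norm (v x))\<^sup>2)"
    by (intro AE_I2) simp
qed

lemma L2_add:
  assumes "u \<in> L2 \<Omega>" and "v \<in> L2 \<Omega>"
  shows "(\<lambda>x. u x + v x) \<in> L2 \<Omega>"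
proof (rule L2I)
  show "(\<lambda>x. u x + v x) \<in> borel_measurable (lebesgue_on \<Omega>)"
    using assms by (intro borel_measurable_add L2_measurable)
  show "integrable (lebesgue_on \<Omega>) (\<lambda>x. (norm (u x))\<^sup>2 + (norm (v x))\<^sup>2 + 2 * (u x \<bullet> v x))"
    using assms
    by (intro Bochner_Integration.integrable_add integrable_mult_right L2_integrable_inner
        L2_integrable_norm_square)
  show "AE x in lebesgue_on \<Omega>. (norm (u x + v x))\<^sup>2 \<le> (norm (u x))\<^sup>2 + (norm (v x))\<^sup>2 + 2 * (u x \<bullet> v x)"
    by (intro AE_I2) (simp add: power2_norm_eq_inner inner_add inner_commute)
qed

lemma L2_scaleR: "u \<in> L2 \<Omega> \<Longrightarrow> (\<lambda>x. c *\<^sub>R u x) \<in> L2 \<Omega>"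
  by (auto simp: L2_def power_mult_distrib)

lemma L2_diff:
  assumes "u \<in> L2 \<Omega>" and "v \<in> L2 \<Omega>"
  shows "(\<lambda>x. u x - v x) \<in> L2 \<Omega>"
  using L2_add[OF assms(1) L2_scaleR[OF assms(2), of "-1"]] by simp

lemma L2_zero: "(\<lambda>x. 0) \<in> L2 \<Omega>"
  by (simp add: L2_def)

lemma L2_inner_commute: "L2_inner \<Omega> u v = L2_inner \<Omega> v u"
  by (simp add: L2_inner_def inner_commute)

lemma L2_inner_add_left:
  "u \<in> L2 \<Omega> \<Longrightarrow> v \<in> L2 \<Omega> \<Longrightarrow> w \<in> L2 \<Omega> \<Longrightarrow>
    L2_inner \<Omega> (\<lambda>x. u x + v x) w = L2_inner \<Omega> u w + L2_inner \<Omega> v w"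
  by (simp add: L2_inner_def inner_add_left L2_integrable_inner)

lemma L2_inner_diff_left:
  "u \<in> L2 \<Omega> \<Longrightarrow> v \<in> L2 \<Omega> \<Longrightarrow> w \<in> L2 \<Omega> \<Longrightarrow>
    L2_inner \<Omega> (\<lambda>x. u x - v x) w = L2_inner \<Omega> u w - L2_inner \<Omega> v w"
  by (simp add: L2_inner_def inner_diff_left L2_integrable_inner)

lemma L2_inner_scaleR_left: "L2_inner \<Omega> (\<lambda>x. c *\<^sub>R u x) w = c * L2_inner \<Omega> u w"
  by (simp add: L2_inner_def)

lemma L2_inner_add_right:
  "u \<in> L2 \<Omega> \<Longrightarrow> v \<in> L2 \<Omega> \<Longrightarrow> w \<in> L2 \<Omega> \<Longrightarrow>
    L2_inner \<Omega> w (\<lambda>x. u x + v x) = L2_inner \<Omega> w u + L2_inner \<Omega> w v"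
  by (simp add: L2_inner_def inner_add_right L2_integrable_inner)

lemma L2_inner_diff_right:
  "u \<in> L2 \<Omega> \<Longrightarrow> v \<in> L2 \<Omega> \<Longrightarrow> w \<in> L2 \<Omega> \<Longrightarrow>
    L2_inner \<Omega> w (\<lambda>x. u x - v x) = L2_inner \<Omega> w u - L2_inner \<Omega> w v"
  by (simp add: L2_inner_def inner_diff_right L2_integrable_inner)

lemma L2_inner_scaleR_right: "L2_inner \<Omega> w (\<lambda>x. c *\<^sub>R u x) = c * L2_inner \<Omega> w u"
  by (simp add: L2_inner_def)

lemma L2_inner_cong_AE:
  fixes u v u' v' :: "'a::euclidean_space \<Rightarrow> 'b::euclidean_space"
  assumes "u \<in> L2 \<Omega>" "v \<in> L2 \<Omega>" "u' \<in> L2 \<Omega>" "v' \<in> L2 \<Omega>"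
    and "AE x in lebesgue_on \<Omega>. u x = u' x" "AE x in lebesgue_on \<Omega>. v x = v' x"
  shows "L2_inner \<Omega> u v = L2_inner \<Omega> u' v'"
  unfolding L2_inner_def
proof (rule integral_cong_AE)
  show "AE x in lebesgue_on \<Omega>. u x \<bullet> v x = u' x \<bullet> v' x"
    using assms(5,6) by eventually_elim simp
qed (intro borel_measurable_inner L2_measurable assms)+

lemma L2_norm_nonneg: "0 \<le> L2_norm \<Omega> u"
  by (simp add: L2_norm_def)

lemma L2_norm_square: "(L2_norm \<Omega> u)\<^sup>2 = L2_inner \<Omega> u u"
  by (simp add: L2_norm_def L2_inner_def power2_norm_eq_inner)

lemma L2_inner_self_nonneg: "0 \<le> L2_inner \<Omega> u u"
  by (simp add: L2_norm_square[symmetric])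

lemma L2_norm_cong_AE:
  assumes "u \<in> L2 \<Omega>" and "v \<in> L2 \<Omega>" and "AE x in lebesgue_on \<Omega>. u x = v x"
  shows "L2_norm \<Omega> u = L2_norm \<Omega> v"
proof (rule power2_eq_imp_eq)
  show "(L2_norm \<Omega> u)\<^sup>2 = (L2_norm \<Omega> v)\<^sup>2"
    unfolding L2_norm_square by (rule L2_inner_cong_AE[OF assms(1,1,2,2,3,3)])
qed (rule L2_norm_nonneg)+

lemma L2_inner_add_self:
  assumes "u \<in> L2 \<Omega>" and "v \<in> L2 \<Omega>"
  shows "L2_inner \<Omega> (\<lambda>x. u x + v x) (\<lambda>x. u x + v x) =
    L2_inner \<Omega> u u + 2 * L2_inner \<Omega> u v + L2_inner \<Omega> v v"
  using assms by (simp add: L2_inner_add_left L2_inner_add_right L2_add L2_inner_commute[of \<Omega> v u])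

lemma L2_inner_diff_self:
  assumes "u \<in> L2 \<Omega>" and "v \<in> L2 \<Omega>"
  shows "L2_inner \<Omega> (\<lambda>x. u x - v x) (\<lambda>x. u x - v x) =
    L2_inner \<Omega> u u - 2 * L2_inner \<Omega> u v + L2_inner \<Omega> v v"
  using assms by (simp add: L2_inner_diff_left L2_inner_diff_right L2_diff L2_inner_commute[of \<Omega> v u])

lemma L2_Cauchy_Schwarz:
  assumes "u \<in> L2 \<Omega>" and "v \<in> L2 \<Omega>"
  shows "\<bar>L2_inner \<Omega> u v\<bar> \<le> L2_norm \<Omega> u * L2_norm \<Omega> v"
proof -
  have "0 \<le> L2_inner \<Omega> u u + 2 * t * L2_inner \<Omega> u v + t\<^sup>2 * L2_inner \<Omega> v v" for t
    using L2_inner_self_nonneg[of \<Omega> "\<lambda>x. u x + t *\<^sub>R v x"]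
    by (simp add: L2_inner_add_self assms L2_scaleR L2_inner_scaleR_left L2_inner_scaleR_right
        power2_eq_square mult.assoc)
  then have "(L2_inner \<Omega> u v)\<^sup>2 \<le> L2_inner \<Omega> u u * L2_inner \<Omega> v v"
    by (intro square_le_mult_if_quadratic_nonneg L2_inner_self_nonneg)
  then have "(L2_inner \<Omega> u v)\<^sup>2 \<le> (L2_norm \<Omega> u * L2_norm \<Omega> v)\<^sup>2"
    by (simp add: power_mult_distrib L2_norm_square)
  then have "\<bar>L2_inner \<Omega> u v\<bar> \<le> \<bar>L2_norm \<Omega> u * L2_norm \<Omega> v\<bar>"
    by (simp only: abs_le_square_iff)
  then show ?thesis by (simp add: L2_norm_nonneg)
qed

lemma L2_norm_triangle:
  assumes "u \<in> L2 \<Omega>" and "v \<in> L2 \<Omega>"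
  shows "L2_norm \<Omega> (\<lambda>x. u x + v x) \<le> L2_norm \<Omega> u + L2_norm \<Omega> v"
proof (rule power2_le_imp_le)
  have "(L2_norm \<Omega> (\<lambda>x. u x + v x))\<^sup>2 = (L2_norm \<Omega> u)\<^sup>2 + 2 * L2_inner \<Omega> u v + (L2_norm \<Omega> v)\<^sup>2"
    using assms by (simp add: L2_norm_square L2_inner_add_self)
  also have "\<dots> \<le> (L2_norm \<Omega> u + L2_norm \<Omega> v)\<^sup>2"
    using L2_Cauchy_Schwarz[OF assms] by (simp add: power2_sum)
  finally show "(L2_norm \<Omega> (\<lambda>x. u x + v x))\<^sup>2 \<le> (L2_norm \<Omega> u + L2_norm \<Omega> v)\<^sup>2" .
qed (simp add: L2_norm_nonneg)

lemma L2_norm_minus_commute: "L2_norm \<Omega> (\<lambda>x. u x - v x) = L2_norm \<Omega> (\<lambda>x. v x - u x)"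
  by (simp add: L2_norm_def norm_minus_commute)

lemma L2_norm_triangle_diff:
  assumes "u \<in> L2 \<Omega>" and "v \<in> L2 \<Omega>" and "w \<in> L2 \<Omega>"
  shows "L2_norm \<Omega> (\<lambda>x. u x - w x) \<le> L2_norm \<Omega> (\<lambda>x. u x - v x) + L2_norm \<Omega> (\<lambda>x. v x - w x)"
  using L2_norm_triangle[OF L2_diff[OF assms(1,2)] L2_diff[OF assms(2,3)]] by simp

lemma L2_norm_reverse_triangle:
  assumes "u \<in> L2 \<Omega>" and "v \<in> L2 \<Omega>"
  shows "\<bar>L2_norm \<Omega> u - L2_norm \<Omega> v\<bar> \<le> L2_norm \<Omega> (\<lambda>x. u x - v x)"
  using L2_norm_triangle_diff[OF assms L2_zero] L2_norm_triangle_diff[OF assms(2,1) L2_zero]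
  by (simp add: L2_norm_minus_commute[of \<Omega> u v])

lemma L2_norm_eq_0_imp_AE:
  assumes "u \<in> L2 \<Omega>" and "L2_norm \<Omega> u = 0"
  shows "AE x in lebesgue_on \<Omega>. u x = 0"
proof -
  have "(\<integral>x. (norm (u x))\<^sup>2 \<partial>lebesgue_on \<Omega>) = 0"
    using assms(2) by (simp add: L2_norm_def)
  then have "AE x in lebesgue_on \<Omega>. (norm (u x))\<^sup>2 = 0"
    using integral_nonneg_eq_0_iff_AE[OF L2_integrable_norm_square[OF assms(1)]] by auto
  then show ?thesis by simp
qed

section \<open>Completeness and Riesz representation\<close>

lemma L2_nn_integral:
  assumes "u \<in> L2 \<Omega>"
  shows "(\<integral>\<^sup>+x. ennreal ((norm (u x))\<^sup>2) \<partial>lebesgue_on \<Omega>) = ennreal ((L2_norm \<Omega> u)\<^sup>2)"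
  using assms by (simp add: L2_norm_def nn_integral_eq_integral L2_integrable_norm_square)

text \<open>Cauchy-Schwarz against the constant function 1, which is square integrable because
  \<Omega> has finite measure.\<close>

lemma L2_integrable_norm:
  assumes "\<Omega> \<in> lmeasurable" and "u \<in> L2 \<Omega>"
  shows "integrable (lebesgue_on \<Omega>) (\<lambda>x. norm (u x))"
    and "(\<integral>x. norm (u x) \<partial>lebesgue_on \<Omega>) \<le> sqrt (measure lebesgue \<Omega>) * L2_norm \<Omega> u"
proof -
  have one: "(\<lambda>x. 1::real) \<in> L2 \<Omega>"
    using finite_measure.integrable_const[OF finite_measure_lebesgue_on[OF assms(1)]]
    by (simp add: L2_def)
  have n: "(\<lambda>x. norm (u x)) \<in> L2 \<Omega>"
    using assms(2) L2_measurable[OF assms(2)] by (simp add: L2_def)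
  have *: "L2_norm \<Omega> (\<lambda>x. norm (u x)) = L2_norm \<Omega> u" 
    by (simp add: L2_norm_def)
  have **: "L2_norm \<Omega> (\<lambda>x. 1::real) = sqrt (measure lebesgue \<Omega>)"
    using assms(1) by (simp add: L2_norm_def measure_restrict_space fmeasurableD)
  show "integrable (lebesgue_on \<Omega>) (\<lambda>x. norm (u x))"
    using L2_integrable_inner[OF one n] by simp
  show "(\<integral>x. norm (u x) \<partial>lebesgue_on \<Omega>) \<le> sqrt (measure lebesgue \<Omega>) * L2_norm \<Omega> u"
    using L2_Cauchy_Schwarz[OF one n] by (simp add: L2_inner_def * **)
qed

text \<open>Riesz-Fischer for a rapidly converging sequence. On a set of finite measure the
  increments are summable in L1, hence absolutely summable at almost every point, which yields the
  limit; Fatou's lemma turns the tail bounds into convergence in norm. A minimising sequence can be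
  chosen this fast.\<close>

lemma L2_complete:
  fixes u :: "nat \<Rightarrow> 'a::euclidean_space \<Rightarrow> 'b::euclidean_space"
  assumes \<Omega>: "\<Omega> \<in> lmeasurable" and u: "\<And>n. u n \<in> L2 \<Omega>"
    and fast: "\<And>n. L2_norm \<Omega> (\<lambda>x. u (Suc n) x - u n x) \<le> (1/2) ^ n"
  shows "\<exists>w\<in>L2 \<Omega>. (\<lambda>n. L2_norm \<Omega> (\<lambda>x. u n x - w x)) \<longlonglongrightarrow> 0"
proof -
  let ?M = "lebesgue_on \<Omega>"
  have meas[measurable]: "u n \<in> borel_measurable ?M" for n
    using u by (rule L2_measurable)
  \<comment> \<open>Where the sequence diverges, \<open>lim\<close> is some default value. The
    function is measurable all the same, and these points form a null set.\<close>
  define w where "w x = lim (\<lambda>n. u n x)" for x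
  have w[measurable]: "w \<in> borel_measurable ?M"
    unfolding w_def[abs_def] by measurable
  let ?d = "\<lambda>n x. norm (u (Suc n) x - u n x)"
  have "(\<integral>\<^sup>+x. (\<Sum>n. ennreal (?d n x)) \<partial>?M) = (\<Sum>n. \<integral>\<^sup>+x. ennreal (?d n x) \<partial>?M)"
    by (rule nn_integral_suminf) measurable
  also have "\<dots> \<le> (\<Sum>n. ennreal (sqrt (measure lebesgue \<Omega>) * (1/2) ^ n))"
  proof (intro suminf_le)
    fix n
    have *: "(\<lambda>x. u (Suc n) x - u n x) \<in> L2 \<Omega>" by (intro L2_diff u)
    have "(\<integral>x. ?d n x \<partial>?M) \<le> sqrt (measure lebesgue \<Omega>) * (1/2) ^ n"
      using L2_integrable_norm(2)[OF \<Omega> *] mult_left_mono[OF fast[of n], of "sqrt (measure lebesgue \<Omega>)"]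
      by simp
    then show "(\<integral>\<^sup>+x. ennreal (?d n x) \<partial>?M) \<le> ennreal (sqrt (measure lebesgue \<Omega>) * (1/2) ^ n)"
      using L2_integrable_norm(1)[OF \<Omega> *] by (simp add: nn_integral_eq_integral ennreal_leI)
  qed auto
  also have "\<dots> < \<infinity>"
    by (subst suminf_ennreal2) (auto intro!: summable_mult summable_geometric)
  finally have "AE x in ?M. (\<Sum>n. ennreal (?d n x)) \<noteq> \<infinity>"
    by (intro nn_integral_PInf_AE) auto
  then have conv: "AE x in ?M. (\<lambda>n. u n x) \<longlonglongrightarrow> w x"
  proof eventually_elim
    case (elim x)
    then have "summable (\<lambda>n. ?d n x)"
      by (intro summable_suminf_not_top) auto
    then have "summable (\<lambda>n. u (Suc n) x - u n x)"
      by (rule summable_norm_cancel)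
    then have "convergent (\<lambda>n. \<Sum>i<n. u (Suc i) x - u i x)"
      by (simp add: summable_iff_convergent)
    then have "convergent (\<lambda>n. u n x - u 0 x)"
      by (simp add: sum_lessThan_telescope[of "\<lambda>i. u i x"])
    then have "convergent (\<lambda>n. (u n x - u 0 x) + u 0 x)"
      by (intro convergent_add convergent_const)
    then show ?case by (simp add: w_def convergent_LIMSEQ_iff)
  qed
  \<comment> \<open>The exact value of the finite geometric sum is kept, so that the induction on
    \<open>k\<close> closes; the subtracted term is dropped afterwards.\<close>
  have tail: "L2_norm \<Omega> (\<lambda>x. u (n + k) x - u n x) \<le> 2 * (1/2) ^ n - 2 * (1/2) ^ (n + k)" for n k
  proof (induction k)
    case 0
    then show ?case by (simp add: L2_norm_def)
  next
    case (Suc k)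
    have "L2_norm \<Omega> (\<lambda>x. u (n + Suc k) x - u n x) \<le>
        L2_norm \<Omega> (\<lambda>x. u (Suc (n + k)) x - u (n + k) x) + L2_norm \<Omega> (\<lambda>x. u (n + k) x - u n x)"
      using L2_norm_triangle_diff[OF u[of "Suc (n + k)"] u[of "n + k"] u[of n]] by simp
    then show ?case using Suc.IH fast[of "n + k"] by simp
  qed
  have fatou: "(\<integral>\<^sup>+x. ennreal ((norm (w x - u n x))\<^sup>2) \<partial>?M) \<le> ennreal ((2 * (1/2) ^ n)\<^sup>2)" for n
  proof -
    have "(\<integral>\<^sup>+x. ennreal ((norm (w x - u n x))\<^sup>2) \<partial>?M) =
        (\<integral>\<^sup>+x. liminf (\<lambda>k. ennreal ((norm (u (n + k) x - u n x))\<^sup>2)) \<partial>?M)"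
    proof (rule nn_integral_cong_AE)
      show "AE x in ?M. ennreal ((norm (w x - u n x))\<^sup>2) =
          liminf (\<lambda>k. ennreal ((norm (u (n + k) x - u n x))\<^sup>2))"
        using conv
      proof eventually_elim
        case (elim x)
        then have "(\<lambda>k. u (n + k) x) \<longlonglongrightarrow> w x"
          using LIMSEQ_ignore_initial_segment[of "\<lambda>n. u n x" "w x" n] by (simp add: add.commute)
        then have "(\<lambda>k. ennreal ((norm (u (n + k) x - u n x))\<^sup>2)) \<longlonglongrightarrow> ennreal ((norm (w x - u n x))\<^sup>2)"
          by (intro tendsto_ennrealI tendsto_intros)
        then show ?case by (rule lim_imp_Liminf[symmetric, rotated]) simp
      qed
    qed
    also have "\<dots> \<le> liminf (\<lambda>k. \<integral>\<^sup>+x. ennreal ((norm (u (n + k) x - u n x))\<^sup>2) \<partial>?M)"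
      by (rule nn_integral_liminf) measurable
    also have "\<dots> \<le> liminf (\<lambda>k. ennreal ((2 * (1/2) ^ n)\<^sup>2))"
    proof (intro Liminf_mono always_eventually allI)
      fix k
      have "(L2_norm \<Omega> (\<lambda>x. u (n + k) x - u n x))\<^sup>2 \<le> (2 * (1/2) ^ n)\<^sup>2"
        using tail[of n k] zero_le_power[of "1/2::real" "n + k"]
        by (intro power_mono L2_norm_nonneg) linarith
      then show "(\<integral>\<^sup>+x. ennreal ((norm (u (n + k) x - u n x))\<^sup>2) \<partial>?M) \<le> ennreal ((2 * (1/2) ^ n)\<^sup>2)"
        by (subst L2_nn_integral[OF L2_diff[OF u u]]) (rule ennreal_leI)
    qed
    also have "\<dots> = ennreal ((2 * (1/2) ^ n)\<^sup>2)"
      by (simp add: Liminf_const)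
    finally show ?thesis .
  qed
  have wu: "(\<lambda>x. w x - u n x) \<in> L2 \<Omega>" for n
    using fatou[of n]
    by (auto simp: L2_def intro!: integrableI_nonneg le_less_trans[OF fatou[of n]])
  have wL2: "w \<in> L2 \<Omega>"
    using L2_add[OF wu[of 0] u[of 0]] by simp
  have bound: "L2_norm \<Omega> (\<lambda>x. u n x - w x) \<le> 2 * (1/2) ^ n" for n
  proof -
    have "(L2_norm \<Omega> (\<lambda>x. w x - u n x))\<^sup>2 \<le> (2 * (1/2) ^ n)\<^sup>2"
      using fatou[of n] L2_nn_integral[OF wu[of n]] by (simp add: ennreal_le_iff)
    then show ?thesis
      by (subst L2_norm_minus_commute) (rule power2_le_imp_le, auto)
  qed
  have "(\<lambda>n. 2 * (1/2::real) ^ n) \<longlonglongrightarrow> 0"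
    by (auto intro!: tendsto_mult_right_zero LIMSEQ_power_zero)
  then have "(\<lambda>n. L2_norm \<Omega> (\<lambda>x. u n x - w x)) \<longlonglongrightarrow> 0"
    by (rule Lim_null_comparison[rotated])
       (auto simp: bound L2_norm_nonneg intro!: always_eventually)
  then show ?thesis using wL2 by blast
qed

text \<open>The representing element minimises \<open>J v = \<parallel>v\<parallel>\<^sup>2 - 2 l v\<close>.\<close>

lemma L2_Riesz:
  fixes l :: "('a::euclidean_space \<Rightarrow> 'b::euclidean_space) \<Rightarrow> real"
  assumes \<Omega>: "\<Omega> \<in> lmeasurable"
    and add: "\<And>u v. u \<in> L2 \<Omega> \<Longrightarrow> v \<in> L2 \<Omega> \<Longrightarrow> l (\<lambda>x. u x + v x) = l u + l v"
    and scale: "\<And>u c. u \<in> L2 \<Omega> \<Longrightarrow> l (\<lambda>x. c *\<^sub>R u x) = c * l u"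
    and bound: "\<And>u. u \<in> L2 \<Omega> \<Longrightarrow> \<bar>l u\<bar> \<le> C * L2_norm \<Omega> u"
  shows "\<exists>w\<in>L2 \<Omega>. \<forall>v\<in>L2 \<Omega>. L2_inner \<Omega> w v = l v"
proof -
  define J where "J v = L2_inner \<Omega> v v - 2 * l v" for v
  \<comment> \<open>Completing the square in \<parallel>v\<parallel>^2 - 2 C
    \<parallel>v\<parallel>.\<close>
  have below: "- C\<^sup>2 \<le> J v" if "v \<in> L2 \<Omega>" for v
  proof -
    have "0 \<le> (L2_norm \<Omega> v - C)\<^sup>2" by simp
    then show ?thesis
      using bound[OF that] unfolding J_def L2_norm_square[symmetric]
      by (simp add: power2_diff mult.assoc mult.commute[of C] abs_le_iff)
  qed
  then have bdd: "bdd_below (J ` L2 \<Omega>)" by (intro bdd_belowI2)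
  define d where "d = (INF v\<in>L2 \<Omega>. J v)"
  have d_le: "d \<le> J v" if "v \<in> L2 \<Omega>" for v
    unfolding d_def using bdd that by (rule cINF_lower)
  \<comment> \<open>The tolerance is tuned to \<open>L2_complete\<close>: by the parallelogram law
    consecutive elements then have squared distance at most \<open>(1/4) ^ n\<close>.\<close>
  have "\<exists>v\<in>L2 \<Omega>. J v < d + (1/4) ^ n / 4" for n :: nat
    using cINF_less_iff[OF _ bdd, of "d + (1/4) ^ n / 4"] L2_zero[of \<Omega>] by (auto simp: d_def)
  then obtain v where v: "\<And>n. v n \<in> L2 \<Omega>" "\<And>n. J (v n) < d + (1/4) ^ n / 4"
    by metis
  have "L2_norm \<Omega> (\<lambda>x. v (Suc n) x - v n x) \<le> (1/2) ^ n" for n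
  proof (rule power2_le_imp_le)
    let ?a = "v (Suc n)" and ?b = "v n"
    have h: "(\<lambda>x. ?a x + ?b x) \<in> L2 \<Omega>" by (intro L2_add v)
    have "4 * J (\<lambda>x. (1/2) *\<^sub>R (?a x + ?b x)) =
        L2_inner \<Omega> ?a ?a + 2 * L2_inner \<Omega> ?a ?b + L2_inner \<Omega> ?b ?b - 4 * (l ?a + l ?b)"
      unfolding J_def scale[OF h] L2_inner_scaleR_left L2_inner_scaleR_right
      by (simp add: L2_inner_add_self add v L2_inner_commute[of \<Omega> ?b ?a] field_simps)
    \<comment> \<open>Parallelogram law: the linear parts of \<open>J\<close> at the two points and
      at their midpoint cancel.\<close>
    then have "(L2_norm \<Omega> (\<lambda>x. ?a x - ?b x))\<^sup>2 =
        2 * J ?a + 2 * J ?b - 4 * J (\<lambda>x. (1/2) *\<^sub>R (?a x + ?b x))"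
      by (simp add: L2_norm_square L2_inner_diff_self v J_def)
    also have "\<dots> \<le> 2 * (d + (1/4) ^ Suc n / 4) + 2 * (d + (1/4) ^ n / 4) - 4 * d"
      using less_imp_le[OF v(2)[of n]] less_imp_le[OF v(2)[of "Suc n"]] d_le[OF L2_scaleR[OF h, of "1/2"]]
      by (intro diff_mono add_mono mult_left_mono; (assumption | simp))
    also have "\<dots> \<le> (1/4) ^ n" by simp
    also have "\<dots> = ((1/2) ^ n)\<^sup>2"
      by (simp add: power2_eq_square power_mult_distrib[symmetric])
    finally show "(L2_norm \<Omega> (\<lambda>x. ?a x - ?b x))\<^sup>2 \<le> ((1/2) ^ n)\<^sup>2" .
  qed simp
  then obtain w where w: "w \<in> L2 \<Omega>" "(\<lambda>n. L2_norm \<Omega> (\<lambda>x. v n x - w x)) \<longlonglongrightarrow> 0"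
    using L2_complete[OF \<Omega>, of v] v(1) by blast
  have "(\<lambda>n. L2_norm \<Omega> (v n) - L2_norm \<Omega> w) \<longlonglongrightarrow> 0"
    by (rule Lim_null_comparison[OF _ w(2)])
       (auto simp: L2_norm_reverse_triangle v w intro!: always_eventually)
  then have norms: "(\<lambda>n. L2_norm \<Omega> (v n)) \<longlonglongrightarrow> L2_norm \<Omega> w"
    by (simp add: LIM_zero_iff)
  have "(\<lambda>n. l (v n) - l w) \<longlonglongrightarrow> 0"
  proof (rule Lim_null_comparison)
    show "(\<lambda>n. C * L2_norm \<Omega> (\<lambda>x. v n x - w x)) \<longlonglongrightarrow> 0"
      using w(2) by (rule tendsto_mult_right_zero)
    have "l (v n) - l w = l (\<lambda>x. v n x - w x)" for n
      using add[OF v(1)[of n] L2_scaleR[OF w(1), of "-1"]] scale[OF w(1), of "-1"] by simp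
    then show "\<forall>\<^sub>F n in sequentially. norm (l (v n) - l w) \<le> C * L2_norm \<Omega> (\<lambda>x. v n x - w x)"
      using bound[OF L2_diff[OF v(1) w(1)]] by (auto intro!: always_eventually)
  qed
  then have "(\<lambda>n. l (v n)) \<longlonglongrightarrow> l w"
    by (simp add: LIM_zero_iff)
  with norms have "(\<lambda>n. J (v n)) \<longlonglongrightarrow> J w"
    unfolding J_def L2_norm_square[symmetric] by (intro tendsto_intros)
  moreover have "(\<lambda>n. d + (1/4) ^ n / 4) \<longlonglongrightarrow> d + 0 / 4"
    by (intro tendsto_intros LIMSEQ_power_zero) auto
  ultimately have Jw: "J w \<le> d"
    using v(2) by (intro LIMSEQ_le[where X = "\<lambda>n. J (v n)"]) (auto intro: less_imp_le)
  have "L2_inner \<Omega> w z = l z" if z: "z \<in> L2 \<Omega>" for z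
  proof -
    \<comment> \<open>Minimality of \<open>w\<close> along the line in direction \<open>z\<close>.
      The constant term is zero, so the linear coefficient must vanish.\<close>
    have "0 \<le> 0 + 2 * t * (L2_inner \<Omega> w z - l z) + t\<^sup>2 * L2_inner \<Omega> z z" for t
    proof -
      have "J w \<le> J (\<lambda>x. w x + t *\<^sub>R z x)"
        using Jw d_le[OF L2_add[OF w(1) L2_scaleR[OF z, of t]]] by linarith
      then show ?thesis
        by (simp add: J_def L2_inner_add_self w(1) L2_scaleR z add scale L2_inner_scaleR_left
            L2_inner_scaleR_right power2_eq_square algebra_simps)
    qed
    then have "(L2_inner \<Omega> w z - l z)\<^sup>2 \<le> 0 * L2_inner \<Omega> z z"
      by (intro square_le_mult_if_quadratic_nonneg L2_inner_self_nonneg)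
    then show ?thesis by simp
  qed
  then show ?thesis using w(1) by blast
qed

section \<open>Weak gradients\<close>

lemma L2_if_continuous_compact_support:
  fixes h :: "'a::euclidean_space \<Rightarrow> real"
  assumes \<Omega>: "\<Omega> \<in> lmeasurable" and h: "continuous_on UNIV h"
    and K: "compact K" "\<And>x. x \<notin> K \<Longrightarrow> h x = 0"
  shows "h \<in> L2 \<Omega>"
proof -
  have "continuous_on K h" using h continuous_on_subset by blast
  then have "bounded (h ` K)"
    using K(1) compact_continuous_image compact_imp_bounded by blast
  then obtain B where B: "\<And>x. x \<in> K \<Longrightarrow> \<bar>h x\<bar> \<le> B" by (auto simp: bounded_iff)
  have hB: "\<bar>h x\<bar> \<le> \<bar>B\<bar>" for x using B[of x] K(2)[of x] by (cases "x \<in> K") auto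
  show ?thesis
  proof (rule L2I)
    have "h \<in> borel_measurable borel" using h by (rule borel_measurable_continuous_onI)
    then show "h \<in> borel_measurable (lebesgue_on \<Omega>)"
      by (intro measurable_restrict_space1 measurable_completion) simp
    show "integrable (lebesgue_on \<Omega>) (\<lambda>x. B\<^sup>2)"
      using finite_measure.integrable_const[OF finite_measure_lebesgue_on[OF \<Omega>]] .
    show "AE x in lebesgue_on \<Omega>. (norm (h x))\<^sup>2 \<le> B\<^sup>2"
      using hB by (intro AE_I2) (simp add: abs_le_square_iff)
  qed
qed

lemma L2_component:
  assumes "g \<in> L2 \<Omega>" and "b \<in> Basis"
  shows "(\<lambda>x. g x \<bullet> b) \<in> L2 \<Omega>"
proof (rule L2I[OF _ L2_integrable_norm_square[OF assms(1)]])
  show "(\<lambda>x. g x \<bullet> b) \<in> borel_measurable (lebesgue_on \<Omega>)"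
    by (intro borel_measurable_inner L2_measurable[OF assms(1)] borel_measurable_const)
  show "AE x in lebesgue_on \<Omega>. (norm (g x \<bullet> b))\<^sup>2 \<le> (norm (g x))\<^sup>2"
    using Basis_le_norm[OF assms(2)] by (intro AE_I2 power_mono) auto
qed

lemma grad_component:
  "b \<in> Basis \<Longrightarrow> grad f x \<bullet> b = frechet_derivative f (at x) b"
  unfolding grad_def by (simp add: inner_sum_left inner_Basis if_distrib cong: if_cong)

lemma test_functions_compact_support:
  "f \<in> test_functions S \<Longrightarrow> compact (closure {x. f x \<noteq> 0})"
  by (simp add: test_functions_def)

lemma test_functions_Ck: "f \<in> test_functions S \<Longrightarrow> Ck k f"
  by (simp add: test_functions_def)

lemma test_function_outside_support: "x \<notin> closure {x. f x \<noteq> 0} \<Longrightarrow> f x = 0"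
  using subsetD[OF closure_subset, of x "{x. f x \<noteq> 0}"] by blast

lemma test_function_L2:
  assumes "\<Omega> \<in> lmeasurable" and "f \<in> test_functions \<Omega>"
  shows "f \<in> L2 \<Omega>"
  using assms(1) Ck_imp_continuous_on[OF test_functions_Ck[OF assms(2), of 0]]
    test_functions_compact_support[OF assms(2)] test_function_outside_support
  by (rule L2_if_continuous_compact_support)

lemma test_function_grad_L2:
  assumes "\<Omega> \<in> lmeasurable" and f: "f \<in> test_functions \<Omega>" and b: "b \<in> Basis"
  shows "(\<lambda>x. grad f x \<bullet> b) \<in> L2 \<Omega>"
proof (rule L2_if_continuous_compact_support[OF assms(1)])
  show "continuous_on UNIV (\<lambda>x. grad f x \<bullet> b)"
    using test_functions_Ck[OF f, of 1] b by (simp add: grad_component[OF b])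
  show "compact (closure {x. f x \<noteq> 0})"
    using f by (rule test_functions_compact_support)
  fix x assume x: "x \<notin> closure {x. f x \<noteq> 0}"
  have "(f has_derivative (\<lambda>_. 0)) (at x)"
  proof (rule has_derivative_transform_within_open)
    show "((\<lambda>_. 0) has_derivative (\<lambda>_. 0)) (at x)" by (rule has_derivative_const)
    show "open (- closure {x. f x \<noteq> 0})" by (simp add: open_Compl)
    show "x \<in> - closure {x. f x \<noteq> 0}" using x by blast
    show "0 = f y" if "y \<in> - closure {x. f x \<noteq> 0}" for y
      using test_function_outside_support[of y f] that by simp
  qed
  from frechet_derivative_at[OF this] have "frechet_derivative f (at x) b = 0"
    by metis
  then show "grad f x \<bullet> b = 0" by (simp add: grad_component[OF b])
qed

lemma is_weak_gradient_iff_L2_inner: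
  "is_weak_gradient \<Omega> u g \<longleftrightarrow> (\<forall>f\<in>test_functions \<Omega>. \<forall>b\<in>Basis.
     L2_inner \<Omega> u (\<lambda>x. grad f x \<bullet> b) = - L2_inner \<Omega> (\<lambda>x. g x \<bullet> b) f)"
  by (simp add: is_weak_gradient_def L2_inner_def)

text \<open>The fundamental lemma of the calculus of variations: the bumps
  \<open>box_bump n a c\<close> tend boundedly to the indicator of a box whose closed box lies in
  \<Omega>, which reduces the claim to integrals over boxes.\<close>

lemma AE_eq_0_if_test_integrals_eq_0:
  fixes h :: "'a::euclidean_space \<Rightarrow> real"
  assumes \<Omega>: "open \<Omega>" and h: "integrable (lebesgue_on \<Omega>) h"
    and zero: "\<And>f. f \<in> test_functions \<Omega> \<Longrightarrow> (\<integral>x. f x * h x \<partial>lebesgue_on \<Omega>) = 0"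
  shows "AE x in lebesgue_on \<Omega>. h x = 0"
proof (rule AE_eq_0_if_cbox_integrals_eq_0[OF \<Omega> h])
  fix a c assume "cbox a c \<subseteq> \<Omega>"
  have meas: "borel_measurable borel \<subseteq> borel_measurable (lebesgue_on \<Omega>)"
    by (auto intro!: measurable_restrict_space1 measurable_completion)
  have "(\<lambda>n. \<integral>x. box_bump n a c x * h x \<partial>lebesgue_on \<Omega>) \<longlonglongrightarrow>
      (\<integral>x. indicat_real (box a c) x * h x \<partial>lebesgue_on \<Omega>)"
  proof (rule integral_dominated_convergence[where w = "\<lambda>x. norm (h x)"])
    have "box_bump n a c \<in> borel_measurable borel" for n
      using Ck_imp_continuous_on[OF Ck_box_bump] by (rule borel_measurable_continuous_onI)
    then have "box_bump n a c \<in> borel_measurable (lebesgue_on \<Omega>)" for n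
      using meas by blast
    then show "(\<lambda>x. box_bump n a c x * h x) \<in> borel_measurable (lebesgue_on \<Omega>)" for n
      by (rule borel_measurable_times[OF _ borel_measurable_integrable[OF h]])
    have "(\<lambda>x. indicat_real (box a c) x) \<in> borel_measurable (lebesgue_on \<Omega>)"
      using meas by auto
    then show "(\<lambda>x. indicat_real (box a c) x * h x) \<in> borel_measurable (lebesgue_on \<Omega>)"
      by (rule borel_measurable_times[OF _ borel_measurable_integrable[OF h]])
    show "integrable (lebesgue_on \<Omega>) (\<lambda>x. norm (h x))" using h by simp
    show "AE x in lebesgue_on \<Omega>. (\<lambda>n. box_bump n a c x * h x) \<longlonglongrightarrow> indicat_real (box a c) x * h x"
      by (intro AE_I2 tendsto_mult tendsto_const box_bump_tendsto)
    show "AE x in lebesgue_on \<Omega>. norm (box_bump n a c x * h x) \<le> norm (h x)" for n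
      using box_bump_bounds[of n a c] by (intro AE_I2) (simp add: abs_mult mult_left_le_one_le)
  qed
  moreover have "(\<integral>x. box_bump n a c x * h x \<partial>lebesgue_on \<Omega>) = 0" for n
    using zero[OF box_bump_test_function[OF \<open>cbox a c \<subseteq> \<Omega>\<close>]] .
  ultimately show "(\<integral>x. indicat_real (box a c) x * h x \<partial>lebesgue_on \<Omega>) = 0"
    by (simp add: LIMSEQ_const_iff)
qed

text \<open>Stated for functions that agree only almost everywhere, because \<open>wgrad\<close>
  chooses separately for each representative. Every later identity between chosen gradients is an
  instance.\<close>

lemma weak_gradient_unique:
  assumes \<Omega>: "open \<Omega>" "\<Omega> \<in> lmeasurable"
    and u: "u \<in> L2 \<Omega>" "v \<in> L2 \<Omega>" "AE x in lebesgue_on \<Omega>. u x = v x"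
    and g: "g \<in> L2 \<Omega>" "is_weak_gradient \<Omega> u g"
    and k: "k \<in> L2 \<Omega>" "is_weak_gradient \<Omega> v k"
  shows "AE x in lebesgue_on \<Omega>. g x = k x"
proof -
  have "AE x in lebesgue_on \<Omega>. g x \<bullet> b - k x \<bullet> b = 0" if b: "b \<in> Basis" for b
  proof (rule AE_eq_0_if_test_integrals_eq_0[OF \<Omega>(1)])
    have L2: "(\<lambda>x. g x \<bullet> b) \<in> L2 \<Omega>" "(\<lambda>x. k x \<bullet> b) \<in> L2 \<Omega>"
      using g(1) k(1) b by (auto intro: L2_component)
    then have d: "(\<lambda>x. g x \<bullet> b - k x \<bullet> b) \<in> L2 \<Omega>" by (rule L2_diff)
    have one: "(\<lambda>x. 1::real) \<in> L2 \<Omega>"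
      using finite_measure.integrable_const[OF finite_measure_lebesgue_on[OF \<Omega>(2)]]
      by (simp add: L2_def)
    show "integrable (lebesgue_on \<Omega>) (\<lambda>x. g x \<bullet> b - k x \<bullet> b)"
      using L2_integrable_inner[OF one d] by simp
    fix f assume f: "f \<in> test_functions \<Omega>"
    note f2 = test_function_L2[OF \<Omega>(2) f] and gr = test_function_grad_L2[OF \<Omega>(2) f b]
    have "L2_inner \<Omega> (\<lambda>x. g x \<bullet> b) f = L2_inner \<Omega> (\<lambda>x. k x \<bullet> b) f"
      using g(2) k(2) f b L2_inner_cong_AE[OF u(1) gr u(2) gr u(3)]
      by (simp add: is_weak_gradient_iff_L2_inner)
    then have "L2_inner \<Omega> f (\<lambda>x. g x \<bullet> b - k x \<bullet> b) = 0"
      by (subst L2_inner_commute) (simp add: L2_inner_diff_left L2 f2)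
    then show "(\<integral>x. f x * (g x \<bullet> b - k x \<bullet> b) \<partial>lebesgue_on \<Omega>) = 0"
      by (simp add: L2_inner_def)
  qed
  then have "AE x in lebesgue_on \<Omega>. \<forall>b\<in>Basis. g x \<bullet> b - k x \<bullet> b = 0"
    by (subst AE_ball_countable) (auto intro: countable_finite)
  then show ?thesis
    by eventually_elim (rule euclidean_eqI, simp)
qed

section \<open>Calculus with the chosen weak gradient\<close>

lemma H1_imp_L2: "u \<in> H1 \<Omega> \<Longrightarrow> u \<in> L2 \<Omega>"
  by (simp add: H1_def)

lemma wgrad_L2: "u \<in> H1 \<Omega> \<Longrightarrow> wgrad \<Omega> u \<in> L2 \<Omega>"
  and is_weak_gradient_wgrad: "u \<in> H1 \<Omega> \<Longrightarrow> is_weak_gradient \<Omega> u (wgrad \<Omega> u)"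
proof -
  assume "u \<in> H1 \<Omega>"
  then have "\<exists>g. g \<in> L2 \<Omega> \<and> is_weak_gradient \<Omega> u g" by (auto simp: H1_def)
  then have "wgrad \<Omega> u \<in> L2 \<Omega> \<and> is_weak_gradient \<Omega> u (wgrad \<Omega> u)"
    unfolding wgrad_def by (rule someI_ex)
  then show "wgrad \<Omega> u \<in> L2 \<Omega>" "is_weak_gradient \<Omega> u (wgrad \<Omega> u)" by auto
qed

lemma is_weak_gradient_diff:
  assumes \<Omega>: "\<Omega> \<in> lmeasurable"
    and u: "u \<in> L2 \<Omega>" "g \<in> L2 \<Omega>" "is_weak_gradient \<Omega> u g"
    and v: "v \<in> L2 \<Omega>" "k \<in> L2 \<Omega>" "is_weak_gradient \<Omega> v k"
  shows "is_weak_gradient \<Omega> (\<lambda>x. u x - v x) (\<lambda>x. g x - k x)"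
  unfolding is_weak_gradient_iff_L2_inner
proof (intro ballI)
  fix f :: "'a \<Rightarrow> real" and b :: 'a assume f: "f \<in> test_functions \<Omega>" and b: "b \<in> Basis"
  show "L2_inner \<Omega> (\<lambda>x. u x - v x) (\<lambda>x. grad f x \<bullet> b) = - L2_inner \<Omega> (\<lambda>x. (g x - k x) \<bullet> b) f"
    using u v f b
    by (simp add: L2_inner_diff_left inner_diff_left L2_component test_function_L2[OF \<Omega>]
        test_function_grad_L2[OF \<Omega>] is_weak_gradient_iff_L2_inner)
qed

lemma is_weak_gradient_diff_wgrad:
  assumes "\<Omega> \<in> lmeasurable" "u \<in> H1 \<Omega>" "v \<in> H1 \<Omega>"
  shows "is_weak_gradient \<Omega> (\<lambda>x. u x - v x) (\<lambda>x. wgrad \<Omega> u x - wgrad \<Omega> v x)"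
  using assms by (intro is_weak_gradient_diff H1_imp_L2 wgrad_L2 is_weak_gradient_wgrad)

lemma H1_diff:
  assumes "\<Omega> \<in> lmeasurable" "u \<in> H1 \<Omega>" "v \<in> H1 \<Omega>"
  shows "(\<lambda>x. u x - v x) \<in> H1 \<Omega>"
  unfolding H1_def mem_Collect_eq
  using L2_diff[OF wgrad_L2[OF assms(2)] wgrad_L2[OF assms(3)]]
    L2_diff[OF H1_imp_L2[OF assms(2)] H1_imp_L2[OF assms(3)]]
    is_weak_gradient_diff_wgrad[OF assms] by blast

lemma wgrad_diff:
  assumes "open \<Omega>" "\<Omega> \<in> lmeasurable" "u \<in> H1 \<Omega>" "v \<in> H1 \<Omega>"
  shows "AE x in lebesgue_on \<Omega>. wgrad \<Omega> (\<lambda>x. u x - v x) x = wgrad \<Omega> u x - wgrad \<Omega> v x"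
proof -
  note d = H1_diff[OF assms(2-4)]
  show ?thesis
    by (rule weak_gradient_unique[OF assms(1,2) H1_imp_L2[OF d] H1_imp_L2[OF d] AE_I2[OF refl]
          wgrad_L2[OF d] is_weak_gradient_wgrad[OF d]
          L2_diff[OF wgrad_L2[OF assms(3)] wgrad_L2[OF assms(4)]]
          is_weak_gradient_diff_wgrad[OF assms(2-4)]])
qed

lemma wgrad_cong_AE:
  assumes "open \<Omega>" "\<Omega> \<in> lmeasurable" "u \<in> H1 \<Omega>" "v \<in> H1 \<Omega>"
    and "AE x in lebesgue_on \<Omega>. u x = v x"
  shows "AE x in lebesgue_on \<Omega>. wgrad \<Omega> u x = wgrad \<Omega> v x"
  by (rule weak_gradient_unique[OF assms(1,2) H1_imp_L2[OF assms(3)] H1_imp_L2[OF assms(4)] assms(5)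
        wgrad_L2[OF assms(3)] is_weak_gradient_wgrad[OF assms(3)]
        wgrad_L2[OF assms(4)] is_weak_gradient_wgrad[OF assms(4)]])

lemma L2_norm_wgrad_le_H1_norm: "L2_norm \<Omega> (wgrad \<Omega> u) \<le> H1_norm \<Omega> u"
  by (auto simp: H1_norm_def intro!: real_le_rsqrt)

lemma H1_norm_nonneg: "0 \<le> H1_norm \<Omega> u"
  by (simp add: H1_norm_def)

section \<open>Square-integrable curves in the Hilbert space\<close>

text \<open>Sum the hypothesis over an equidistant partition into \<open>Suc n\<close> pieces.
  Everything telescopes, and the error shrinks to \<open>t / Suc n\<close> times the total increment
  of \<open>Q\<close>. This takes the place of differentiating \<open>f\<close>.\<close>

lemma increment_le_if_locally_superadditive:
  fixes f P Q :: "real \<Rightarrow> real"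
  assumes "0 \<le> t"
    and le: "\<And>a b. 0 \<le> a \<Longrightarrow> a \<le> b \<Longrightarrow> b \<le> t \<Longrightarrow> f b - f a \<le> (P b - P a) + (b - a) * (Q b - Q a)"
  shows "f t - f 0 \<le> P t - P 0"
proof -
  have "f t - f 0 \<le> (P t - P 0) + t / real (Suc n) * (Q t - Q 0)" for n
  proof -
    define x where "x i = t * real i / real (Suc n)" for i
    have x0: "x 0 = 0" and xn: "x (Suc n) = t" by (simp_all add: x_def)
    have step: "x (Suc i) - x i = t / real (Suc n)" for i
      by (simp add: x_def distrib_left add_divide_distrib)
    have "f (x (Suc i)) - f (x i) \<le> (P (x (Suc i)) - P (x i)) + t / real (Suc n) * (Q (x (Suc i)) - Q (x i))"
      if "i < Suc n" for i
    proof -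
      have "0 \<le> x i" using assms(1) by (simp add: x_def)
      moreover have "x i \<le> x (Suc i)" using step[of i] assms(1) by (simp add: x_def divide_right_mono mult_left_mono)
      moreover have "x (Suc i) \<le> x (Suc n)"
        unfolding x_def using assms(1) that by (intro divide_right_mono mult_left_mono) auto
      ultimately show ?thesis using le[of "x i" "x (Suc i)"] by (simp only: step xn)
    qed
    then have "(\<Sum>i<Suc n. f (x (Suc i)) - f (x i)) \<le>
        (\<Sum>i<Suc n. (P (x (Suc i)) - P (x i)) + t / real (Suc n) * (Q (x (Suc i)) - Q (x i)))"
      by (intro sum_mono) blast
    then show ?thesis
      unfolding sum.distrib sum_distrib_left[symmetric]
        sum_lessThan_telescope[of "\<lambda>i. f (x i)"] sum_lessThan_telescope[of "\<lambda>i. P (x i)"]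
        sum_lessThan_telescope[of "\<lambda>i. Q (x i)"]
      by (simp only: x0 xn)
  qed
  moreover have "(\<lambda>n. (P t - P 0) + t / real (Suc n) * (Q t - Q 0)) \<longlonglongrightarrow> (P t - P 0) + 0 * (Q t - Q 0)"
  proof (intro tendsto_intros)
    show "(\<lambda>n. t / real (Suc n)) \<longlonglongrightarrow> 0" by real_asymp
  qed
  ultimately show ?thesis
    using LIMSEQ_le_const[of "\<lambda>n. (P t - P 0) + t / real (Suc n) * (Q t - Q 0)"] by fastforce
qed

text \<open>Let \<open>exp (- k * t) * Y t\<close> attain its maximum at \<open>r\<close>. Inserting
  the resulting exponential bound into the integral inequality at \<open>r\<close> gives
  \<open>Y r \<le> Y r / 2\<close>, so the maximum is zero.\<close>

lemma Gronwall_zero: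
  fixes Y :: "real \<Rightarrow> real"
  assumes cont: "continuous_on {0..T} Y" and nonneg: "\<And>t. t \<in> {0..T} \<Longrightarrow> 0 \<le> Y t"
    and C: "0 \<le> C" and le: "\<And>t. t \<in> {0..T} \<Longrightarrow> Y t \<le> C * integral {0..t} Y"
    and t: "t \<in> {0..T}"
  shows "Y t = 0"
proof -
  \<comment> \<open>Doubling \<open>C\<close> yields \<open>C / k \<le> 1 / 2\<close>; the added 1
    keeps \<open>k\<close> positive when \<open>C = 0\<close>.\<close>
  define k where "k = 2 * C + 1"
  have k: "k > 0" using C by (simp add: k_def)
  have "compact {0..T}" "{0..T} \<noteq> {}" using t by auto
  moreover have "continuous_on {0..T} (\<lambda>t. exp (- k * t) * Y t)"
    by (intro continuous_intros cont)
  ultimately have "\<exists>r\<in>{0..T}. \<forall>t\<in>{0..T}. exp (- k * t) * Y t \<le> exp (- k * r) * Y r"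
    by (rule continuous_attains_sup)
  then obtain r where r: "r \<in> {0..T}"
    "\<And>t. t \<in> {0..T} \<Longrightarrow> exp (- k * t) * Y t \<le> exp (- k * r) * Y r"
    by blast
  define m where "m = exp (- k * r) * Y r"
  have "0 \<le> m" using nonneg[OF r(1)] by (simp add: m_def)
  have Ym: "Y s \<le> m * exp (k * s)" if "s \<in> {0..T}" for s
    using r(2)[OF that] unfolding m_def[symmetric] by (simp add: exp_minus field_simps)
  have hi: "((\<lambda>s. m * exp (k * s)) has_integral (m * exp (k * r) / k - m * exp (k * 0) / k)) {0..r}"
    using r(1) k
    by (intro fundamental_theorem_of_calculus)
       (auto intro!: derivative_eq_intros simp: has_real_derivative_iff_has_vector_derivative[symmetric])
  have "Y r \<le> C * integral {0..r} Y" by (rule le[OF r(1)])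
  also have "\<dots> \<le> C * integral {0..r} (\<lambda>s. m * exp (k * s))"
  proof (intro mult_left_mono integral_le C)
    show "Y integrable_on {0..r}"
      using cont r(1) by (intro integrable_continuous_real continuous_on_subset[OF cont]) auto
    show "(\<lambda>s. m * exp (k * s)) integrable_on {0..r}" using hi by blast
    show "Y s \<le> m * exp (k * s)" if "s \<in> {0..r}" for s using that r(1) by (intro Ym) auto
  qed
  also have "\<dots> = C * (m * exp (k * r) / k - m / k)" using integral_unique[OF hi] by simp
  also have "\<dots> \<le> C * (m * exp (k * r) / k)"
    using C \<open>0 \<le> m\<close> k by (intro mult_left_mono) auto
  also have "\<dots> \<le> (m * exp (k * r)) / 2"
  proof -
    have "C / k \<le> 1 / 2" using k C by (simp add: k_def field_simps)
    then have "C / k * (m * exp (k * r)) \<le> 1 / 2 * (m * exp (k * r))"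
      using \<open>0 \<le> m\<close> by (intro mult_right_mono) auto
    then show ?thesis by simp
  qed
  also have "m * exp (k * r) = Y r" by (simp add: m_def exp_minus)
  finally have "Y r = 0" using nonneg[OF r(1)] by simp
  then have "m = 0" by (simp add: m_def)
  then show ?thesis using Ym[OF t] nonneg[OF t] by simp
qed

text \<open>An abstract form of the curve of gradient differences. Only its scalar products with
  fixed functions are required to be measurable in time; the majorant \<open>\<gamma>\<close>
  carries the measurability and square integrability that the norms would need.\<close>

locale L2_curve =
  fixes \<Omega> :: "'a::euclidean_space set" and T :: real
    and g :: "real \<Rightarrow> 'a \<Rightarrow> 'b::euclidean_space" and \<gamma> :: "real \<Rightarrow> real"
  assumes domain_lmeasurable: "\<Omega> \<in> lmeasurable"
    and g_L2: "\<And>s. g s \<in> L2 \<Omega>"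
    and g_measurable: "\<And>v. v \<in> L2 \<Omega> \<Longrightarrow>
      (\<lambda>s. L2_inner \<Omega> (g s) v) \<in> borel_measurable (lebesgue_on {0<..<T})"
    and \<gamma>_L2: "\<gamma> \<in> L2 {0<..<T}"
    and g_bound: "AE s in lebesgue_on {0<..<T}. L2_norm \<Omega> (g s) \<le> \<gamma> s"
begin

text \<open>The indicator lets all times share one measure space, so integrability is established
  once and increments are integrals of differences.\<close>

definition integral_upto :: "real \<Rightarrow> (real \<Rightarrow> real) \<Rightarrow> real" where
  "integral_upto t f = (\<integral>s. indicat_real {0<..<t} s * f s \<partial>lebesgue_on {0<..<T})"

lemma integrable_indicator_mult:
  fixes f :: "real \<Rightarrow> real"
  assumes "integrable (lebesgue_on {0<..<T}) f" and "A \<in> sets borel"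
  shows "integrable (lebesgue_on {0<..<T}) (\<lambda>s. indicat_real A s * f s)"
proof -
  have "indicat_real A \<in> borel_measurable (lebesgue_on {0<..<T})"
    using assms(2) by (intro measurable_restrict_space1 measurable_completion) simp
  then show ?thesis
    by (intro Bochner_Integration.integrable_bound[OF assms(1)] borel_measurable_times
        borel_measurable_integrable[OF assms(1)] AE_I2) (simp_all add: abs_mult mult_left_le_one_le)
qed

lemma integral_upto_diff:
  assumes f: "integrable (lebesgue_on {0<..<T}) f" and ab: "0 \<le> a" "a \<le> b"
  shows "integral_upto b f - integral_upto a f = (\<integral>s. indicat_real {a..<b} s * f s \<partial>lebesgue_on {0<..<T})"
proof -
  have "integral_upto b f - integral_upto a f =
      (\<integral>s. indicat_real {0<..<b} s * f s - indicat_real {0<..<a} s * f s \<partial>lebesgue_on {0<..<T})"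
    unfolding integral_upto_def using f by (subst Bochner_Integration.integral_diff) (auto intro: integrable_indicator_mult)
  also have "\<dots> = (\<integral>s. indicat_real {a..<b} s * f s \<partial>lebesgue_on {0<..<T})"
    \<comment> \<open>The indicators may disagree at the point 0 when \<open>a = 0\<close>, but 0
      lies outside the measure space.\<close>
    using ab by (intro Bochner_Integration.integral_cong) (auto simp: indicator_def)
  finally show ?thesis .
qed

lemma \<gamma>_integrable: "integrable (lebesgue_on {0<..<T}) \<gamma>"
proof -
  have T: "{0<..<T} \<in> lmeasurable" by simp
  have one: "(\<lambda>x::real. 1::real) \<in> L2 {0<..<T}"
    using finite_measure.integrable_const[OF finite_measure_lebesgue_on[OF T]]
    by (simp add: L2_def)
  show ?thesis using L2_integrable_inner[OF one \<gamma>_L2] by simp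
qed

lemma integrable_L2_inner_g:
  assumes v: "v \<in> L2 \<Omega>"
  shows "integrable (lebesgue_on {0<..<T}) (\<lambda>s. L2_inner \<Omega> (g s) v)"
proof (rule Bochner_Integration.integrable_bound)
  show "integrable (lebesgue_on {0<..<T}) (\<lambda>s. \<gamma> s * L2_norm \<Omega> v)"
    using \<gamma>_integrable by simp
  show "AE s in lebesgue_on {0<..<T}. norm (L2_inner \<Omega> (g s) v) \<le> norm (\<gamma> s * L2_norm \<Omega> v)"
    using g_bound
  proof eventually_elim
    case (elim s)
    have "\<bar>L2_inner \<Omega> (g s) v\<bar> \<le> L2_norm \<Omega> (g s) * L2_norm \<Omega> v"
      by (rule L2_Cauchy_Schwarz[OF g_L2 v])
    also have "\<dots> \<le> \<gamma> s * L2_norm \<Omega> v"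
      using elim L2_norm_nonneg by (rule mult_right_mono)
    finally show ?case by simp
  qed
qed (rule g_measurable[OF v])

text \<open>Pairing with \<open>v\<close> and integrating in time is a linear functional of
  \<open>v\<close>, bounded with constant the integral of \<open>\<gamma>\<close> over
  (0,T).\<close>

lemma exists_L2_integral:
  "\<exists>w\<in>L2 \<Omega>. \<forall>v\<in>L2 \<Omega>. L2_inner \<Omega> w v = integral_upto t (\<lambda>s. L2_inner \<Omega> (g s) v)"
proof (rule L2_Riesz[OF domain_lmeasurable])
  fix u v :: "'a \<Rightarrow> 'b" assume u: "u \<in> L2 \<Omega>" and v: "v \<in> L2 \<Omega>"
  have "integral_upto t (\<lambda>s. L2_inner \<Omega> (g s) (\<lambda>x. u x + v x)) =
      (\<integral>s. indicat_real {0<..<t} s * L2_inner \<Omega> (g s) u + indicat_real {0<..<t} s * L2_inner \<Omega> (g s) v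
        \<partial>lebesgue_on {0<..<T})"
    unfolding integral_upto_def by (simp add: L2_inner_add_right g_L2 u v distrib_left)
  also have "\<dots> = integral_upto t (\<lambda>s. L2_inner \<Omega> (g s) u) + integral_upto t (\<lambda>s. L2_inner \<Omega> (g s) v)"
    unfolding integral_upto_def using u v
    by (intro Bochner_Integration.integral_add integrable_indicator_mult integrable_L2_inner_g) auto
  finally show "integral_upto t (\<lambda>s. L2_inner \<Omega> (g s) (\<lambda>x. u x + v x)) =
      integral_upto t (\<lambda>s. L2_inner \<Omega> (g s) u) + integral_upto t (\<lambda>s. L2_inner \<Omega> (g s) v)" .
next
  fix u :: "'a \<Rightarrow> 'b" and c assume u: "u \<in> L2 \<Omega>"
  show "integral_upto t (\<lambda>s. L2_inner \<Omega> (g s) (\<lambda>x. c *\<^sub>R u x)) = c * integral_upto t (\<lambda>s. L2_inner \<Omega> (g s) u)"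
    unfolding integral_upto_def L2_inner_scaleR_right
    by (subst Bochner_Integration.integral_mult_right_zero[symmetric])
       (simp add: mult.left_commute)
next
  fix u :: "'a \<Rightarrow> 'b" assume u: "u \<in> L2 \<Omega>"
  have "\<bar>integral_upto t (\<lambda>s. L2_inner \<Omega> (g s) u)\<bar> \<le>
      (\<integral>s. \<gamma> s * L2_norm \<Omega> u \<partial>lebesgue_on {0<..<T})"
    unfolding integral_upto_def
  proof (rule integral_abs_bound[THEN order_trans], rule integral_mono_AE)
    show "integrable (lebesgue_on {0<..<T}) (\<lambda>s. \<bar>indicat_real {0<..<t} s * L2_inner \<Omega> (g s) u\<bar>)"
      by (intro integrable_abs integrable_indicator_mult integrable_L2_inner_g u) simp
    show "integrable (lebesgue_on {0<..<T}) (\<lambda>s. \<gamma> s * L2_norm \<Omega> u)"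
      using \<gamma>_integrable by simp
    show "AE s in lebesgue_on {0<..<T}.
        \<bar>indicat_real {0<..<t} s * L2_inner \<Omega> (g s) u\<bar> \<le> \<gamma> s * L2_norm \<Omega> u"
      using g_bound
    proof eventually_elim
      case (elim s)
      have "\<bar>indicat_real {0<..<t} s * L2_inner \<Omega> (g s) u\<bar> \<le> \<bar>L2_inner \<Omega> (g s) u\<bar>"
        by (simp add: indicator_def)
      also have "\<dots> \<le> L2_norm \<Omega> (g s) * L2_norm \<Omega> u"
        by (rule L2_Cauchy_Schwarz[OF g_L2 u])
      also have "\<dots> \<le> \<gamma> s * L2_norm \<Omega> u"
        using elim L2_norm_nonneg by (rule mult_right_mono)
      finally show ?case .
    qed
  qed
  also have "\<dots> = (\<integral>s. \<gamma> s \<partial>lebesgue_on {0<..<T}) * L2_norm \<Omega> u"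
    by simp
  finally show "\<bar>integral_upto t (\<lambda>s. L2_inner \<Omega> (g s) u)\<bar> \<le> (\<integral>s. \<gamma> s \<partial>lebesgue_on {0<..<T}) * L2_norm \<Omega> u" .
qed

text \<open>A weak integral, given by Riesz representation: it replaces the Bochner integral of \<open>g\<close>
  over \<open>(0,t)\<close>, which is not available because \<open>L2 \<Omega>\<close> is a carrier set and not a type.\<close>

definition primitive :: "real \<Rightarrow> 'a \<Rightarrow> 'b" where
  "primitive t = (SOME w. w \<in> L2 \<Omega> \<and> (\<forall>v\<in>L2 \<Omega>. L2_inner \<Omega> w v = integral_upto t (\<lambda>s. L2_inner \<Omega> (g s) v)))"

lemma primitive_L2: "primitive t \<in> L2 \<Omega>"
  and L2_inner_primitive: "v \<in> L2 \<Omega> \<Longrightarrow> L2_inner \<Omega> (primitive t) v = integral_upto t (\<lambda>s. L2_inner \<Omega> (g s) v)"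
proof -
  have "\<exists>w. w \<in> L2 \<Omega> \<and> (\<forall>v\<in>L2 \<Omega>. L2_inner \<Omega> w v = integral_upto t (\<lambda>s. L2_inner \<Omega> (g s) v))"
    using exists_L2_integral[of t] by blast
  from someI_ex[OF this] have "primitive t \<in> L2 \<Omega> \<and>
      (\<forall>v\<in>L2 \<Omega>. L2_inner \<Omega> (primitive t) v = integral_upto t (\<lambda>s. L2_inner \<Omega> (g s) v))"
    unfolding primitive_def .
  then show "primitive t \<in> L2 \<Omega>"
    and "v \<in> L2 \<Omega> \<Longrightarrow> L2_inner \<Omega> (primitive t) v = integral_upto t (\<lambda>s. L2_inner \<Omega> (g s) v)" by blast+
qed

lemma L2_inner_primitive_diff:
  assumes "0 \<le> a" "a \<le> b" and v: "v \<in> L2 \<Omega>"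
  shows "L2_inner \<Omega> (\<lambda>x. primitive b x - primitive a x) v =
    (\<integral>s. indicat_real {a..<b} s * L2_inner \<Omega> (g s) v \<partial>lebesgue_on {0<..<T})"
  using integral_upto_diff[OF integrable_L2_inner_g[OF v] assms(1,2)]
  by (simp add: L2_inner_diff_left primitive_L2 v L2_inner_primitive)

text \<open>The triangle inequality for a weakly defined integral: the increment is paired with
  itself, and one factor of its norm is cancelled.\<close>

lemma primitive_norm_increment:
  assumes "0 \<le> a" "a \<le> b"
  shows "L2_norm \<Omega> (\<lambda>x. primitive b x - primitive a x) \<le> integral_upto b \<gamma> - integral_upto a \<gamma>"
proof -
  let ?d = "\<lambda>x. primitive b x - primitive a x"
  have d: "?d \<in> L2 \<Omega>" by (intro L2_diff primitive_L2)
  have "L2_norm \<Omega> ?d * L2_norm \<Omega> ?d = L2_inner \<Omega> ?d ?d"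
    by (simp add: L2_norm_square[symmetric] power2_eq_square)
  also have "\<dots> = (\<integral>s. indicat_real {a..<b} s * L2_inner \<Omega> (g s) ?d \<partial>lebesgue_on {0<..<T})"
    by (rule L2_inner_primitive_diff[OF assms d])
  also have "\<dots> \<le> (\<integral>s. indicat_real {a..<b} s * \<gamma> s * L2_norm \<Omega> ?d \<partial>lebesgue_on {0<..<T})"
  proof (rule integral_mono_AE)
    show "integrable (lebesgue_on {0<..<T}) (\<lambda>s. indicat_real {a..<b} s * L2_inner \<Omega> (g s) ?d)"
      by (intro integrable_indicator_mult integrable_L2_inner_g d) simp
    show "integrable (lebesgue_on {0<..<T}) (\<lambda>s. indicat_real {a..<b} s * \<gamma> s * L2_norm \<Omega> ?d)"
      by (intro integrable_mult_left integrable_indicator_mult \<gamma>_integrable) simp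
    show "AE s in lebesgue_on {0<..<T}. indicat_real {a..<b} s * L2_inner \<Omega> (g s) ?d
        \<le> indicat_real {a..<b} s * \<gamma> s * L2_norm \<Omega> ?d"
      using g_bound
    proof eventually_elim
      case (elim s)
      have "L2_inner \<Omega> (g s) ?d \<le> L2_norm \<Omega> (g s) * L2_norm \<Omega> ?d"
        using L2_Cauchy_Schwarz[OF g_L2[of s] d] by linarith
      also have "\<dots> \<le> \<gamma> s * L2_norm \<Omega> ?d"
        using elim L2_norm_nonneg by (rule mult_right_mono)
      finally show ?case by (simp add: indicator_def)
    qed
  qed
  also have "\<dots> = (integral_upto b \<gamma> - integral_upto a \<gamma>) * L2_norm \<Omega> ?d"
    using integral_upto_diff[OF \<gamma>_integrable assms] by simp
  finally have le: "L2_norm \<Omega> ?d * L2_norm \<Omega> ?d \<le> (integral_upto b \<gamma> - integral_upto a \<gamma>) * L2_norm \<Omega> ?d" .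
  show ?thesis
  proof (cases "L2_norm \<Omega> ?d = 0")
    \<comment> \<open>Nothing can be cancelled here. The right side is nonnegative because
      \<open>\<gamma>\<close> dominates a norm almost everywhere.\<close>
    case True
    have "0 \<le> (\<integral>s. indicat_real {a..<b} s * \<gamma> s \<partial>lebesgue_on {0<..<T})"
    proof (rule integral_nonneg_AE)
      show "AE s in lebesgue_on {0<..<T}. 0 \<le> indicat_real {a..<b} s * \<gamma> s"
        using g_bound
      proof eventually_elim
        case (elim s)
        then have "0 \<le> \<gamma> s" using L2_norm_nonneg[of \<Omega> "g s"] by linarith
        then show ?case by simp
      qed
    qed
    then show ?thesis using True integral_upto_diff[OF \<gamma>_integrable assms] by simp
  next
    case False
    then have "L2_norm \<Omega> ?d > 0" using L2_norm_nonneg[of \<Omega> ?d] by linarith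
    then show ?thesis using le by (rule mult_right_le_imp_le[rotated])
  qed
qed

text \<open>Cauchy-Schwarz in time against the indicator of [a,b). The factor \<open>b - a\<close>
  gained here is what makes the quadratic error vanish under refinement.\<close>

lemma integral_upto_\<gamma>_increment_square:
  assumes "0 \<le> a" "a \<le> b"
  shows "(integral_upto b \<gamma> - integral_upto a \<gamma>)\<^sup>2 \<le> (b - a) * (integral_upto b (\<lambda>s. (\<gamma> s)\<^sup>2) - integral_upto a (\<lambda>s. (\<gamma> s)\<^sup>2))"
proof -
  let ?i = "indicat_real {a..<b}"
  have meas: "?i \<in> borel_measurable (lebesgue_on {0<..<T})"
    by (intro measurable_restrict_space1 measurable_completion) simp
  have sq: "integrable (lebesgue_on {0<..<T}) (\<lambda>s. (\<gamma> s)\<^sup>2)"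
    using L2_integrable_norm_square[OF \<gamma>_L2] by simp
  have one: "integrable (lebesgue_on {0<..<T}) (\<lambda>s. 1::real)"
    by (intro finite_measure.integrable_const finite_measure_lebesgue_on) simp
  have i: "?i \<in> L2 {0<..<T}"
    by (rule L2I[OF meas one]) (simp add: indicator_def)
  have i\<gamma>: "(\<lambda>s. ?i s * \<gamma> s) \<in> L2 {0<..<T}"
    by (rule L2I[OF borel_measurable_times[OF meas L2_measurable[OF \<gamma>_L2]] sq]) (simp add: indicator_def)
  have ii: "?i s * ?i s = ?i s" for s by (simp add: indicator_def)
  have "integral_upto b \<gamma> - integral_upto a \<gamma> = L2_inner {0<..<T} ?i (\<lambda>s. ?i s * \<gamma> s)"
    unfolding integral_upto_diff[OF \<gamma>_integrable assms] L2_inner_def by (simp add: mult.assoc[symmetric] ii)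
  then have "(integral_upto b \<gamma> - integral_upto a \<gamma>)\<^sup>2 \<le> (L2_norm {0<..<T} ?i * L2_norm {0<..<T} (\<lambda>s. ?i s * \<gamma> s))\<^sup>2"
    using L2_Cauchy_Schwarz[OF i i\<gamma>] by (metis abs_ge_zero power2_abs power_mono)
  also have "\<dots> = (L2_norm {0<..<T} ?i)\<^sup>2 * (L2_norm {0<..<T} (\<lambda>s. ?i s * \<gamma> s))\<^sup>2"
    by (rule power_mult_distrib)
  also have "(L2_norm {0<..<T} (\<lambda>s. ?i s * \<gamma> s))\<^sup>2 = integral_upto b (\<lambda>s. (\<gamma> s)\<^sup>2) - integral_upto a (\<lambda>s. (\<gamma> s)\<^sup>2)"
    unfolding integral_upto_diff[OF sq assms] L2_norm_square L2_inner_def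
    by (intro Bochner_Integration.integral_cong) (auto simp: indicator_def power2_eq_square)
  also have "(L2_norm {0<..<T} ?i)\<^sup>2 = measure (lebesgue_on {0<..<T}) ({a..<b} \<inter> {0<..<T})"
    unfolding L2_norm_square L2_inner_def by (simp add: ii)
  also have "\<dots> = measure lebesgue ({a..<b} \<inter> {0<..<T})"
    by (subst measure_restrict_space) auto
  \<comment> \<open>Only an inequality, since \<open>b\<close> is not assumed to stay below
    \<open>T\<close>.\<close>
  also have "\<dots> \<le> measure lebesgue {a..b}"
    by (intro measure_mono_fmeasurable) auto
  also have "\<dots> = b - a" using assms by simp
  finally show ?thesis
    using L2_norm_nonneg by (smt (verit) mult_right_mono integral_upto_diff[OF sq assms] integral_nonneg_AE AE_I2 indicator_pos_le zero_le_power2 mult_nonneg_nonneg)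
qed

text \<open>The two increment bounds combine to Hoelder continuity of exponent 1/2, with the
  integral of the square of \<open>\<gamma>\<close> as constant. Gronwall's argument needs this
  continuity.\<close>

lemma primitive_norm_continuous: "continuous_on {0..T} (\<lambda>t. L2_norm \<Omega> (primitive t))"
proof -
  define B where "B = (\<integral>s. (\<gamma> s)\<^sup>2 \<partial>lebesgue_on {0<..<T})"
  have sq: "integrable (lebesgue_on {0<..<T}) (\<lambda>s. (\<gamma> s)\<^sup>2)"
    using L2_integrable_norm_square[OF \<gamma>_L2] by simp
  have *: "(L2_norm \<Omega> (primitive b) - L2_norm \<Omega> (primitive a))\<^sup>2 \<le> \<bar>b - a\<bar> * B"
    if "0 \<le> a" "a \<le> b" for a b
  proof -
    have "\<bar>L2_norm \<Omega> (primitive b) - L2_norm \<Omega> (primitive a)\<bar> \<le> integral_upto b \<gamma> - integral_upto a \<gamma>"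
      using L2_norm_reverse_triangle[OF primitive_L2 primitive_L2] primitive_norm_increment[OF that]
      by (rule order_trans)
    then have "(L2_norm \<Omega> (primitive b) - L2_norm \<Omega> (primitive a))\<^sup>2 \<le> (integral_upto b \<gamma> - integral_upto a \<gamma>)\<^sup>2"
      by (metis abs_ge_zero power2_abs power_mono)
    also have "\<dots> \<le> (b - a) * (integral_upto b (\<lambda>s. (\<gamma> s)\<^sup>2) - integral_upto a (\<lambda>s. (\<gamma> s)\<^sup>2))"
      by (rule integral_upto_\<gamma>_increment_square[OF that])
    also have "\<dots> \<le> (b - a) * B"
      unfolding integral_upto_diff[OF sq that] B_def
      using that by (intro mult_left_mono integral_mono integrable_indicator_mult sq)
        (auto simp: indicator_def)
    finally show ?thesis using that by simp
  qed
  have **: "(L2_norm \<Omega> (primitive s) - L2_norm \<Omega> (primitive t))\<^sup>2 \<le> \<bar>s - t\<bar> * B"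
    if "0 \<le> s" "0 \<le> t" for s t
  proof (cases "t \<le> s")
    case True
    then show ?thesis using * that by simp
  next
    case False
    then show ?thesis using *[of s t] that by (simp add: power2_commute abs_minus_commute)
  qed
  show ?thesis
    unfolding continuous_on_def
  proof
    fix t assume t: "t \<in> {0..T}"
    have "((\<lambda>s. sqrt (\<bar>s - t\<bar> * B)) \<longlongrightarrow> sqrt (\<bar>t - t\<bar> * B)) (at t within {0..T})"
      by (intro tendsto_intros)
    then have "((\<lambda>s. sqrt (\<bar>s - t\<bar> * B)) \<longlongrightarrow> 0) (at t within {0..T})" by simp
    moreover have "\<forall>\<^sub>F s in at t within {0..T}.
        norm (L2_norm \<Omega> (primitive s) - L2_norm \<Omega> (primitive t)) \<le> sqrt (\<bar>s - t\<bar> * B)"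
      unfolding eventually_at_filter
      using ** t by (intro always_eventually) (auto intro!: real_le_rsqrt)
    ultimately have "((\<lambda>s. L2_norm \<Omega> (primitive s) - L2_norm \<Omega> (primitive t)) \<longlongrightarrow> 0) (at t within {0..T})"
      by (rule Lim_null_comparison[rotated])
    then show "((\<lambda>s. L2_norm \<Omega> (primitive s)) \<longlongrightarrow> L2_norm \<Omega> (primitive t)) (at t within {0..T})"
      by (simp add: LIM_zero_iff)
  qed
qed

lemma integrable_primitive_norm_square:
  "integrable (lebesgue_on {0<..<T}) (\<lambda>s. (L2_norm \<Omega> (primitive s))\<^sup>2)"
proof (rule integrable_lebesgue_on_subset)
  show "integrable (lebesgue_on {0..T}) (\<lambda>s. (L2_norm \<Omega> (primitive s))\<^sup>2)"
    by (intro continuous_imp_integrable_real continuous_intros primitive_norm_continuous)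
qed auto

text \<open>No joint measurability of \<open>g\<close> in time and space is known, so Fubini's theorem cannot be
  used to differentiate the square of the norm. Instead the polarised difference is estimated: for
  \<open>s\<close> in \<open>[a,b)\<close> the sum of the primitives at \<open>a\<close> and \<open>b\<close> differs from twice the primitive at
  \<open>s\<close> by at most the integral of \<open>\<gamma>\<close> over \<open>(a,b)\<close>. The resulting quadratic error disappears when
  the increments over a refining partition are summed.\<close>

lemma primitive_norm_square_increment:
  assumes K: "AE s in lebesgue_on {0<..<T}.
      L2_inner \<Omega> (g s) (primitive s) \<le> K * (L2_norm \<Omega> (primitive s))\<^sup>2"
    and ab: "0 \<le> a" "a \<le> b"
  shows "(L2_norm \<Omega> (primitive b))\<^sup>2 - (L2_norm \<Omega> (primitive a))\<^sup>2 \<le>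
    2 * K * (integral_upto b (\<lambda>s. (L2_norm \<Omega> (primitive s))\<^sup>2) - integral_upto a (\<lambda>s. (L2_norm \<Omega> (primitive s))\<^sup>2)) +
    (integral_upto b \<gamma> - integral_upto a \<gamma>)\<^sup>2"
proof -
  let ?p = "\<lambda>x. primitive b x + primitive a x" and ?Y = "\<lambda>s. (L2_norm \<Omega> (primitive s))\<^sup>2"
  let ?\<Gamma> = "integral_upto b \<gamma> - integral_upto a \<gamma>"
  have p: "?p \<in> L2 \<Omega>" by (intro L2_add primitive_L2)
  have "?Y b - ?Y a = L2_inner \<Omega> (\<lambda>x. primitive b x - primitive a x) ?p"
    by (simp add: L2_norm_square L2_inner_diff_left L2_inner_add_right primitive_L2 p
        L2_inner_commute[of \<Omega> "primitive a" "primitive b"])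
  also have "\<dots> = (\<integral>s. indicat_real {a..<b} s * L2_inner \<Omega> (g s) ?p \<partial>lebesgue_on {0<..<T})"
    by (rule L2_inner_primitive_diff[OF ab p])
  also have "\<dots> \<le> (\<integral>s. 2 * K * (indicat_real {a..<b} s * ?Y s) + indicat_real {a..<b} s * \<gamma> s * ?\<Gamma>
      \<partial>lebesgue_on {0<..<T})"
  proof (rule integral_mono_AE)
    show "integrable (lebesgue_on {0<..<T}) (\<lambda>s. indicat_real {a..<b} s * L2_inner \<Omega> (g s) ?p)"
      by (intro integrable_indicator_mult integrable_L2_inner_g p) simp
    show "integrable (lebesgue_on {0<..<T})
        (\<lambda>s. 2 * K * (indicat_real {a..<b} s * ?Y s) + indicat_real {a..<b} s * \<gamma> s * ?\<Gamma>)"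
      by (intro Bochner_Integration.integrable_add integrable_mult_right integrable_mult_left integrable_indicator_mult
          \<gamma>_integrable integrable_primitive_norm_square) simp_all
    show "AE s in lebesgue_on {0<..<T}. indicat_real {a..<b} s * L2_inner \<Omega> (g s) ?p \<le>
        2 * K * (indicat_real {a..<b} s * ?Y s) + indicat_real {a..<b} s * \<gamma> s * ?\<Gamma>"
      using g_bound K
    proof eventually_elim
      case (elim s)
      show ?case
      proof (cases "s \<in> {a..<b}")
        case True
        let ?u = "\<lambda>x. primitive b x - primitive s x" and ?v = "\<lambda>x. primitive a x - primitive s x"
        have u: "?u \<in> L2 \<Omega>" and v: "?v \<in> L2 \<Omega>" by (intro L2_diff primitive_L2)+
        have "L2_inner \<Omega> (g s) ?p =
            2 * L2_inner \<Omega> (g s) (primitive s) + L2_inner \<Omega> (g s) ?u + L2_inner \<Omega> (g s) ?v"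
          by (simp add: L2_inner_add_right L2_inner_diff_right g_L2 primitive_L2)
        moreover have "L2_inner \<Omega> (g s) ?u + L2_inner \<Omega> (g s) ?v \<le>
            L2_norm \<Omega> (g s) * (L2_norm \<Omega> ?u + L2_norm \<Omega> ?v)"
          using L2_Cauchy_Schwarz[OF g_L2[of s] u] L2_Cauchy_Schwarz[OF g_L2[of s] v]
          by (simp add: distrib_left)
        moreover have "\<dots> \<le> \<gamma> s * ?\<Gamma>"
        proof (rule mult_mono)
          show "L2_norm \<Omega> ?u + L2_norm \<Omega> ?v \<le> ?\<Gamma>"
            using primitive_norm_increment[of s b] primitive_norm_increment[of a s] ab True
            by (simp add: L2_norm_minus_commute[of \<Omega> "primitive a" "primitive s"])
          show "0 \<le> \<gamma> s" using elim(1) L2_norm_nonneg order_trans by blast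
        qed (use elim L2_norm_nonneg in \<open>auto intro: add_nonneg_nonneg\<close>)
        ultimately show ?thesis using elim(2) True by simp
      qed simp
    qed
  qed
  also have "\<dots> = 2 * K * (\<integral>s. indicat_real {a..<b} s * ?Y s \<partial>lebesgue_on {0<..<T}) +
      (\<integral>s. indicat_real {a..<b} s * \<gamma> s \<partial>lebesgue_on {0<..<T}) * ?\<Gamma>"
    by (subst Bochner_Integration.integral_add)
      (auto intro!: integrable_mult_right integrable_mult_left integrable_indicator_mult
        \<gamma>_integrable integrable_primitive_norm_square)
  also have "\<dots> = 2 * K * (integral_upto b ?Y - integral_upto a ?Y) + ?\<Gamma>\<^sup>2"
    unfolding integral_upto_diff[OF integrable_primitive_norm_square ab] integral_upto_diff[OF \<gamma>_integrable ab]
    by (simp add: power2_eq_square)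
  finally show ?thesis .
qed

lemma integral_upto_eq_integral:
  assumes "continuous_on {0..T} f" and "t \<in> {0..T}"
  shows "integral_upto t f = integral {0..t} f"
proof -
  have "integral_upto t f = (\<integral>s. f s \<partial>lebesgue_on {0<..<t})"
    unfolding integral_upto_def using assms(2)
    by (auto simp: integral_restrict_space indicator_def intro!: Bochner_Integration.integral_cong)
  also have "\<dots> = integral {0<..<t} f"
  proof (rule lebesgue_integral_eq_integral)
    show "integrable (lebesgue_on {0<..<t}) f"
      by (rule integrable_lebesgue_on_subset[OF continuous_imp_integrable_real[OF assms(1)]])
        (use assms(2) in auto)
  qed simp
  also have "\<dots> = integral {0..t} f" using integral_open_interval[of 0 t f] by (simp add: box_real)
  finally show ?thesis .
qed

theorem primitive_norm_eq_0:
  assumes K: "AE s in lebesgue_on {0<..<T}.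
      L2_inner \<Omega> (g s) (primitive s) \<le> K * (L2_norm \<Omega> (primitive s))\<^sup>2"
    and "0 \<le> K" and t: "t \<in> {0..T}"
  shows "L2_norm \<Omega> (primitive t) = 0"
proof -
  let ?Y = "\<lambda>s. (L2_norm \<Omega> (primitive s))\<^sup>2"
  have cont: "continuous_on {0..T} ?Y"
    by (intro continuous_intros primitive_norm_continuous)
  have init: "?Y 0 = 0"
  proof -
    have "?Y 0 = integral_upto 0 (\<lambda>s. L2_inner \<Omega> (g s) (primitive 0))"
      unfolding L2_norm_square by (rule L2_inner_primitive[OF primitive_L2])
    then show ?thesis by (simp add: integral_upto_def)
  qed
  have "?Y t \<le> 2 * K * integral {0..t} ?Y" if t: "t \<in> {0..T}" for t
  proof -
    \<comment> \<open>The partition lemma is applied with \<open>2 * K\<close> times the integral of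
      \<open>?Y\<close> as main part and the integral of the square of \<open>\<gamma>\<close> as
      error function; the latter leaves no trace in the limit.\<close>
    have "?Y t - ?Y 0 \<le> 2 * K * integral_upto t ?Y - 2 * K * integral_upto 0 ?Y"
    proof (rule increment_le_if_locally_superadditive)
      fix a b :: real assume "0 \<le> a" "a \<le> b"
      then show "?Y b - ?Y a \<le> (2 * K * integral_upto b ?Y - 2 * K * integral_upto a ?Y) +
          (b - a) * (integral_upto b (\<lambda>s. (\<gamma> s)\<^sup>2) - integral_upto a (\<lambda>s. (\<gamma> s)\<^sup>2))"
        using primitive_norm_square_increment[OF K] integral_upto_\<gamma>_increment_square[of a b]
        by (smt (verit) right_diff_distrib)
    qed (use t in simp)
    then show ?thesis using init by (simp add: integral_upto_eq_integral[OF cont t]) (simp add: integral_upto_def)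
  qed
  then have "?Y t = 0"
    using Gronwall_zero[OF cont, of "2 * K" t] \<open>0 \<le> K\<close> t by simp
  then show ?thesis by simp
qed

end

section \<open>Anisotropy and potential\<close>

lemma continuous_on_grad: "Ck 1 A \<Longrightarrow> continuous_on UNIV (grad A)"
  unfolding grad_def[abs_def]
  by (intro continuous_on_sum continuous_on_scaleR continuous_on_const) auto

text \<open>Differentiating \<open>A (l *\<^sub>R p) = l\<^sup>2 * A p\<close> in \<open>p\<close>
  produces a factor \<open>l\<close> on the left by the chain rule; it cancels one of the two on the
  right.\<close>

lemma grad_scaleR_if_homogeneous:
  fixes A :: "'a::euclidean_space \<Rightarrow> real"
  assumes A: "Ck 1 A" and hom: "\<And>l p. l > 0 \<Longrightarrow> A (l *\<^sub>R p) = l\<^sup>2 * A p" and l: "l > 0"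
  shows "grad A (l *\<^sub>R p) = l *\<^sub>R grad A p"
proof (rule euclidean_eqI)
  fix b :: 'a assume b: "b \<in> Basis"
  from A have "Ck (Suc 0) A" by simp
  then obtain D where D: "\<And>x. (A has_derivative D x) (at x)" by (rule Ck_SucE) (rule that)
  have D_eq: "frechet_derivative A (at x) = D x" for x
    using frechet_derivative_at[OF D] by simp
  have "((\<lambda>p. A (l *\<^sub>R p)) has_derivative (\<lambda>h. D (l *\<^sub>R p) (l *\<^sub>R h))) (at p)"
    by (rule has_derivative_compose[OF _ D, where f = "\<lambda>p. l *\<^sub>R p"]) (auto intro!: derivative_eq_intros)
  moreover have "((\<lambda>p. l\<^sup>2 * A p) has_derivative (\<lambda>h. l\<^sup>2 * D p h)) (at p)"
    by (intro has_derivative_mult_right D)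
  ultimately have "(\<lambda>h. D (l *\<^sub>R p) (l *\<^sub>R h)) = (\<lambda>h. l\<^sup>2 * D p h)"
    using hom[OF l] by (intro has_derivative_unique) simp_all
  then have "D (l *\<^sub>R p) (l *\<^sub>R b) = l\<^sup>2 * D p b" by (rule fun_cong)
  then have "l * D (l *\<^sub>R p) b = l * (l * D p b)"
    using linear_scale[OF has_derivative_linear[OF D]] by (simp add: power2_eq_square)
  then show "grad A (l *\<^sub>R p) \<bullet> b = (l *\<^sub>R grad A p) \<bullet> b"
    using l by (simp add: grad_component[OF b] D_eq)
qed

text \<open>The gradient is homogeneous of degree one and, being continuous, bounded on the unit
  sphere.\<close>

lemma grad_linear_growth:
  fixes A :: "'a::euclidean_space \<Rightarrow> real"
  assumes A: "Ck 1 A" and hom: "\<And>l p. l > 0 \<Longrightarrow> A (l *\<^sub>R p) = l\<^sup>2 * A p"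
  obtains C where "\<And>p. norm (grad A p) \<le> C * norm p"
proof -
  have "bounded (grad A ` sphere 0 1)"
    by (intro compact_imp_bounded compact_continuous_image continuous_on_subset[OF continuous_on_grad[OF A]]) auto
  then have "\<exists>C. \<forall>p\<in>sphere 0 1. norm (grad A p) \<le> C"
    by (simp add: bounded_iff)
  then obtain C where "\<forall>p\<in>sphere 0 1. norm (grad A p) \<le> C" ..
  then have C: "norm (grad A p) \<le> C" if "norm p = 1" for p using that by simp
  have "norm (grad A p) \<le> C * norm p" for p
  proof (cases "p = 0")
    case True
    \<comment> \<open>The origin is no multiple of a unit vector with positive factor; scaling it by
      2 forces the gradient there to vanish.\<close>
    have "grad A 0 = 2 *\<^sub>R grad A 0"
      using grad_scaleR_if_homogeneous[OF A hom, of 2 0] by simp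
    then have "grad A 0 = 0" by (simp add: scaleR_2)
    then show ?thesis using True by simp
  next
    case False
    have "grad A p = norm p *\<^sub>R grad A (p /\<^sub>R norm p)"
      using grad_scaleR_if_homogeneous[OF A hom, of "norm p" "p /\<^sub>R norm p"] False by simp
    then have "norm (grad A p) = norm p * norm (grad A (p /\<^sub>R norm p))"
      by (metis abs_norm_cancel norm_scaleR)
    also have "\<dots> \<le> norm p * C" using False by (intro mult_left_mono C) auto
    finally show ?thesis by (simp add: mult.commute)
  qed
  then show ?thesis by (rule that)
qed

lemma grad_compose_L2:
  fixes A :: "'a::euclidean_space \<Rightarrow> real"
  assumes A: "Ck 1 A" and hom: "\<And>l p. l > 0 \<Longrightarrow> A (l *\<^sub>R p) = l\<^sup>2 * A p"
    and u: "u \<in> L2 \<Omega>"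
  shows "(\<lambda>x. grad A (u x)) \<in> L2 \<Omega>"
proof -
  obtain C where C: "\<And>p. norm (grad A p) \<le> C * norm p"
    using grad_linear_growth[OF A hom] by blast
  show ?thesis
  proof (rule L2I)
    show "(\<lambda>x. grad A (u x)) \<in> borel_measurable (lebesgue_on \<Omega>)"
      by (rule measurable_compose[OF L2_measurable[OF u]
            borel_measurable_continuous_onI[OF continuous_on_grad[OF A]]])
    show "integrable (lebesgue_on \<Omega>) (\<lambda>x. C\<^sup>2 * (norm (u x))\<^sup>2)"
      by (intro integrable_mult_right L2_integrable_norm_square u)
    show "AE x in lebesgue_on \<Omega>. (norm (grad A (u x)))\<^sup>2 \<le> C\<^sup>2 * (norm (u x))\<^sup>2"
      using C by (intro AE_I2) (simp add: power_mult_distrib[symmetric] power_mono)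
  qed
qed

section \<open>One-sided Lipschitz bounds for the derivative of the potential\<close>

lemma Ck_Suc_imp_DERIV:
  fixes h :: "real \<Rightarrow> real"
  assumes "Ck (Suc k) h"
  shows "(h has_real_derivative deriv h x) (at x)"
proof -
  obtain D where D: "\<And>x. (h has_derivative D x) (at x)"
    using assms by (rule Ck_SucE) (rule that)
  have "D x y = D x 1 * y" for y
    using linear_scale[OF has_derivative_linear[OF D], of x y 1] by simp
  then have "(h has_real_derivative D x 1) (at x)"
    using D[of x] unfolding has_field_derivative_def by (metis (no_types, lifting) ext)
  then show ?thesis using DERIV_imp_deriv by metis
qed

text \<open>Add the tangent line inequalities at \<open>a\<close> and at \<open>b\<close>.\<close>

lemma convex_on_imp_deriv_mono:
  fixes f :: "real \<Rightarrow> real"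
  assumes "convex_on UNIV f" and D: "\<And>x. (f has_real_derivative f' x) (at x)"
  shows "0 \<le> (f' a - f' b) * (a - b)"
proof -
  have "f x - f c \<ge> f' c * (x - c)" for x c
    using assms(1) D[of c] by (intro convex_on_imp_above_tangent[where A = UNIV]) auto
  from this[of b a] this[of a b] show ?thesis by (simp add: algebra_simps)
qed

text \<open>The convex part contributes a nonnegative term, and the other part loses at most its
  Lipschitz constant times the square.\<close>

lemma decomposition_condition_one_sided:
  assumes "decomposition_condition F"
  shows "\<exists>L\<ge>0. \<forall>a b. - L * (a - b)\<^sup>2 \<le> (deriv F a - deriv F b) * (a - b)"
proof -
  from assms obtain F1 F2 L where F: "Ck 2 F1" "Ck 2 F2" "\<And>s. F s = F1 s + F2 s"
    "convex_on UNIV F1" and L: "L-lipschitz_on UNIV (deriv F2)"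
    unfolding decomposition_condition_def by blast
  have D1: "(F1 has_real_derivative deriv F1 x) (at x)"
    and D2: "(F2 has_real_derivative deriv F2 x) (at x)" for x
    using Ck_Suc_imp_DERIV[of 1] F(1,2) by (simp_all add: numeral_2_eq_2)
  have "F = (\<lambda>s. F1 s + F2 s)" using F(3) by (rule ext)
  then have deriv: "deriv F x = deriv F1 x + deriv F2 x" for x
    using DERIV_add[OF D1 D2] by (simp add: DERIV_imp_deriv)
  have "- L * (a - b)\<^sup>2 \<le> (deriv F a - deriv F b) * (a - b)" for a b
  proof -
    have "\<bar>deriv F2 a - deriv F2 b\<bar> \<le> L * \<bar>a - b\<bar>"
      using lipschitz_onD[OF L, of a b] by (simp add: dist_real_def)
    then have "\<bar>deriv F2 a - deriv F2 b\<bar> * \<bar>a - b\<bar> \<le> L * \<bar>a - b\<bar> * \<bar>a - b\<bar>"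
      by (intro mult_right_mono) auto
    then have "\<bar>(deriv F2 a - deriv F2 b) * (a - b)\<bar> \<le> L * (a - b)\<^sup>2"
      by (simp add: abs_mult power2_eq_square mult.assoc)
    moreover have "0 \<le> (deriv F1 a - deriv F1 b) * (a - b)"
      using F(4) D1 by (rule convex_on_imp_deriv_mono)
    ultimately show ?thesis by (simp add: deriv algebra_simps)
  qed
  moreover have "0 \<le> L" using L by (rule lipschitz_on_nonneg)
  ultimately show ?thesis by blast
qed

lemma log_potential_deriv:
  assumes "\<bar>s\<bar> < 1"
  shows "deriv (log_potential \<theta> \<theta>\<^sub>c) s = \<theta> / 2 * (ln (1 + s) - ln (1 - s)) - \<theta>\<^sub>c * s"
proof (rule DERIV_imp_deriv)
  show "(log_potential \<theta> \<theta>\<^sub>c has_real_derivative \<theta> / 2 * (ln (1 + s) - ln (1 - s)) - \<theta>\<^sub>c * s) (at s)"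
    unfolding log_potential_def[abs_def] using assms
    by (auto intro!: derivative_eq_intros simp: abs_less_iff)
qed

text \<open>The logarithmic part of the derivative is increasing on (-1,1). Only the linear part
  decreases, and it does so with slope \<open>\<theta>\<^sub>c\<close>.\<close>

lemma log_potential_one_sided:
  assumes "0 < \<theta>" and a: "\<bar>a\<bar> < 1" and b: "\<bar>b\<bar> < 1"
  shows "- \<theta>\<^sub>c * (a - b)\<^sup>2 \<le>
    (deriv (log_potential \<theta> \<theta>\<^sub>c) a - deriv (log_potential \<theta> \<theta>\<^sub>c) b) * (a - b)"
proof -
  define h where "h s = ln (1 + s) - ln (1 - s)" for s :: real
  have mono: "h s \<le> h t" if "s \<le> t" "\<bar>s\<bar> < 1" "\<bar>t\<bar> < 1" for s t
    using that unfolding h_def by (intro diff_mono) auto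
  have "0 \<le> (h a - h b) * (a - b)"
  proof (cases "a \<le> b")
    case True
    then show ?thesis using mono[of a b] a b by (intro mult_nonpos_nonpos) auto
  next
    case False
    then show ?thesis using mono[of b a] a b by (intro mult_nonneg_nonneg) auto
  qed
  moreover define c where "c = \<theta> / 2"
  ultimately have "0 \<le> c * ((h a - h b) * (a - b))" using assms(1) by simp
  then show ?thesis
    unfolding log_potential_deriv[OF a] log_potential_deriv[OF b] h_def[symmetric] c_def[symmetric]
    by (simp add: power2_eq_square algebra_simps)
qed

text \<open>The values at which \<open>deriv (pot P)\<close> is the intended derivative. With it, a
  single one-sided estimate covers both kinds of potential.\<close>

definition admissible_value :: "potential \<Rightarrow> real \<Rightarrow> bool" where
  "admissible_value P s \<longleftrightarrow> (case P of Regular F \<Rightarrow> True | Logarithmic \<theta> \<theta>\<^sub>c \<Rightarrow> \<bar>s\<bar> < 1)"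

lemma potential_one_sided:
  assumes "case P of Regular F \<Rightarrow> decomposition_condition F | Logarithmic \<theta> \<theta>\<^sub>c \<Rightarrow> 0 < \<theta> \<and> 0 < \<theta>\<^sub>c"
  shows "\<exists>L\<ge>0. \<forall>a b. admissible_value P a \<longrightarrow> admissible_value P b \<longrightarrow>
    - L * (a - b)\<^sup>2 \<le> (deriv (pot P) a - deriv (pot P) b) * (a - b)"
proof (cases P)
  case (Regular F)
  then show ?thesis using assms decomposition_condition_one_sided[of F] by (auto simp: admissible_value_def)
next
  case (Logarithmic \<theta> \<theta>\<^sub>c)
  then show ?thesis
    using assms log_potential_one_sided[of \<theta>] by (auto simp: admissible_value_def intro!: exI[of _ \<theta>\<^sub>c])
qed

text \<open>Lebesgue measure is complete; extension by zero transfers this from the whole space to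
  \<open>S\<close>.\<close>

lemma borel_measurable_lebesgue_on_AE:
  fixes f g :: "'a::euclidean_space \<Rightarrow> 'b::euclidean_space"
  assumes S: "S \<in> sets lebesgue" and f: "f \<in> borel_measurable (lebesgue_on S)"
    and eq: "AE x in lebesgue_on S. f x = g x"
  shows "g \<in> borel_measurable (lebesgue_on S)"
proof -
  have "(\<lambda>x. if x \<in> S then f x else 0) \<in> borel_measurable lebesgue"
    using f S by (simp add: borel_measurable_if)
  moreover have "AE x in lebesgue. (if x \<in> S then f x else 0) = (if x \<in> S then g x else 0)"
    using eq S by (auto simp: AE_restrict_space_iff elim!: eventually_mono)
  ultimately have "(\<lambda>x. if x \<in> S then g x else 0) \<in> borel_measurable lebesgue"
    by (rule borel_measurable_AE)
  then show ?thesis using S by (simp add: borel_measurable_if)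
qed

lemma borel_measurable_lebesgue_on_AE_limit:
  fixes f :: "nat \<Rightarrow> 'a::euclidean_space \<Rightarrow> 'b::euclidean_space"
  assumes S: "S \<in> sets lebesgue" and f: "\<And>k. f k \<in> borel_measurable (lebesgue_on S)"
    and lim: "AE x in lebesgue_on S. (\<lambda>k. f k x) \<longlonglongrightarrow> g x"
  shows "g \<in> borel_measurable (lebesgue_on S)"
proof (rule borel_measurable_lebesgue_on_AE[OF S])
  show "(\<lambda>x. lim (\<lambda>k. f k x)) \<in> borel_measurable (lebesgue_on S)"
    using f by (rule borel_measurable_lim_metric)
  show "AE x in lebesgue_on S. lim (\<lambda>k. f k x) = g x"
    using lim by eventually_elim (rule limI)
qed

text \<open>The points of (0,T) where \<open>f\<close> is nonzero form an open null set, hence the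
  empty set; the closure adds the end points.\<close>

lemma continuous_AE_eq_0_imp_eq_0:
  fixes f :: "real \<Rightarrow> real"
  assumes T: "0 < T" and f: "continuous_on {0..T} f"
    and AE: "AE t in lebesgue_on {0<..<T}. f t = 0" and t: "t \<in> {0..T}"
  shows "f t = 0"
proof -
  have "open ({0<..<T} \<inter> f -` (- {0}))"
    by (intro continuous_open_preimage continuous_on_subset[OF f]) auto
  moreover have "negligible ({0<..<T} \<inter> f -` (- {0}))"
  proof -
    have "AE t in lebesgue. t \<notin> {0<..<T} \<inter> f -` (- {0})"
      using AE by (auto simp: AE_restrict_space_iff elim!: eventually_mono)
    then show ?thesis
      by (simp add: negligible_iff_null_sets completion.null_sets_iff_AE)
  qed
  ultimately have empty: "{0<..<T} \<inter> f -` (- {0}) = {}"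
    using open_not_negligible by blast
  have cl: "closure {0<..<T} = {0..T}" using T by simp
  show ?thesis
  proof (rule continuous_constant_on_closure[of "{0<..<T}" f 0])
    show "f x = 0" if "x \<in> {0<..<T}" for x using empty that by auto
  qed (use f t cl in auto)
qed

section \<open>Weak solutions\<close>

lemma AE_lebesgue_on_subset:
  assumes "AE x in lebesgue_on S. P x" and "T \<subseteq> S" and "S \<in> sets lebesgue" and "T \<in> sets lebesgue"
  shows "AE x in lebesgue_on T. P x"
  using assms by (auto simp: AE_restrict_space_iff elim!: eventually_mono)

lemma Bochner_L2_AE_mem: "f \<in> Bochner_L2 T X N \<Longrightarrow> AE t in lebesgue_on {0<..<T}. f t \<in> X"
  by (simp add: Bochner_L2_def strongly_measurable_def)

text \<open>The definition speaks of integrability of the square of the norm; its root returns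
  measurability of the norm itself.\<close>

lemma Bochner_L2_norm_L2:
  assumes f: "f \<in> Bochner_L2 T X N" and N: "\<And>u. 0 \<le> N u"
  shows "(\<lambda>t. N (f t)) \<in> L2 {0<..<T}"
proof -
  have int: "integrable (lebesgue_on {0<..<T}) (\<lambda>t. (N (f t))\<^sup>2)"
    using f by (simp add: Bochner_L2_def)
  then have "(\<lambda>t. sqrt ((N (f t))\<^sup>2)) \<in> borel_measurable (lebesgue_on {0<..<T})"
    by (intro measurable_compose[OF borel_measurable_integrable borel_measurable_continuous_onI])
      (auto intro!: continuous_intros)
  then show ?thesis using int by (simp add: L2_def N)
qed

text \<open>A simple function composed with any map is simple, so the approximants cause no
  difficulty although \<open>wgrad\<close> is a choice. They converge because the H1 norm dominates
  the L2 norm of the difference of gradients.\<close>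

lemma L2_inner_wgrad_measurable:
  assumes \<Omega>: "open \<Omega>" "\<Omega> \<in> lmeasurable"
    and \<mu>: "\<mu> \<in> Bochner_L2 T (H1 \<Omega>) (H1_norm \<Omega>)" and v: "v \<in> L2 \<Omega>"
  shows "(\<lambda>s. L2_inner \<Omega> (wgrad \<Omega> (\<mu> s)) v) \<in> borel_measurable (lebesgue_on {0<..<T})"
proof -
  obtain S where S: "\<And>k::nat. simple_function (lebesgue_on {0<..<T}) (S k)"
    "\<And>k. S k ` {0<..<T} \<subseteq> H1 \<Omega>"
    and lim: "AE t in lebesgue_on {0<..<T}. (\<lambda>k. H1_norm \<Omega> (\<lambda>x. S k t x - \<mu> t x)) \<longlonglongrightarrow> 0"
    using \<mu> unfolding Bochner_L2_def strongly_measurable_def by blast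
  show ?thesis
  proof (rule borel_measurable_lebesgue_on_AE_limit)
    show "(\<lambda>s. L2_inner \<Omega> (wgrad \<Omega> (S k s)) v) \<in> borel_measurable (lebesgue_on {0<..<T})" for k
      by (rule borel_measurable_simple_function[OF simple_function_compose1[OF S(1)]])
    have "AE t in lebesgue_on {0<..<T}. t \<in> {0<..<T}"
      using AE_space[of "lebesgue_on {0<..<T}"] by simp
    then show "AE s in lebesgue_on {0<..<T}.
        (\<lambda>k. L2_inner \<Omega> (wgrad \<Omega> (S k s)) v) \<longlonglongrightarrow> L2_inner \<Omega> (wgrad \<Omega> (\<mu> s)) v"
      using lim Bochner_L2_AE_mem[OF \<mu>]
    proof eventually_elim
      case (elim s)
      have Sk: "S k s \<in> H1 \<Omega>" for k using S(2) elim(1) by blast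
      have bound: "norm (L2_inner \<Omega> (wgrad \<Omega> (S k s)) v - L2_inner \<Omega> (wgrad \<Omega> (\<mu> s)) v) \<le>
          H1_norm \<Omega> (\<lambda>x. S k s x - \<mu> s x) * L2_norm \<Omega> v" for k
      proof -
        let ?d = "\<lambda>x. S k s x - \<mu> s x" and ?e = "\<lambda>x. wgrad \<Omega> (S k s) x - wgrad \<Omega> (\<mu> s) x"
        have e: "?e \<in> L2 \<Omega>" by (intro L2_diff wgrad_L2 Sk elim(3))
        have d: "wgrad \<Omega> ?d \<in> L2 \<Omega>" by (intro wgrad_L2 H1_diff \<Omega> Sk elim(3))
        have "L2_inner \<Omega> (wgrad \<Omega> (S k s)) v - L2_inner \<Omega> (wgrad \<Omega> (\<mu> s)) v = L2_inner \<Omega> ?e v"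
          using L2_inner_diff_left[OF wgrad_L2[OF Sk] wgrad_L2[OF elim(3)] v] by simp
        also have "norm \<dots> \<le> L2_norm \<Omega> ?e * L2_norm \<Omega> v"
          unfolding real_norm_def by (rule L2_Cauchy_Schwarz[OF e v])
        also have "L2_norm \<Omega> ?e = L2_norm \<Omega> (wgrad \<Omega> ?d)"
          by (rule L2_norm_cong_AE[OF d e wgrad_diff[OF \<Omega> Sk elim(3)], symmetric])
        also have "L2_norm \<Omega> (wgrad \<Omega> ?d) * L2_norm \<Omega> v \<le> H1_norm \<Omega> ?d * L2_norm \<Omega> v"
          by (intro mult_right_mono L2_norm_wgrad_le_H1_norm L2_norm_nonneg)
        finally show ?thesis .
      qed
      have "(\<lambda>k. H1_norm \<Omega> (\<lambda>x. S k s x - \<mu> s x) * L2_norm \<Omega> v) \<longlonglongrightarrow> 0"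
        using elim(2) by (rule tendsto_mult_left_zero)
      then have "(\<lambda>k. L2_inner \<Omega> (wgrad \<Omega> (S k s)) v - L2_inner \<Omega> (wgrad \<Omega> (\<mu> s)) v) \<longlonglongrightarrow> 0"
        by (rule Lim_null_comparison[OF always_eventually[OF allI[OF bound]]])
      then show ?case by (simp add: LIM_zero_iff)
    qed
  qed simp
qed

lemma L2_inner_time_continuous:
  assumes \<phi>: "\<phi> \<in> time_continuous T (L2 \<Omega>) (L2_norm \<Omega>)" and \<zeta>: "\<zeta> \<in> L2 \<Omega>"
  shows "continuous_on {0..T} (\<lambda>t. L2_inner \<Omega> (\<phi> t) \<zeta>)"
  unfolding continuous_on_def
proof
  fix t assume t: "t \<in> {0..T}"
  have L2: "\<And>s. s \<in> {0..T} \<Longrightarrow> \<phi> s \<in> L2 \<Omega>"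
    and lim: "((\<lambda>s. L2_norm \<Omega> (\<lambda>x. \<phi> s x - \<phi> t x)) \<longlongrightarrow> 0) (at t within {0..T})"
    using \<phi> t by (auto simp: time_continuous_def)
  have "((\<lambda>s. L2_inner \<Omega> (\<phi> s) \<zeta> - L2_inner \<Omega> (\<phi> t) \<zeta>) \<longlongrightarrow> 0) (at t within {0..T})"
  proof (rule Lim_null_comparison)
    show "((\<lambda>s. L2_norm \<Omega> (\<lambda>x. \<phi> s x - \<phi> t x) * L2_norm \<Omega> \<zeta>) \<longlongrightarrow> 0) (at t within {0..T})"
      using lim by (rule tendsto_mult_left_zero)
    show "\<forall>\<^sub>F s in at t within {0..T}. norm (L2_inner \<Omega> (\<phi> s) \<zeta> - L2_inner \<Omega> (\<phi> t) \<zeta>) \<le>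
        L2_norm \<Omega> (\<lambda>x. \<phi> s x - \<phi> t x) * L2_norm \<Omega> \<zeta>"
      unfolding eventually_at_filter
    proof (intro always_eventually allI impI)
      fix s assume "s \<in> {0..T}"
      then show "norm (L2_inner \<Omega> (\<phi> s) \<zeta> - L2_inner \<Omega> (\<phi> t) \<zeta>) \<le>
          L2_norm \<Omega> (\<lambda>x. \<phi> s x - \<phi> t x) * L2_norm \<Omega> \<zeta>"
        using L2_Cauchy_Schwarz[OF L2_diff[OF L2 L2] \<zeta>, of s t] t
        by (simp add: L2_inner_diff_left L2 \<zeta>)
    qed
  qed
  then show "((\<lambda>s. L2_inner \<Omega> (\<phi> s) \<zeta>) \<longlongrightarrow> L2_inner \<Omega> (\<phi> t) \<zeta>) (at t within {0..T})"
    by (simp add: LIM_zero_iff)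
qed

lemma L2_norm_time_continuous_diff:
  assumes \<phi>: "\<phi> \<in> time_continuous T (L2 \<Omega>) (L2_norm \<Omega>)"
    and \<psi>: "\<psi> \<in> time_continuous T (L2 \<Omega>) (L2_norm \<Omega>)"
  shows "continuous_on {0..T} (\<lambda>t. L2_norm \<Omega> (\<lambda>x. \<phi> t x - \<psi> t x))"
  unfolding continuous_on_def
proof
  fix t assume t: "t \<in> {0..T}"
  have L2: "\<And>s. s \<in> {0..T} \<Longrightarrow> \<phi> s \<in> L2 \<Omega>" "\<And>s. s \<in> {0..T} \<Longrightarrow> \<psi> s \<in> L2 \<Omega>"
    and lim: "((\<lambda>s. L2_norm \<Omega> (\<lambda>x. \<phi> s x - \<phi> t x)) \<longlongrightarrow> 0) (at t within {0..T})"
      "((\<lambda>s. L2_norm \<Omega> (\<lambda>x. \<psi> s x - \<psi> t x)) \<longlongrightarrow> 0) (at t within {0..T})"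
    using \<phi> \<psi> t by (auto simp: time_continuous_def)
  let ?n = "\<lambda>s. L2_norm \<Omega> (\<lambda>x. \<phi> s x - \<psi> s x)"
  have "((\<lambda>s. ?n s - ?n t) \<longlongrightarrow> 0) (at t within {0..T})"
  proof (rule Lim_null_comparison)
    show "((\<lambda>s. L2_norm \<Omega> (\<lambda>x. \<phi> s x - \<phi> t x) + L2_norm \<Omega> (\<lambda>x. \<psi> s x - \<psi> t x)) \<longlongrightarrow> 0) (at t within {0..T})"
      using tendsto_add[OF lim] by simp
    show "\<forall>\<^sub>F s in at t within {0..T}. norm (?n s - ?n t) \<le>
        L2_norm \<Omega> (\<lambda>x. \<phi> s x - \<phi> t x) + L2_norm \<Omega> (\<lambda>x. \<psi> s x - \<psi> t x)"
      unfolding eventually_at_filter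
    proof (intro always_eventually allI impI)
      fix s assume s: "s \<in> {0..T}"
      have "norm (?n s - ?n t) \<le> L2_norm \<Omega> (\<lambda>x. (\<phi> s x - \<psi> s x) - (\<phi> t x - \<psi> t x))"
        unfolding real_norm_def using s t by (intro L2_norm_reverse_triangle L2_diff L2)
      also have "(\<lambda>x. (\<phi> s x - \<psi> s x) - (\<phi> t x - \<psi> t x)) = (\<lambda>x. (\<phi> s x - \<phi> t x) + (\<psi> t x - \<psi> s x))"
        by (rule ext) simp
      also have "L2_norm \<Omega> \<dots> \<le> L2_norm \<Omega> (\<lambda>x. \<phi> s x - \<phi> t x) + L2_norm \<Omega> (\<lambda>x. \<psi> s x - \<psi> t x)"
        using L2_norm_triangle[OF L2_diff[OF L2(1)[OF s] L2(1)[OF t]] L2_diff[OF L2(2)[OF t] L2(2)[OF s]]]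
        by (simp add: L2_norm_minus_commute[of \<Omega> "\<psi> t" "\<psi> s"])
      finally show "norm (?n s - ?n t) \<le>
          L2_norm \<Omega> (\<lambda>x. \<phi> s x - \<phi> t x) + L2_norm \<Omega> (\<lambda>x. \<psi> s x - \<psi> t x)" .
    qed
  qed
  then show "(?n \<longlongrightarrow> ?n t) (at t within {0..T})"
    by (simp add: LIM_zero_iff)
qed

lemma weak_equations_constant_mobility:
  assumes "weak_equations \<Omega> T A M P \<phi> \<mu> \<phi>\<^sub>t" and M: "\<And>p s. M p s = m"
  shows "AE t in lebesgue_on {0<..<T}. \<forall>\<zeta>\<in>H1 \<Omega>.
      \<phi>\<^sub>t t \<zeta> = - m * L2_inner \<Omega> (wgrad \<Omega> (\<mu> t)) (wgrad \<Omega> \<zeta>)"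
    and "AE t in lebesgue_on {0<..<T}. \<forall>\<eta>\<in>H1 \<Omega>. L2_inner \<Omega> (\<mu> t) \<eta> =
      (\<integral>x. grad A (wgrad \<Omega> (\<phi> t) x) \<bullet> wgrad \<Omega> \<eta> x + deriv (pot P) (\<phi> t x) * \<eta> x \<partial>lebesgue_on \<Omega>)"
proof -
  have eq: "AE t in lebesgue_on {0<..<T}. \<forall>\<zeta>\<in>H1 \<Omega>. \<forall>\<eta>\<in>H1 \<Omega>.
        \<phi>\<^sub>t t \<zeta> = - (\<integral>x. m * (wgrad \<Omega> (\<mu> t) x \<bullet> wgrad \<Omega> \<zeta> x) \<partial>lebesgue_on \<Omega>) \<and>
        (\<integral>x. \<mu> t x * \<eta> x \<partial>lebesgue_on \<Omega>) =
          (\<integral>x. grad A (wgrad \<Omega> (\<phi> t) x) \<bullet> wgrad \<Omega> \<eta> x + deriv (pot P) (\<phi> t x) * \<eta> x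
             \<partial>lebesgue_on \<Omega>)"
    using assms(1) unfolding weak_equations_def M by (rule AE_lebesgue_on_subset) auto
  show "AE t in lebesgue_on {0<..<T}. \<forall>\<zeta>\<in>H1 \<Omega>.
      \<phi>\<^sub>t t \<zeta> = - m * L2_inner \<Omega> (wgrad \<Omega> (\<mu> t)) (wgrad \<Omega> \<zeta>)"
    using eq by eventually_elim (simp add: L2_inner_def)
  show "AE t in lebesgue_on {0<..<T}. \<forall>\<eta>\<in>H1 \<Omega>. L2_inner \<Omega> (\<mu> t) \<eta> =
      (\<integral>x. grad A (wgrad \<Omega> (\<phi> t) x) \<bullet> wgrad \<Omega> \<eta> x + deriv (pot P) (\<phi> t x) * \<eta> x \<partial>lebesgue_on \<Omega>)"
    using eq by eventually_elim (simp add: L2_inner_def)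
qed

lemma integrable_L2_inner_wgrad:
  assumes \<Omega>: "open \<Omega>" "\<Omega> \<in> lmeasurable"
    and \<mu>: "\<mu> \<in> Bochner_L2 T (H1 \<Omega>) (H1_norm \<Omega>)" and v: "v \<in> L2 \<Omega>"
  shows "integrable (lebesgue_on {0<..<T}) (\<lambda>s. L2_inner \<Omega> (wgrad \<Omega> (\<mu> s)) v)"
proof (rule Bochner_Integration.integrable_bound)
  have "integrable (lebesgue_on {0<..<T}) (\<lambda>s. H1_norm \<Omega> (\<mu> s))"
    using L2_integrable_norm(1)[OF _ Bochner_L2_norm_L2[OF \<mu> H1_norm_nonneg]] by (simp add: H1_norm_nonneg)
  then show "integrable (lebesgue_on {0<..<T}) (\<lambda>s. H1_norm \<Omega> (\<mu> s) * L2_norm \<Omega> v)" by simp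
  show "AE s in lebesgue_on {0<..<T}. norm (L2_inner \<Omega> (wgrad \<Omega> (\<mu> s)) v) \<le>
      norm (H1_norm \<Omega> (\<mu> s) * L2_norm \<Omega> v)"
    using Bochner_L2_AE_mem[OF \<mu>]
  proof eventually_elim
    case (elim s)
    have "\<bar>L2_inner \<Omega> (wgrad \<Omega> (\<mu> s)) v\<bar> \<le> L2_norm \<Omega> (wgrad \<Omega> (\<mu> s)) * L2_norm \<Omega> v"
      by (rule L2_Cauchy_Schwarz[OF wgrad_L2[OF elim] v])
    also have "\<dots> \<le> H1_norm \<Omega> (\<mu> s) * L2_norm \<Omega> v"
      by (intro mult_right_mono L2_norm_wgrad_le_H1_norm L2_norm_nonneg)
    finally show ?case by simp
  qed
qed (rule L2_inner_wgrad_measurable[OF assms])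

text \<open>By the first equation the flux term is a version of the time derivative paired with
  \<open>\<zeta>\<close>; the increment formula then applies to the continuous function
  \<open>L2_inner \<Omega> (\<phi> t) \<zeta>\<close> of time.\<close>

lemma weak_solution_increment:
  assumes \<Omega>: "open \<Omega>" "\<Omega> \<in> lmeasurable"
    and reg: "solution_regularity \<Omega> T P \<phi> \<mu> \<phi>\<^sub>t"
    and eq: "weak_equations \<Omega> T A M P \<phi> \<mu> \<phi>\<^sub>t" and M: "\<And>p s. M p s = m"
    and \<zeta>: "\<zeta> \<in> H1 \<Omega>" and t: "t \<in> {0..T}"
  shows "L2_inner \<Omega> (\<phi> t) \<zeta> - L2_inner \<Omega> (\<phi> 0) \<zeta> =
    - m * (\<integral>s. indicat_real {0<..<t} s * L2_inner \<Omega> (wgrad \<Omega> (\<mu> s)) (wgrad \<Omega> \<zeta>) \<partial>lebesgue_on {0<..<T})"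
proof -
  let ?\<psi> = "\<lambda>s. - m * L2_inner \<Omega> (wgrad \<Omega> (\<mu> s)) (wgrad \<Omega> \<zeta>)"
  have \<mu>: "\<mu> \<in> Bochner_L2 T (H1 \<Omega>) (H1_norm \<Omega>)"
    and \<phi>: "\<phi> \<in> time_continuous T (L2 \<Omega>) (L2_norm \<Omega>)"
    and deriv: "is_time_derivative \<Omega> T \<phi> \<phi>\<^sub>t"
    using reg by (auto simp: solution_regularity_def)
  have int: "integrable (lebesgue_on {0<..<T}) ?\<psi>"
    by (intro integrable_mult_right integrable_L2_inner_wgrad \<Omega> \<mu> wgrad_L2 \<zeta>)
  have AE: "AE s in lebesgue_on {0<..<T}. ?\<psi> s = \<phi>\<^sub>t s \<zeta>"
    using weak_equations_constant_mobility(1)[OF eq M] by eventually_elim (use \<zeta> in simp)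
  \<comment> \<open>Measurability of the pairing is inherited from the flux term, with which it
    agrees almost everywhere.\<close>
  have meas: "(\<lambda>s. \<phi>\<^sub>t s \<zeta>) \<in> borel_measurable (lebesgue_on {0<..<T})"
    by (rule borel_measurable_lebesgue_on_AE[OF _ borel_measurable_integrable[OF int] AE]) simp
  have "L2_inner \<Omega> (\<phi> t) \<zeta> - L2_inner \<Omega> (\<phi> 0) \<zeta> =
      (\<integral>s. indicat_real {0<..<t} s * ?\<psi> s \<partial>lebesgue_on {0<..<T})"
  proof (rule weak_derivative_increment[OF _ int _ t])
    show "continuous_on {0..T} (\<lambda>t. L2_inner \<Omega> (\<phi> t) \<zeta>)"
      by (rule L2_inner_time_continuous[OF \<phi> H1_imp_L2[OF \<zeta>]])
    fix \<theta> assume \<theta>: "\<theta> \<in> test_functions {0<..<T}"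
    have "\<theta> \<in> borel_measurable borel"
      using Ck_imp_continuous_on[OF test_functions_Ck[OF \<theta>]] by (rule borel_measurable_continuous_onI)
    then have \<theta>m: "\<theta> \<in> borel_measurable (lebesgue_on {0<..<T})"
      by (intro measurable_restrict_space1 measurable_completion) simp
    have "(\<integral>t. \<theta> t * \<phi>\<^sub>t t \<zeta> \<partial>lebesgue_on {0<..<T}) = (\<integral>t. \<theta> t * ?\<psi> t \<partial>lebesgue_on {0<..<T})"
    proof (rule integral_cong_AE)
      show "(\<lambda>t. \<theta> t * \<phi>\<^sub>t t \<zeta>) \<in> borel_measurable (lebesgue_on {0<..<T})"
        by (rule borel_measurable_times[OF \<theta>m meas])
      show "(\<lambda>t. \<theta> t * ?\<psi> t) \<in> borel_measurable (lebesgue_on {0<..<T})"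
        by (rule borel_measurable_times[OF \<theta>m borel_measurable_integrable[OF int]])
      show "AE t in lebesgue_on {0<..<T}. \<theta> t * \<phi>\<^sub>t t \<zeta> = \<theta> t * ?\<psi> t"
        using AE by eventually_elim simp
    qed
    then show "(\<integral>t. deriv \<theta> t * L2_inner \<Omega> (\<phi> t) \<zeta> \<partial>lebesgue_on {0<..<T}) =
        - (\<integral>t. \<theta> t * ?\<psi> t \<partial>lebesgue_on {0<..<T})"
      using deriv \<theta> \<zeta> by (simp add: is_time_derivative_def L2_functional_def L2_inner_def)
  qed
  also have "\<dots> = (\<integral>s. - m * (indicat_real {0<..<t} s * L2_inner \<Omega> (wgrad \<Omega> (\<mu> s)) (wgrad \<Omega> \<zeta>))
      \<partial>lebesgue_on {0<..<T})"
    by (simp add: mult.left_commute)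
  also have "\<dots> = - m * (\<integral>s. indicat_real {0<..<t} s * L2_inner \<Omega> (wgrad \<Omega> (\<mu> s)) (wgrad \<Omega> \<zeta>)
      \<partial>lebesgue_on {0<..<T})"
    by (rule Bochner_Integration.integral_mult_right_zero)
  finally show ?thesis .
qed

text \<open>Both equations are tested with the difference of the phase fields and the integrands are
  compared pointwise. \<open>wgrad_diff\<close> makes strong monotonicity applicable, and linear
  growth of \<open>grad A\<close> makes every term integrable.\<close>

lemma chemical_potential_one_sided:
  fixes A :: "'a::euclidean_space \<Rightarrow> real"
  assumes \<Omega>: "open \<Omega>" "\<Omega> \<in> lmeasurable"
    and A: "Ck 1 A" and hom: "\<And>l p. l > 0 \<Longrightarrow> A (l *\<^sub>R p) = l\<^sup>2 * A p"
    and mono: "\<And>p q. (grad A p - grad A q) \<bullet> (p - q) \<ge> a\<^sub>0 * (norm (p - q))\<^sup>2"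
    and u: "u\<^sub>1 \<in> H1 \<Omega>" "u\<^sub>2 \<in> H1 \<Omega>"
    and \<mu>: "\<mu>\<^sub>1 \<in> L2 \<Omega>" "\<mu>\<^sub>2 \<in> L2 \<Omega>"
    and f: "(\<lambda>x. f (u\<^sub>1 x)) \<in> L2 \<Omega>" "(\<lambda>x. f (u\<^sub>2 x)) \<in> L2 \<Omega>"
    and eq1: "\<And>\<eta>. \<eta> \<in> H1 \<Omega> \<Longrightarrow> L2_inner \<Omega> \<mu>\<^sub>1 \<eta> =
      (\<integral>x. grad A (wgrad \<Omega> u\<^sub>1 x) \<bullet> wgrad \<Omega> \<eta> x + f (u\<^sub>1 x) * \<eta> x \<partial>lebesgue_on \<Omega>)"
    and eq2: "\<And>\<eta>. \<eta> \<in> H1 \<Omega> \<Longrightarrow> L2_inner \<Omega> \<mu>\<^sub>2 \<eta> =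
      (\<integral>x. grad A (wgrad \<Omega> u\<^sub>2 x) \<bullet> wgrad \<Omega> \<eta> x + f (u\<^sub>2 x) * \<eta> x \<partial>lebesgue_on \<Omega>)"
    and L: "AE x in lebesgue_on \<Omega>. - L * (u\<^sub>1 x - u\<^sub>2 x)\<^sup>2 \<le> (f (u\<^sub>1 x) - f (u\<^sub>2 x)) * (u\<^sub>1 x - u\<^sub>2 x)"
  shows "a\<^sub>0 * (L2_norm \<Omega> (wgrad \<Omega> (\<lambda>x. u\<^sub>1 x - u\<^sub>2 x)))\<^sup>2 - L * (L2_norm \<Omega> (\<lambda>x. u\<^sub>1 x - u\<^sub>2 x))\<^sup>2
    \<le> L2_inner \<Omega> (\<lambda>x. \<mu>\<^sub>1 x - \<mu>\<^sub>2 x) (\<lambda>x. u\<^sub>1 x - u\<^sub>2 x)"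
proof -
  let ?\<eta> = "\<lambda>x. u\<^sub>1 x - u\<^sub>2 x" and ?w = "wgrad \<Omega> (\<lambda>x. u\<^sub>1 x - u\<^sub>2 x)"
  let ?G1 = "\<lambda>x. grad A (wgrad \<Omega> u\<^sub>1 x)" and ?G2 = "\<lambda>x. grad A (wgrad \<Omega> u\<^sub>2 x)"
  have \<eta>H: "?\<eta> \<in> H1 \<Omega>" by (rule H1_diff[OF \<Omega>(2) u])
  note \<eta> = H1_imp_L2[OF \<eta>H] and w = wgrad_L2[OF \<eta>H]
  have G: "?G1 \<in> L2 \<Omega>" "?G2 \<in> L2 \<Omega>"
    by (intro grad_compose_L2[OF A hom] wgrad_L2 u; simp)+
  have int1: "integrable (lebesgue_on \<Omega>) (\<lambda>x. ?G1 x \<bullet> ?w x)"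
    "integrable (lebesgue_on \<Omega>) (\<lambda>x. ?G2 x \<bullet> ?w x)"
    by (intro L2_integrable_inner G w)+
  have int2: "integrable (lebesgue_on \<Omega>) (\<lambda>x. f (u\<^sub>1 x) * ?\<eta> x)"
    "integrable (lebesgue_on \<Omega>) (\<lambda>x. f (u\<^sub>2 x) * ?\<eta> x)"
    using L2_integrable_inner[OF f(1) \<eta>] L2_integrable_inner[OF f(2) \<eta>] by simp_all
  have int3: "integrable (lebesgue_on \<Omega>) (\<lambda>x. (norm (?w x))\<^sup>2)"
    "integrable (lebesgue_on \<Omega>) (\<lambda>x. (?\<eta> x)\<^sup>2)"
    using L2_integrable_norm_square[OF w] L2_integrable_norm_square[OF \<eta>] by simp_all
  have "a\<^sub>0 * (L2_norm \<Omega> ?w)\<^sup>2 - L * (L2_norm \<Omega> ?\<eta>)\<^sup>2 =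
      (\<integral>x. a\<^sub>0 * (norm (?w x))\<^sup>2 - L * (?\<eta> x)\<^sup>2 \<partial>lebesgue_on \<Omega>)"
    using int3 by (simp add: L2_norm_def)
  also have "\<dots> \<le> (\<integral>x. (?G1 x \<bullet> ?w x + f (u\<^sub>1 x) * ?\<eta> x) - (?G2 x \<bullet> ?w x + f (u\<^sub>2 x) * ?\<eta> x)
      \<partial>lebesgue_on \<Omega>)"
  proof (rule integral_mono_AE)
    show "integrable (lebesgue_on \<Omega>) (\<lambda>x. a\<^sub>0 * (norm (?w x))\<^sup>2 - L * (?\<eta> x)\<^sup>2)"
      by (intro Bochner_Integration.integrable_diff integrable_mult_right int3)
    show "integrable (lebesgue_on \<Omega>)
        (\<lambda>x. (?G1 x \<bullet> ?w x + f (u\<^sub>1 x) * ?\<eta> x) - (?G2 x \<bullet> ?w x + f (u\<^sub>2 x) * ?\<eta> x))"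
      by (intro Bochner_Integration.integrable_diff Bochner_Integration.integrable_add int1 int2)
    show "AE x in lebesgue_on \<Omega>. a\<^sub>0 * (norm (?w x))\<^sup>2 - L * (?\<eta> x)\<^sup>2 \<le>
        (?G1 x \<bullet> ?w x + f (u\<^sub>1 x) * ?\<eta> x) - (?G2 x \<bullet> ?w x + f (u\<^sub>2 x) * ?\<eta> x)"
      using L wgrad_diff[OF \<Omega> u]
    proof eventually_elim
      case (elim x)
      have "a\<^sub>0 * (norm (?w x))\<^sup>2 \<le> (?G1 x - ?G2 x) \<bullet> ?w x"
        unfolding elim(2) by (rule mono)
      then show ?case using elim(1) by (simp add: inner_diff_left left_diff_distrib)
    qed
  qed
  also have "\<dots> = L2_inner \<Omega> \<mu>\<^sub>1 ?\<eta> - L2_inner \<Omega> \<mu>\<^sub>2 ?\<eta>"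
    unfolding eq1[OF \<eta>H] eq2[OF \<eta>H]
    by (intro Bochner_Integration.integral_diff Bochner_Integration.integrable_add int1 int2)
  also have "\<dots> = L2_inner \<Omega> (\<lambda>x. \<mu>\<^sub>1 x - \<mu>\<^sub>2 x) ?\<eta>"
    using \<mu> \<eta> by (simp add: L2_inner_diff_left)
  finally show ?thesis .
qed

text \<open>The right sides of the two equations coincide. The difference of the chemical potentials
  lies in \<open>H1 \<Omega>\<close> and may itself be the test function, so its L2 norm is
  zero.\<close>

lemma chemical_potential_unique:
  fixes A :: "'a::euclidean_space \<Rightarrow> real"
  assumes \<Omega>: "open \<Omega>" "\<Omega> \<in> lmeasurable" and A: "Ck 1 A"
    and u: "u\<^sub>1 \<in> H1 \<Omega>" "u\<^sub>2 \<in> H1 \<Omega>" "AE x in lebesgue_on \<Omega>. u\<^sub>1 x = u\<^sub>2 x"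
    and \<mu>: "\<mu>\<^sub>1 \<in> H1 \<Omega>" "\<mu>\<^sub>2 \<in> H1 \<Omega>"
    and f: "(\<lambda>x. f (u\<^sub>1 x)) \<in> L2 \<Omega>" "(\<lambda>x. f (u\<^sub>2 x)) \<in> L2 \<Omega>"
    and eq1: "\<And>\<eta>. \<eta> \<in> H1 \<Omega> \<Longrightarrow> L2_inner \<Omega> \<mu>\<^sub>1 \<eta> =
      (\<integral>x. grad A (wgrad \<Omega> u\<^sub>1 x) \<bullet> wgrad \<Omega> \<eta> x + f (u\<^sub>1 x) * \<eta> x \<partial>lebesgue_on \<Omega>)"
    and eq2: "\<And>\<eta>. \<eta> \<in> H1 \<Omega> \<Longrightarrow> L2_inner \<Omega> \<mu>\<^sub>2 \<eta> =
      (\<integral>x. grad A (wgrad \<Omega> u\<^sub>2 x) \<bullet> wgrad \<Omega> \<eta> x + f (u\<^sub>2 x) * \<eta> x \<partial>lebesgue_on \<Omega>)"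
  shows "AE x in lebesgue_on \<Omega>. \<mu>\<^sub>1 x = \<mu>\<^sub>2 x"
proof -
  let ?\<eta> = "\<lambda>x. \<mu>\<^sub>1 x - \<mu>\<^sub>2 x"
  have \<eta>H: "?\<eta> \<in> H1 \<Omega>" by (rule H1_diff[OF \<Omega>(2) \<mu>])
  note \<eta> = H1_imp_L2[OF \<eta>H] and w = wgrad_L2[OF \<eta>H]
  have meas: "(\<lambda>x. grad A (wgrad \<Omega> u x) \<bullet> wgrad \<Omega> ?\<eta> x + f (u x) * ?\<eta> x) \<in> borel_measurable (lebesgue_on \<Omega>)"
    if "u \<in> H1 \<Omega>" "(\<lambda>x. f (u x)) \<in> L2 \<Omega>" for u
    by (intro borel_measurable_add borel_measurable_inner borel_measurable_times L2_measurable[OF w]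
        L2_measurable[OF \<eta>] L2_measurable[OF that(2)]
        measurable_compose[OF L2_measurable[OF wgrad_L2[OF that(1)]]
          borel_measurable_continuous_onI[OF continuous_on_grad[OF A]]])
  have "L2_inner \<Omega> \<mu>\<^sub>1 ?\<eta> = L2_inner \<Omega> \<mu>\<^sub>2 ?\<eta>"
    unfolding eq1[OF \<eta>H] eq2[OF \<eta>H]
  proof (rule integral_cong_AE)
    show "AE x in lebesgue_on \<Omega>. grad A (wgrad \<Omega> u\<^sub>1 x) \<bullet> wgrad \<Omega> ?\<eta> x + f (u\<^sub>1 x) * ?\<eta> x =
        grad A (wgrad \<Omega> u\<^sub>2 x) \<bullet> wgrad \<Omega> ?\<eta> x + f (u\<^sub>2 x) * ?\<eta> x"
      using u(3) wgrad_cong_AE[OF \<Omega> u] by eventually_elim simp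
  qed (intro meas u f)+
  then have "L2_inner \<Omega> ?\<eta> ?\<eta> = 0"
    by (simp add: L2_inner_diff_left H1_imp_L2 \<mu> \<eta>)
  then have "L2_norm \<Omega> ?\<eta> = 0" by (simp add: L2_norm_square[symmetric])
  from L2_norm_eq_0_imp_AE[OF \<eta> this] show ?thesis by simp
qed

text \<open>Completing the square; the bound is the maximum of the left side over
  \<open>d\<close>.\<close>

lemma quadratic_absorption:
  fixes a d c :: real
  assumes "0 < a"
  shows "c * d - a * d\<^sup>2 \<le> c\<^sup>2 / (4 * a)"
proof -
  have "0 \<le> (2 * a * d - c)\<^sup>2" by simp
  then show ?thesis using assms by (simp add: field_simps power2_eq_square)
qed

theorem theorem2p7:
  fixes \<Omega> :: "(real ^ 'n) set" and T :: real
    and A :: "real ^ 'n \<Rightarrow> real" and a\<^sub>0 :: real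
    and M :: "real ^ 'n \<Rightarrow> real \<Rightarrow> real" and m :: real
    and P :: potential
    and \<phi>\<^sub>0 :: "real ^ 'n \<Rightarrow> real"
    and \<phi>\<^sub>1 \<phi>\<^sub>2 \<mu>\<^sub>1 \<mu>\<^sub>2 :: "real \<Rightarrow> real ^ 'n \<Rightarrow> real"
  assumes dim: "CARD('n) \<in> {2, 3}"
    and domain: "bounded_Lipschitz_domain \<Omega>"
    and T: "T > 0"
    and A_C1: "Ck 1 A"
    and A_pos: "\<And>p. p \<noteq> 0 \<Longrightarrow> A p > 0"
    and A_hom: "\<And>l p. l > 0 \<Longrightarrow> A (l *\<^sub>R p) = l\<^sup>2 * A p"
    and a0: "a\<^sub>0 > 0"
    and A_mono: "\<And>p q. (grad A p - grad A q) \<bullet> (p - q) \<ge> a\<^sub>0 * (norm (p - q))\<^sup>2"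
    and m: "m > 0"
    and M_const: "\<And>p s. M p s = m"
    and init: "\<phi>\<^sub>0 \<in> H1 \<Omega>"
    and potential: "case P of
        Regular F \<Rightarrow> growth_condition F \<and> decomposition_condition F
      | Logarithmic \<theta> \<theta>\<^sub>c \<Rightarrow> \<theta> > 0 \<and> \<theta>\<^sub>c > 0 \<and>
          (AE x in lebesgue_on \<Omega>. \<bar>\<phi>\<^sub>0 x\<bar> \<le> 1) \<and> \<bar>spatial_mean \<Omega> \<phi>\<^sub>0\<bar> < 1"
    and sol1: "weak_solution \<Omega> T A M P \<phi>\<^sub>0 \<phi>\<^sub>1 \<mu>\<^sub>1"
    and sol2: "weak_solution \<Omega> T A M P \<phi>\<^sub>0 \<phi>\<^sub>2 \<mu>\<^sub>2"
  shows "(\<forall>t\<in>{0..T}. AE x in lebesgue_on \<Omega>. \<phi>\<^sub>1 t x = \<phi>\<^sub>2 t x) \<and>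
         (AE t in lebesgue_on {0<..<T}. AE x in lebesgue_on \<Omega>. \<mu>\<^sub>1 t x = \<mu>\<^sub>2 t x)"
proof -
  have \<Omega>: "open \<Omega>" "\<Omega> \<in> lmeasurable"
    using domain by (auto simp: bounded_Lipschitz_domain_def intro: lmeasurable_open)
  obtain \<psi>\<^sub>1 where reg1: "solution_regularity \<Omega> T P \<phi>\<^sub>1 \<mu>\<^sub>1 \<psi>\<^sub>1"
    and eq1: "weak_equations \<Omega> T A M P \<phi>\<^sub>1 \<mu>\<^sub>1 \<psi>\<^sub>1"
    using sol1 unfolding weak_solution_def by blast
  obtain \<psi>\<^sub>2 where reg2: "solution_regularity \<Omega> T P \<phi>\<^sub>2 \<mu>\<^sub>2 \<psi>\<^sub>2"
    and eq2: "weak_equations \<Omega> T A M P \<phi>\<^sub>2 \<mu>\<^sub>2 \<psi>\<^sub>2"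
    using sol2 unfolding weak_solution_def by blast
  have \<mu>1: "\<mu>\<^sub>1 \<in> Bochner_L2 T (H1 \<Omega>) (H1_norm \<Omega>)" and \<mu>2: "\<mu>\<^sub>2 \<in> Bochner_L2 T (H1 \<Omega>) (H1_norm \<Omega>)"
    and \<phi>1: "\<phi>\<^sub>1 \<in> time_continuous T (L2 \<Omega>) (L2_norm \<Omega>)"
    and \<phi>2: "\<phi>\<^sub>2 \<in> time_continuous T (L2 \<Omega>) (L2_norm \<Omega>)"
    using reg1 reg2 by (auto simp: solution_regularity_def)
  have \<phi>1_H1: "AE t in lebesgue_on {0<..<T}. \<phi>\<^sub>1 t \<in> H1 \<Omega>"
    and \<phi>2_H1: "AE t in lebesgue_on {0<..<T}. \<phi>\<^sub>2 t \<in> H1 \<Omega>"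
    using reg1 reg2 by (auto simp: solution_regularity_def Bochner_Linf_def strongly_measurable_def)
  have F1: "AE t in lebesgue_on {0<..<T}. (\<lambda>x. deriv (pot P) (\<phi>\<^sub>1 t x)) \<in> L2 \<Omega>"
    and F2: "AE t in lebesgue_on {0<..<T}. (\<lambda>x. deriv (pot P) (\<phi>\<^sub>2 t x)) \<in> L2 \<Omega>"
    using reg1 reg2 by (auto simp: solution_regularity_def dest!: Bochner_L2_AE_mem)
  have adm1: "AE t in lebesgue_on {0<..<T}. AE x in lebesgue_on \<Omega>. admissible_value P (\<phi>\<^sub>1 t x)"
    and adm2: "AE t in lebesgue_on {0<..<T}. AE x in lebesgue_on \<Omega>. admissible_value P (\<phi>\<^sub>2 t x)"
    using reg1 reg2 by (cases P; simp add: solution_regularity_def admissible_value_def)+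
  have \<mu>1_H1: "AE t in lebesgue_on {0<..<T}. \<mu>\<^sub>1 t \<in> H1 \<Omega>"
    and \<mu>2_H1: "AE t in lebesgue_on {0<..<T}. \<mu>\<^sub>2 t \<in> H1 \<Omega>"
    using \<mu>1 \<mu>2 by (auto dest: Bochner_L2_AE_mem)
  have \<phi>_L2: "\<phi>\<^sub>1 t \<in> L2 \<Omega>" "\<phi>\<^sub>2 t \<in> L2 \<Omega>" if "t \<in> {0..T}" for t
    using \<phi>1 \<phi>2 that by (auto simp: time_continuous_def)
  have interior: "AE t in lebesgue_on {0<..<T}. t \<in> {0<..<T}"
    using AE_space[of "lebesgue_on {0<..<T}"] by simp
  obtain L where "0 \<le> L" and L: "\<And>a b. admissible_value P a \<Longrightarrow> admissible_value P b \<Longrightarrow>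
      - L * (a - b)\<^sup>2 \<le> (deriv (pot P) a - deriv (pot P) b) * (a - b)"
    using potential_one_sided[of P] potential by (auto split: potential.splits)

  \<comment> \<open>\<open>L2_curve\<close> asks for square integrability at every time, whereas the
    chemical potentials lie in \<open>H1 \<Omega>\<close> only for almost every time. Elsewhere
    \<open>wgrad\<close> may be arbitrary, so \<open>g\<close> is set to zero there.\<close>
  define g where "g s = (if \<mu>\<^sub>1 s \<in> H1 \<Omega> \<and> \<mu>\<^sub>2 s \<in> H1 \<Omega>
    then (\<lambda>x. wgrad \<Omega> (\<mu>\<^sub>1 s) x - wgrad \<Omega> (\<mu>\<^sub>2 s) x) else (\<lambda>x. 0))" for s
  define \<gamma> where "\<gamma> s = H1_norm \<Omega> (\<mu>\<^sub>1 s) + H1_norm \<Omega> (\<mu>\<^sub>2 s)" for s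
  have g_inner: "AE s in lebesgue_on {0<..<T}.
      L2_inner \<Omega> (wgrad \<Omega> (\<mu>\<^sub>1 s)) v - L2_inner \<Omega> (wgrad \<Omega> (\<mu>\<^sub>2 s)) v = L2_inner \<Omega> (g s) v"
    if v: "v \<in> L2 \<Omega>" for v
    using \<mu>1_H1 \<mu>2_H1 by eventually_elim (simp add: g_def L2_inner_diff_left wgrad_L2 v)
  interpret L2_curve \<Omega> T g \<gamma>
  proof
    show "\<Omega> \<in> lmeasurable" by (rule \<Omega>(2))
    show "g s \<in> L2 \<Omega>" for s by (simp add: g_def L2_diff wgrad_L2 L2_zero)
    show "\<gamma> \<in> L2 {0<..<T}"
      unfolding \<gamma>_def[abs_def] by (rule L2_add[OF Bochner_L2_norm_L2[OF \<mu>1 H1_norm_nonneg] Bochner_L2_norm_L2[OF \<mu>2 H1_norm_nonneg]])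
    show "(\<lambda>s. L2_inner \<Omega> (g s) v) \<in> borel_measurable (lebesgue_on {0<..<T})" if v: "v \<in> L2 \<Omega>" for v
      by (rule borel_measurable_lebesgue_on_AE[OF _ borel_measurable_diff[OF
            L2_inner_wgrad_measurable[OF \<Omega> \<mu>1 v] L2_inner_wgrad_measurable[OF \<Omega> \<mu>2 v]] g_inner[OF v]]) simp
    show "AE s in lebesgue_on {0<..<T}. L2_norm \<Omega> (g s) \<le> \<gamma> s"
      using \<mu>1_H1 \<mu>2_H1
    proof eventually_elim
      case (elim s)
      note w = wgrad_L2[OF elim(1)] wgrad_L2[OF elim(2)]
      have "L2_norm \<Omega> (g s) \<le> L2_norm \<Omega> (wgrad \<Omega> (\<mu>\<^sub>1 s)) + L2_norm \<Omega> (wgrad \<Omega> (\<mu>\<^sub>2 s))"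
        using L2_norm_triangle_diff[OF w(1) L2_zero w(2)] elim
        by (simp add: g_def L2_norm_def)
      then show ?case
        unfolding \<gamma>_def using L2_norm_wgrad_le_H1_norm[of \<Omega>] by (meson add_mono order_trans)
    qed
  qed

  have duality: "L2_inner \<Omega> (\<lambda>x. \<phi>\<^sub>1 t x - \<phi>\<^sub>2 t x) \<zeta> = - m * L2_inner \<Omega> (primitive t) (wgrad \<Omega> \<zeta>)"
    if t: "t \<in> {0..T}" and \<zeta>: "\<zeta> \<in> H1 \<Omega>" for t \<zeta>
  proof -
    let ?v = "wgrad \<Omega> \<zeta>"
    have v: "?v \<in> L2 \<Omega>" by (rule wgrad_L2[OF \<zeta>])
    have zero: "0 \<in> {0..T}" using T by simp
    have i: "AE x in lebesgue_on \<Omega>. \<phi>\<^sub>1 0 x = \<phi>\<^sub>2 0 x"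
    proof -
      have "AE x in lebesgue_on \<Omega>. \<phi>\<^sub>1 0 x = \<phi>\<^sub>0 x" "AE x in lebesgue_on \<Omega>. \<phi>\<^sub>2 0 x = \<phi>\<^sub>0 x"
        using sol1 sol2 by (simp_all add: weak_solution_def)
      then show ?thesis by eventually_elim simp
    qed
    \<comment> \<open>The initial terms cancel in the difference, so the primitive started at zero
      represents it without a constant.\<close>
    have init_eq: "L2_inner \<Omega> (\<phi>\<^sub>1 0) \<zeta> = L2_inner \<Omega> (\<phi>\<^sub>2 0) \<zeta>"
      by (rule L2_inner_cong_AE[OF \<phi>_L2(1)[OF zero] H1_imp_L2[OF \<zeta>] \<phi>_L2(2)[OF zero] H1_imp_L2[OF \<zeta>]
            i AE_I2[OF refl]])
    let ?h1 = "\<lambda>s. L2_inner \<Omega> (wgrad \<Omega> (\<mu>\<^sub>1 s)) ?v" and ?h2 = "\<lambda>s. L2_inner \<Omega> (wgrad \<Omega> (\<mu>\<^sub>2 s)) ?v"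
    have int: "integrable (lebesgue_on {0<..<T}) (\<lambda>s. indicat_real {0<..<t} s * ?h1 s)"
      "integrable (lebesgue_on {0<..<T}) (\<lambda>s. indicat_real {0<..<t} s * ?h2 s)"
      by (rule integrable_indicator_mult[OF integrable_L2_inner_wgrad[OF \<Omega> \<mu>1 v]], simp,
          rule integrable_indicator_mult[OF integrable_L2_inner_wgrad[OF \<Omega> \<mu>2 v]], simp)
    have intg: "integrable (lebesgue_on {0<..<T}) (\<lambda>s. indicat_real {0<..<t} s * L2_inner \<Omega> (g s) ?v)"
      by (intro integrable_indicator_mult integrable_L2_inner_g v) simp
    have "integral_upto t ?h1 - integral_upto t ?h2 =
        (\<integral>s. indicat_real {0<..<t} s * ?h1 s - indicat_real {0<..<t} s * ?h2 s \<partial>lebesgue_on {0<..<T})"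
      unfolding integral_upto_def by (rule Bochner_Integration.integral_diff[OF int, symmetric])
    also have "\<dots> = integral_upto t (\<lambda>s. L2_inner \<Omega> (g s) ?v)"
      unfolding integral_upto_def
    proof (rule integral_cong_AE)
      show "AE s in lebesgue_on {0<..<T}. indicat_real {0<..<t} s * ?h1 s - indicat_real {0<..<t} s * ?h2 s =
          indicat_real {0<..<t} s * L2_inner \<Omega> (g s) ?v"
        using g_inner[OF v] by eventually_elim (simp add: right_diff_distrib[symmetric])
    qed (intro borel_measurable_diff borel_measurable_integrable int intg)+
    also have "\<dots> = L2_inner \<Omega> (primitive t) ?v" by (rule L2_inner_primitive[OF v, symmetric])
    finally have up: "integral_upto t ?h1 - integral_upto t ?h2 = L2_inner \<Omega> (primitive t) ?v" .
    have "L2_inner \<Omega> (\<lambda>x. \<phi>\<^sub>1 t x - \<phi>\<^sub>2 t x) \<zeta> = L2_inner \<Omega> (\<phi>\<^sub>1 t) \<zeta> - L2_inner \<Omega> (\<phi>\<^sub>2 t) \<zeta>"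
      by (rule L2_inner_diff_left[OF \<phi>_L2[OF t] H1_imp_L2[OF \<zeta>]])
    also have "\<dots> = - m * integral_upto t ?h1 - - m * integral_upto t ?h2"
      using weak_solution_increment[OF \<Omega> reg1 eq1 M_const \<zeta> t] weak_solution_increment[OF \<Omega> reg2 eq2 M_const \<zeta> t]
        init_eq by (simp add: integral_upto_def)
    also have "\<dots> = - m * L2_inner \<Omega> (primitive t) ?v"
      unfolding up[symmetric] by (simp add: algebra_simps)
    finally show ?thesis .
  qed
  have norm_bound: "(L2_norm \<Omega> (\<lambda>x. \<phi>\<^sub>1 t x - \<phi>\<^sub>2 t x))\<^sup>2 \<le>
      m * L2_norm \<Omega> (primitive t) * L2_norm \<Omega> (wgrad \<Omega> (\<lambda>x. \<phi>\<^sub>1 t x - \<phi>\<^sub>2 t x))"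
    if t: "t \<in> {0..T}" and H: "\<phi>\<^sub>1 t \<in> H1 \<Omega>" "\<phi>\<^sub>2 t \<in> H1 \<Omega>" for t
  proof -
    let ?w = "wgrad \<Omega> (\<lambda>x. \<phi>\<^sub>1 t x - \<phi>\<^sub>2 t x)"
    have d: "(\<lambda>x. \<phi>\<^sub>1 t x - \<phi>\<^sub>2 t x) \<in> H1 \<Omega>" by (rule H1_diff[OF \<Omega>(2) H])
    have "(L2_norm \<Omega> (\<lambda>x. \<phi>\<^sub>1 t x - \<phi>\<^sub>2 t x))\<^sup>2 = m * - L2_inner \<Omega> (primitive t) ?w"
      unfolding L2_norm_square duality[OF t d] by simp
    also have "\<dots> \<le> m * (L2_norm \<Omega> (primitive t) * L2_norm \<Omega> ?w)"
      using L2_Cauchy_Schwarz[OF primitive_L2[of t] wgrad_L2[OF d]] m by (intro mult_left_mono) auto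
    finally show ?thesis by (simp add: mult.assoc)
  qed
  note chem1 = weak_equations_constant_mobility(2)[OF eq1 M_const]
    and chem2 = weak_equations_constant_mobility(2)[OF eq2 M_const]
  \<comment> \<open>Absorbing \<open>L * m * N * d\<close> into \<open>a\<^sub>0 * d\<^sup>2\<close>
    costs \<open>(L * m * N)\<^sup>2 / (4 * a\<^sub>0)\<close>, which is
    \<open>m * K * N\<^sup>2\<close>; the factor \<open>m\<close> is then cancelled.\<close>
  define K where "K = L\<^sup>2 * m / (4 * a\<^sub>0)"
  have "0 \<le> K" using m a0 by (simp add: K_def)
  have K: "AE t in lebesgue_on {0<..<T}.
      L2_inner \<Omega> (g t) (primitive t) \<le> K * (L2_norm \<Omega> (primitive t))\<^sup>2"
    using interior \<phi>1_H1 \<phi>2_H1 \<mu>1_H1 \<mu>2_H1 F1 F2 adm1 adm2 chem1 chem2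
  proof eventually_elim
    case (elim t)
    let ?\<phi> = "\<lambda>x. \<phi>\<^sub>1 t x - \<phi>\<^sub>2 t x" and ?\<mu> = "\<lambda>x. \<mu>\<^sub>1 t x - \<mu>\<^sub>2 t x"
    define d where "d = L2_norm \<Omega> (wgrad \<Omega> ?\<phi>)"
    define N where "N = L2_norm \<Omega> (primitive t)"
    have t: "t \<in> {0..T}" using elim(1) by simp
    have \<mu>: "?\<mu> \<in> H1 \<Omega>" by (rule H1_diff[OF \<Omega>(2) elim(4,5)])
    have pointwise: "AE x in lebesgue_on \<Omega>. - L * (\<phi>\<^sub>1 t x - \<phi>\<^sub>2 t x)\<^sup>2 \<le>
        (deriv (pot P) (\<phi>\<^sub>1 t x) - deriv (pot P) (\<phi>\<^sub>2 t x)) * (\<phi>\<^sub>1 t x - \<phi>\<^sub>2 t x)"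
      using elim(8,9) by eventually_elim (rule L)
    have "a\<^sub>0 * d\<^sup>2 - L * (L2_norm \<Omega> ?\<phi>)\<^sup>2 \<le> L2_inner \<Omega> ?\<mu> ?\<phi>"
      unfolding d_def
      by (rule chemical_potential_one_sided[OF \<Omega> A_C1 A_hom A_mono elim(2,3) H1_imp_L2[OF elim(4)]
            H1_imp_L2[OF elim(5)] elim(6,7) _ _ pointwise]) (use elim(10,11) in blast)+
    also have "L2_inner \<Omega> ?\<mu> ?\<phi> = - m * L2_inner \<Omega> (primitive t) (wgrad \<Omega> ?\<mu>)"
      by (subst L2_inner_commute) (rule duality[OF t \<mu>])
    \<comment> \<open>Here the gradient of the tested chemical potential becomes the integrand of
      the primitive, giving the pairing of W with W' in its weak form.\<close>
    also have "L2_inner \<Omega> (primitive t) (wgrad \<Omega> ?\<mu>) = L2_inner \<Omega> (primitive t) (g t)"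
    proof (rule L2_inner_cong_AE[OF primitive_L2 wgrad_L2[OF \<mu>] primitive_L2 g_L2 AE_I2[OF refl]])
      show "AE x in lebesgue_on \<Omega>. wgrad \<Omega> ?\<mu> x = g t x"
        using wgrad_diff[OF \<Omega> elim(4,5)] by (simp add: g_def elim(4,5))
    qed
    finally have "m * L2_inner \<Omega> (g t) (primitive t) \<le> L * (L2_norm \<Omega> ?\<phi>)\<^sup>2 - a\<^sub>0 * d\<^sup>2"
      by (subst L2_inner_commute) simp
    also have "\<dots> \<le> L * (m * N * d) - a\<^sub>0 * d\<^sup>2"
      using norm_bound[OF t elim(2,3)] \<open>0 \<le> L\<close>
      by (intro diff_right_mono mult_left_mono) (simp_all add: d_def N_def)
    also have "\<dots> \<le> (L * m * N)\<^sup>2 / (4 * a\<^sub>0)"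
      using quadratic_absorption[OF a0, of "L * m * N" d] by (simp add: mult.assoc)
    also have "\<dots> = m * (K * N\<^sup>2)"
      by (simp add: K_def power2_eq_square)
    finally show ?case using m by (simp add: N_def)
  qed
  have primitive_0: "L2_norm \<Omega> (primitive t) = 0" if "t \<in> {0..T}" for t
    by (rule primitive_norm_eq_0[OF K \<open>0 \<le> K\<close> that])

  \<comment> \<open>This reaches only times at which both phase fields lie in
    \<open>H1 \<Omega>\<close>. Continuity in time of the L2 norm of the difference then covers
    every \<open>t\<close>, end points included.\<close>
  have "AE t in lebesgue_on {0<..<T}. L2_norm \<Omega> (\<lambda>x. \<phi>\<^sub>1 t x - \<phi>\<^sub>2 t x) = 0"
    using interior \<phi>1_H1 \<phi>2_H1
  proof eventually_elim
    case (elim t)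
    then show ?case using norm_bound[of t] primitive_0[of t] by simp
  qed
  then have "L2_norm \<Omega> (\<lambda>x. \<phi>\<^sub>1 t x - \<phi>\<^sub>2 t x) = 0" if "t \<in> {0..T}" for t
    by (rule continuous_AE_eq_0_imp_eq_0[OF T L2_norm_time_continuous_diff[OF \<phi>1 \<phi>2] _ that])
  then have \<phi>_eq: "AE x in lebesgue_on \<Omega>. \<phi>\<^sub>1 t x = \<phi>\<^sub>2 t x" if "t \<in> {0..T}" for t
    using L2_norm_eq_0_imp_AE[OF L2_diff[OF \<phi>_L2[OF that]]] that by simp
  moreover have "AE t in lebesgue_on {0<..<T}. AE x in lebesgue_on \<Omega>. \<mu>\<^sub>1 t x = \<mu>\<^sub>2 t x"
    using interior \<phi>1_H1 \<phi>2_H1 \<mu>1_H1 \<mu>2_H1 F1 F2 chem1 chem2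
  proof eventually_elim
    case (elim t)
    have "AE x in lebesgue_on \<Omega>. \<phi>\<^sub>1 t x = \<phi>\<^sub>2 t x" using elim(1) by (intro \<phi>_eq) simp
    then show ?case
      by (rule chemical_potential_unique[OF \<Omega> A_C1 elim(2,3) _ elim(4-7)]) (use elim(8,9) in blast)+
  qed
  ultimately show ?thesis by blast
qed

end
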